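(* Let $f:\mathbf{R}_+\to\mathbf{R}_+$ be continuous, $F(s):=\int_0^s f(\nu)\,d\nu$, and $$ G(a,b):=\frac{F(a)-F(b)}{a-b}\quad(a\neq b),\qquad G(a,a):=f(a). $$ Let $k\ge1$ be an integer, $\beta_0,\dots,\beta_{k-1}\in\mathbf{R}$ with $\beta_0\ne0$, $\lambda\in\{1,-1\}$ and $\tau>0$. Let $\{R^n,u^n\}$ be a solution of the time-stepping scheme $$ i\,\frac{R^{n+1}-R^n}{\tau}=-\Delta R^{n+1/2}+\lambda\, G\bigl(|R^{n+1}|^2,|R^n|^2\bigr)R^{n+1/2},\qquad R^{n+1/2}:=\frac{R^{n+1}+R^n}{2}, $$ $$ u^{n+1}=\beta_0^{-1}\Bigl(R^{n+1}-\sum_{j=1}^{k-1}\beta_ju^{n+1-j}\Bigr) $$ (the sum being empty if $k=1$) for all $n\ge0$ in the range of the computation, under homogeneous Dirichlet or periodic boundary conditions on $\mathcal{D}$. Define $$ \mathcal{M}^n_g:=\|R^n\|_{L^2(\mathcal{D})}^2,\qquad \mathcal{H}^n_g:=\|\nabla R^n\|_{L^2(\mathcal{D})}^2+\lambda\,\|F(|R^n|^2)\|_{L^1(\mathcal{D})}. $$ Then $\mathcal{M}^n_g=\mathcal{M}^0_g$ and $\mathcal{H}^n_g=\mathcal{H}^0_g$ for all $n\ge1$.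
   Context: $\mathcal{D}\subset\mathbf{R}^d$ ($d=1,2,3$) is a bounded domain, $\mathbf{R}_+=[0,\infty)$, and all functions $R^n,u^n$ are complex valued on $\mathcal{D}$; $i=\sqrt{-1}$. In the homogeneous Dirichlet case $R^n\in H^2(\mathcal{D})\cap H^1_0(\mathcal{D})\cap L^\infty(\mathcal{D})$; in the periodic case $\mathcal{D}$ is a box and $R^n$ is a periodic function of class $H^2\cap L^\infty$. The scheme approximates the nonlinear Schrödinger equation $iu_t=-\Delta u+\lambda f(|u|^2)u$. The two sequences are related by $R^n=\sum_{j=0}^{k-1}\beta_ju^{n-j}$; the starting values of $u$ are given (indexed so that $R^0$ is the first value of the sequence $R^n$ defined by them). *)

theory Defs
  imports "HOL-Analysis.Analysis" "HOL-Library.Extended_Nat"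
begin

abbreviation partial_deriv :: "'a::euclidean_space \<Rightarrow> ('a \<Rightarrow> complex) \<Rightarrow> 'a \<Rightarrow> complex" where
  "partial_deriv e \<phi> x \<equiv> frechet_derivative \<phi> (at x) e"

primrec C_k :: "nat \<Rightarrow> ('a::euclidean_space \<Rightarrow> complex) \<Rightarrow> bool" where
  "C_k 0 \<phi> \<longleftrightarrow> continuous_on UNIV \<phi>"
| "C_k (Suc m) \<phi> \<longleftrightarrow> (\<forall>x. \<phi> differentiable (at x)) \<and> (\<forall>e\<in>Basis. C_k m (partial_deriv e \<phi>))"

definition test_functions :: "'a::euclidean_space set \<Rightarrow> ('a \<Rightarrow> complex) set" where
  "test_functions U = {\<phi>. (\<forall>m. C_k m \<phi>) \<and> compact (closure {x. \<phi> x \<noteq> 0})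
                         \<and> closure {x. \<phi> x \<noteq> 0} \<subseteq> U}"

text \<open>Elements of the function spaces on an open set are represented by functions on the whole space, of which only the
  values almost everywhere on that set matter. The norms are meaningful on functions
  of the corresponding space only (a divergent Bochner integral is 0).\<close>

definition L2 :: "'a::euclidean_space set \<Rightarrow> ('a \<Rightarrow> complex) set" where
  "L2 U = {v \<in> borel_measurable (lebesgue_on U). integrable (lebesgue_on U) (\<lambda>x. (norm (v x))\<^sup>2)}"

definition Linf :: "'a::euclidean_space set \<Rightarrow> ('a \<Rightarrow> complex) set" where
  "Linf U = {v \<in> borel_measurable (lebesgue_on U). \<exists>C. AE x in lebesgue_on U. norm (v x) \<le> C}"

definition L1_norm :: "'a::euclidean_space set \<Rightarrow> ('a \<Rightarrow> real) \<Rightarrow> real" where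
  "L1_norm U v = integral\<^sup>L (lebesgue_on U) (\<lambda>x. \<bar>v x\<bar>)"

definition L2_norm :: "'a::euclidean_space set \<Rightarrow> ('a \<Rightarrow> complex) \<Rightarrow> real" where
  "L2_norm U v = sqrt (integral\<^sup>L (lebesgue_on U) (\<lambda>x. (norm (v x))\<^sup>2))"

definition locally_integrable :: "'a::euclidean_space set \<Rightarrow> ('a \<Rightarrow> complex) \<Rightarrow> bool" where
  "locally_integrable U v \<longleftrightarrow> (\<forall>K. compact K \<and> K \<subseteq> U \<longrightarrow> integrable (lebesgue_on K) v)"

definition is_weak_partial ::
    "'a::euclidean_space set \<Rightarrow> 'a \<Rightarrow> ('a \<Rightarrow> complex) \<Rightarrow> ('a \<Rightarrow> complex) \<Rightarrow> bool" where
  "is_weak_partial U e v g \<longleftrightarrow> locally_integrable U v \<and> locally_integrable U g \<and>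
     (\<forall>\<phi>\<in>test_functions U.
        integral\<^sup>L (lebesgue_on U) (\<lambda>x. v x * partial_deriv e \<phi> x)
          = - integral\<^sup>L (lebesgue_on U) (\<lambda>x. g x * \<phi> x))"

text \<open>A weak partial derivative is unique up to a null set, so the choice of the
  representative is immaterial.\<close>

definition weak_partial :: "'a::euclidean_space set \<Rightarrow> 'a \<Rightarrow> ('a \<Rightarrow> complex) \<Rightarrow> 'a \<Rightarrow> complex" where
  "weak_partial U e v = (SOME g. is_weak_partial U e v g)"

definition weak_laplacian :: "'a::euclidean_space set \<Rightarrow> ('a \<Rightarrow> complex) \<Rightarrow> 'a \<Rightarrow> complex" where
  "weak_laplacian U v x = (\<Sum>e\<in>Basis. weak_partial U e (weak_partial U e v) x)"

definition grad_L2_norm :: "'a::euclidean_space set \<Rightarrow> ('a \<Rightarrow> complex) \<Rightarrow> real" where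
  "grad_L2_norm U v =
     sqrt (integral\<^sup>L (lebesgue_on U) (\<lambda>x. \<Sum>e\<in>Basis. (norm (weak_partial U e v x))\<^sup>2))"

definition H1 :: "'a::euclidean_space set \<Rightarrow> ('a \<Rightarrow> complex) set" where
  "H1 U = {v \<in> L2 U. \<forall>e\<in>Basis. \<exists>g\<in>L2 U. is_weak_partial U e v g}"

definition H1_norm :: "'a::euclidean_space set \<Rightarrow> ('a \<Rightarrow> complex) \<Rightarrow> real" where
  "H1_norm U v = sqrt ((L2_norm U v)\<^sup>2 + (grad_L2_norm U v)\<^sup>2)"

definition H2 :: "'a::euclidean_space set \<Rightarrow> ('a \<Rightarrow> complex) set" where
  "H2 U = {v \<in> H1 U. \<forall>e\<in>Basis. weak_partial U e v \<in> H1 U}"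

definition H1_0 :: "'a::euclidean_space set \<Rightarrow> ('a \<Rightarrow> complex) set" where
  "H1_0 U = {v \<in> H1 U. \<forall>\<epsilon>>0. \<exists>\<phi>\<in>test_functions U. H1_norm U (\<lambda>x. v x - \<phi> x) < \<epsilon>}"

text \<open>Periodic functions of class \<open>H2\<close> with period cell \<open>box a b\<close>. The regularity is
  required on the whole space, so that a jump of the function or of its gradient across
  the faces of the cell is excluded.\<close>

definition H2_per :: "'a::euclidean_space \<Rightarrow> 'a \<Rightarrow> ('a \<Rightarrow> complex) set" where
  "H2_per a b = {v. (\<forall>e\<in>Basis. \<forall>x. v (x + ((b - a) \<bullet> e) *\<^sub>R e) = v x)
                  \<and> (\<forall>U. open U \<and> bounded U \<longrightarrow> v \<in> H2 U)}"

definition primF :: "(real \<Rightarrow> real) \<Rightarrow> real \<Rightarrow> real" where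
  "primF f s = integral {0..s} f"

definition diffG :: "(real \<Rightarrow> real) \<Rightarrow> real \<Rightarrow> real \<Rightarrow> real" where
  "diffG f a b = (if a = b then f a else (primF f a - primF f b) / (a - b))"

definition midpoint_step :: "(nat \<Rightarrow> 'a \<Rightarrow> complex) \<Rightarrow> nat \<Rightarrow> 'a \<Rightarrow> complex" where
  "midpoint_step R n x = (R (Suc n) x + R n x) / 2"

definition mass :: "'a::euclidean_space set \<Rightarrow> ('a \<Rightarrow> complex) \<Rightarrow> real" where
  "mass D v = (L2_norm D v)\<^sup>2"

definition energy ::
    "'a::euclidean_space set \<Rightarrow> real \<Rightarrow> (real \<Rightarrow> real) \<Rightarrow> ('a \<Rightarrow> complex) \<Rightarrow> real" where
  "energy D lam f v = (grad_L2_norm D v)\<^sup>2 + lam * L1_norm D (\<lambda>x. primF f ((norm (v x))\<^sup>2))"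

end

theory Submission
  imports Defs
begin

text \<open>
  Write \<open>r\<close>, \<open>s\<close> for two consecutive values of \<open>R\<close>, let \<open>p = s + r\<close> and \<open>q = s - r\<close>, and let \<open>Q\<close> be
  the nonlinear term of the scheme, which is a real multiple of \<open>p\<close> at almost every point. The scheme
  reads \<open>Q = i q / \<tau> + \<Delta> p / 2\<close>. Take the \<open>L2\<close> inner product with \<open>p\<close> and the imaginary part: \<open>Q\<close>
  contributes nothing because it is a real multiple of \<open>p\<close>, the Laplacian contributes nothing because
  the inner product of \<open>\<Delta> p\<close> with \<open>p\<close> is minus the squared norm of the gradient, and what remains is the
  difference of the two masses divided by \<open>\<tau>\<close>. Take the inner product with \<open>q\<close> and the real part: the
  term \<open>i q / \<tau>\<close> drops out, the Laplacian gives half the decrease of the gradient energy, and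
  \<open>Q\<close> gives half the increase of the potential energy, because the quotient \<open>diffG\<close> is built so that
  \<open>diffG f a b * (a - b) = primF f a - primF f b\<close>. This is \<open>crank_nicolson_step\<close>; an induction on the
  number of steps concludes.

  The analytic input is one integration by parts, \<open>green_formula\<close>: the inner product of the second
  weak derivative of \<open>v\<close> with \<open>w\<close> is minus that of the first derivatives. Since weak derivatives are
  arbitrary representatives picked by a choice operator, everything rests on their uniqueness almost
  everywhere (\<open>du_Bois_Reymond\<close>), hence on a supply of test functions. These are built from the
  function \<open>exp (- 1 / t)\<close>; they approximate the indicator of every open set
  (\<open>test_functions_approx_open\<close>) and are therefore dense in \<open>L2\<close> (\<open>test_functions_dense_L2\<close>).

  Under the Dirichlet condition, the formula holds for test functions by the definition of the weak
  derivative, and \<open>w\<close> is a limit of test functions in the \<open>H1\<close> norm (\<open>integration_by_parts_H1_0\<close>).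

  Under the periodic condition, the integral of a periodic
  function over the cell does not change under a translation by \<open>t e\<close>; writing \<open>T\<close> for that translation,
  \<open>T (z w) - z w = (T z - z) w + z (T w - w) + (T z - z) (T w - w)\<close> therefore has integral zero. The
  difference quotients of \<open>z\<close> and \<open>w\<close> are bounded in \<open>L2\<close> by the norms of the weak derivatives and
  converge weakly to them, so that dividing by \<open>t\<close> and letting \<open>t\<close> tend to 0 gives the formula, the last
  product being of order \<open>t\<^sup>2\<close> (\<open>periodic_integration_by_parts\<close>).
\<close>

section \<open>Differentiability of finite order\<close>


lemma C_k_imp_continuous: "C_k m \<phi> \<Longrightarrow> continuous_on UNIV \<phi>"
  by (cases m) (auto intro!: continuous_at_imp_continuous_on differentiable_imp_continuous_within)

lemma C_k_Suc_imp_C_k: "C_k (Suc m) \<phi> \<Longrightarrow> C_k m \<phi>"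
proof (induction m arbitrary: \<phi>)
  case 0
  then show ?case using C_k_imp_continuous[of "Suc 0" \<phi>] by simp
next
  case (Suc m)
  have "C_k m (partial_deriv e \<phi>)" if "e \<in> Basis" for e
    using Suc.IH Suc.prems that by (metis C_k.simps(2))
  moreover have "\<forall>x. \<phi> differentiable (at x)"
    using Suc.prems by (metis C_k.simps(2))
  ultimately show ?case by simp
qed

lemma C_k_const: "C_k m (\<lambda>x. c)"
proof (induction m arbitrary: c)
  case (Suc m)
  have "partial_deriv e (\<lambda>x::'a. c) = (\<lambda>x. 0)" for e :: 'a
    by (simp add: fun_eq_iff frechet_derivative_const)
  then show ?case using Suc by simp
qed auto

lemma C_k_add:
  "C_k m \<phi> \<Longrightarrow> C_k m \<psi> \<Longrightarrow> C_k m (\<lambda>x. \<phi> x + \<psi> x)"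
proof (induction m arbitrary: \<phi> \<psi>)
  case (Suc m)
  have "frechet_derivative (\<lambda>x. \<phi> x + \<psi> x) (at x)
     = (\<lambda>h. frechet_derivative \<phi> (at x) h + frechet_derivative \<psi> (at x) h)" for x
    using Suc.prems
    by (intro frechet_derivative_at[symmetric] has_derivative_add)
      (auto simp: frechet_derivative_works)
  then have "partial_deriv e (\<lambda>x. \<phi> x + \<psi> x)
      = (\<lambda>x. partial_deriv e \<phi> x + partial_deriv e \<psi> x)" for e
    by (simp add: fun_eq_iff)
  then show ?case using Suc by auto
qed (auto intro!: continuous_intros)

lemma C_k_mult:
  "C_k m \<phi> \<Longrightarrow> C_k m \<psi> \<Longrightarrow> C_k m (\<lambda>x. \<phi> x * \<psi> x)"
proof (induction m arbitrary: \<phi> \<psi>)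
  case (Suc m)
  have "frechet_derivative (\<lambda>x. \<phi> x * \<psi> x) (at x)
     = (\<lambda>h. \<phi> x * frechet_derivative \<psi> (at x) h + frechet_derivative \<phi> (at x) h * \<psi> x)" for x
    using Suc.prems
    by (intro frechet_derivative_at[symmetric] has_derivative_mult)
      (auto simp: frechet_derivative_works)
  then have "partial_deriv e (\<lambda>x. \<phi> x * \<psi> x)
      = (\<lambda>x. \<phi> x * partial_deriv e \<psi> x + partial_deriv e \<phi> x * \<psi> x)" for e
    by (simp add: fun_eq_iff)
  moreover have "C_k m \<phi>" "C_k m \<psi>" using Suc.prems C_k_Suc_imp_C_k by blast+
  ultimately show ?case using Suc by (auto intro!: C_k_add)
qed (auto intro!: continuous_intros)

lemma partial_deriv_cnj:
  assumes "\<phi> differentiable (at x)"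
  shows "partial_deriv e (\<lambda>x. cnj (\<phi> x)) x = cnj (partial_deriv e \<phi> x)"
proof -
  have "frechet_derivative (\<lambda>x. cnj (\<phi> x)) (at x) = (\<lambda>h. cnj (frechet_derivative \<phi> (at x) h))"
    using assms
    by (intro frechet_derivative_at[symmetric] has_derivative_cnj)
      (auto simp: frechet_derivative_works)
  then show ?thesis by simp
qed

lemma C_k_cnj: "C_k m \<phi> \<Longrightarrow> C_k m (\<lambda>x. cnj (\<phi> x))"
proof (induction m arbitrary: \<phi>)
  case (Suc m)
  have "partial_deriv e (\<lambda>x. cnj (\<phi> x)) = (\<lambda>x. cnj (partial_deriv e \<phi> x))" for e
    using Suc.prems by (auto simp: fun_eq_iff partial_deriv_cnj)
  moreover have "(\<lambda>x. cnj (\<phi> x)) differentiable at x" for x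
    using Suc.prems has_derivative_cnj unfolding differentiable_def C_k.simps by blast
  ultimately show ?case using Suc by auto
qed (auto intro!: continuous_intros)

lemma C_k_sum: "finite I \<Longrightarrow> (\<And>i. i \<in> I \<Longrightarrow> C_k m (\<phi> i)) \<Longrightarrow> C_k m (\<lambda>x. \<Sum>i\<in>I. \<phi> i x)"
  by (induction I rule: finite_induct) (auto intro: C_k_const C_k_add)

lemma C_k_prod: "finite I \<Longrightarrow> (\<And>i. i \<in> I \<Longrightarrow> C_k m (\<phi> i)) \<Longrightarrow> C_k m (\<lambda>x. \<Prod>i\<in>I. \<phi> i x)"
  by (induction I rule: finite_induct) (auto intro: C_k_const C_k_mult)

text \<open>One lemma for the two substitutions that occur below: an affine function of one coordinate, inserted
  into a function on the line, and a translation.\<close>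

lemma C_k_affine:
  fixes T :: "'a::euclidean_space \<Rightarrow> 'b::euclidean_space"
  assumes "bounded_linear T"
  shows "C_k m \<phi> \<Longrightarrow> C_k m (\<lambda>x. \<phi> (T x + c))"
proof (induction m arbitrary: \<phi>)
  case 0
  have "continuous_on UNIV (\<lambda>x. T x + c)"
    by (intro continuous_on_add continuous_on_const linear_continuous_on assms)
  with 0 show ?case
    using continuous_on_compose2[of UNIV \<phi> UNIV "\<lambda>x. T x + c"] by simp
next
  case (Suc m)
  have d: "((\<lambda>x. \<phi> (T x + c)) has_derivative (\<lambda>h. frechet_derivative \<phi> (at (T x + c)) (T h))) (at x)" for x
  proof (rule has_derivative_compose[where g=\<phi>])
    show "((\<lambda>x. T x + c) has_derivative T) (at x)"
      by (rule has_derivative_add_const[OF bounded_linear_imp_has_derivative[OF assms]])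
    show "(\<phi> has_derivative frechet_derivative \<phi> (at (T x + c))) (at (T x + c))"
      using Suc.prems by (simp add: frechet_derivative_works)
  qed
  have "partial_deriv e (\<lambda>x. \<phi> (T x + c)) = (\<lambda>x. \<Sum>i\<in>Basis. of_real (T e \<bullet> i) * partial_deriv i \<phi> (T x + c))" for e
  proof
    fix x
    have lin: "linear (frechet_derivative \<phi> (at (T x + c)))"
      using Suc.prems by (auto intro!: linear_frechet_derivative)
    have "partial_deriv e (\<lambda>x. \<phi> (T x + c)) x = frechet_derivative \<phi> (at (T x + c)) (T e)"
      using frechet_derivative_at[OF d[of x]] by metis
    also have "T e = (\<Sum>i\<in>Basis. (T e \<bullet> i) *\<^sub>R i)" by (simp add: euclidean_representation)
    also have "frechet_derivative \<phi> (at (T x + c)) \<dots> = (\<Sum>i\<in>Basis. of_real (T e \<bullet> i) * partial_deriv i \<phi> (T x + c))"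
      by (simp add: linear_sum[OF lin] linear_cmul[OF lin] scaleR_conv_of_real)
    finally show "partial_deriv e (\<lambda>x. \<phi> (T x + c)) x = (\<Sum>i\<in>Basis. of_real (T e \<bullet> i) * partial_deriv i \<phi> (T x + c))" .
  qed
  moreover have "C_k m (\<lambda>x. \<Sum>i\<in>Basis. of_real (T e \<bullet> i) * partial_deriv i \<phi> (T x + c))" for e
    using Suc by (intro C_k_sum C_k_mult C_k_const) auto
  moreover have "(\<lambda>x. \<phi> (T x + c)) differentiable at x" for x
    using d[of x] by (auto simp: differentiable_def)
  ultimately show ?case by auto
qed

section \<open>Smooth bump functions\<close>

text \<open>This family contains \<open>exp (- 1 / t)\<close>, continued by 0, and is closed under differentiation, so that
  the smoothness of that function becomes an induction on the order for all polynomials at once.\<close>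

definition poly_exp :: "real poly \<Rightarrow> real \<Rightarrow> real" where
  "poly_exp p t = (if t > 0 then poly p (1 / t) * exp (- (1 / t)) else 0)"

lemma poly_times_exp_tendsto_0: "((\<lambda>u::real. poly p u * exp (- u)) \<longlongrightarrow> 0) at_top"
proof -
  have "((\<lambda>u::real. u ^ i * exp (- u)) \<longlongrightarrow> 0) at_top" for i
    using tendsto_power_div_exp_0[of i] by (simp add: exp_minus divide_inverse)
  then have "((\<lambda>u. \<Sum>i\<le>degree p. coeff p i * (u ^ i * exp (- u))) \<longlongrightarrow> (\<Sum>i\<le>degree p. coeff p i * 0)) at_top"
    by (intro tendsto_intros)
  then show ?thesis by (simp add: poly_altdef sum_distrib_right mult.assoc)
qed

text \<open>The only critical point is 0. There, with \<open>u = 1 / t\<close>, the difference quotient from the right is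
  \<open>u * poly p u * exp (- u)\<close>, and \<open>u\<close> tends to infinity.\<close>

lemma poly_exp_has_derivative:
  "(poly_exp p has_real_derivative poly_exp ([:0, 0, 1:] * (p - pderiv p)) t) (at t)"
proof -
  consider "t < 0" | "t = 0" | "t > 0" by linarith
  then show ?thesis
  proof cases
    case 1
    have "((\<lambda>t. 0) has_real_derivative 0) (at t)" by simp
    then have "(poly_exp p has_real_derivative 0) (at t)"
      by (rule has_field_derivative_transform_within_open[where S="{..<0}"])
        (use 1 in \<open>auto simp: poly_exp_def\<close>)
    then show ?thesis using 1 by (simp add: poly_exp_def)
  next
    case 2
    have L: "((\<lambda>h. poly_exp p h / h) \<longlongrightarrow> 0) (at_left 0)"
    proof (rule Lim_transform_eventually)
      show "eventually (\<lambda>h. 0 = poly_exp p h / h) (at_left 0)"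
        by (auto simp: eventually_at_filter poly_exp_def)
    qed auto
    have "((\<lambda>h. poly (pCons 0 p) (inverse h) * exp (- inverse h)) \<longlongrightarrow> 0) (at_right 0)"
      by (rule filterlim_compose[OF poly_times_exp_tendsto_0 filterlim_inverse_at_top_right])
    then have R: "((\<lambda>h. poly_exp p h / h) \<longlongrightarrow> 0) (at_right 0)"
    proof (rule Lim_transform_eventually)
      show "eventually (\<lambda>h. poly (pCons 0 p) (inverse h) * exp (- inverse h) = poly_exp p h / h) (at_right 0)"
        by (auto simp: eventually_at_filter poly_exp_def field_simps)
    qed
    have "((\<lambda>h. poly_exp p h / h) \<longlongrightarrow> 0) (at 0)"
      using L R filterlim_split_at by blast
    then show ?thesis using 2 by (simp add: DERIV_def poly_exp_def)
  next
    case 3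
    have "((\<lambda>t. poly p (1 / t) * exp (- (1 / t))) has_real_derivative
       poly_exp ([:0, 0, 1:] * (p - pderiv p)) t) (at t)"
      using 3 by (auto intro!: derivative_eq_intros simp: poly_exp_def field_simps power2_eq_square)
    then show ?thesis
      by (rule has_field_derivative_transform_within_open[where S="{0<..}"])
        (use 3 in \<open>auto simp: poly_exp_def\<close>)
  qed
qed

lemma C_k_poly_exp: "C_k m (\<lambda>t. complex_of_real (poly_exp p t))"
proof (induction m arbitrary: p)
  case 0
  have "continuous_on UNIV (poly_exp p)"
    by (rule DERIV_continuous_on[OF has_field_derivative_at_within[OF poly_exp_has_derivative]])
  then show ?case by (simp add: continuous_on_of_real)
next
  case (Suc m)
  define q where "q = [:0, 0, 1:] * (p - pderiv p)"
  have d: "((\<lambda>t. complex_of_real (poly_exp p t)) has_derivative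
     (\<lambda>h. h *\<^sub>R complex_of_real (poly_exp q t))) (at t)" for t
    using has_vector_derivative_of_real[OF poly_exp_has_derivative[of p t]]
    by (simp only: has_vector_derivative_def q_def)
  have "partial_deriv 1 (\<lambda>t. complex_of_real (poly_exp p t))
      = (\<lambda>t. complex_of_real (poly_exp q t))"
    by (simp add: fun_eq_iff flip: frechet_derivative_at[OF d])
  moreover have "(\<lambda>t. complex_of_real (poly_exp p t)) differentiable at t" for t
    using d[of t] by (auto simp: differentiable_def)
  ultimately show ?case using Suc by simp
qed

text \<open>A smooth approximation of the indicator of \<open>box c d\<close>. Subtracting 1 in the arguments keeps the
  support at distance at least \<open>1 / n\<close> from the faces; the factor \<open>n\<close> drives every factor at a given point of the
  box to 1.\<close>

definition flat_bump :: "nat \<Rightarrow> 'a::euclidean_space \<Rightarrow> 'a \<Rightarrow> 'a \<Rightarrow> real" where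
  "flat_bump n c d x = (\<Prod>e\<in>Basis. poly_exp 1 (real n * (x \<bullet> e - c \<bullet> e) - 1)
                              * poly_exp 1 (real n * (d \<bullet> e - x \<bullet> e) - 1))"

lemma poly_exp_1_bounds: "0 \<le> poly_exp 1 t" "poly_exp 1 t \<le> 1"
  by (auto simp: poly_exp_def)

lemma poly_exp_1_tendsto:
  assumes "s > 0"
  shows "(\<lambda>n. poly_exp 1 (real n * s - 1)) \<longlonglongrightarrow> 1"
proof -
  have "filterlim (\<lambda>n. - 1 + s * real n) at_top sequentially"
    by (intro filterlim_tendsto_add_at_top[OF tendsto_const]
        filterlim_tendsto_pos_mult_at_top[OF tendsto_const assms] filterlim_real_sequentially)
  then have lim: "filterlim (\<lambda>n. real n * s - 1) at_top sequentially"
    by (simp add: algebra_simps)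
  have "((\<lambda>t::real. exp (- (1 / t))) \<longlongrightarrow> exp (- 0)) at_top"
    by (intro tendsto_intros tendsto_divide_0[OF tendsto_const] filterlim_at_top_imp_at_infinity[OF filterlim_ident])
  moreover have "\<forall>\<^sub>F t in at_top. exp (- (1 / t)) = poly_exp 1 t"
    using eventually_gt_at_top[of 0] by eventually_elim (simp add: poly_exp_def)
  ultimately have "(poly_exp 1 \<longlongrightarrow> 1) at_top"
    using Lim_transform_eventually by fastforce
  then show ?thesis by (rule filterlim_compose[OF _ lim])
qed

lemma flat_bump_bounds: "0 \<le> flat_bump n c d x" "flat_bump n c d x \<le> 1"
  unfolding flat_bump_def
  by (rule prod_nonneg prod_le_1, simp add: poly_exp_1_bounds mult_le_one)+

lemma flat_bump_tendsto:
  assumes "x \<in> box c d"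
  shows "(\<lambda>n. flat_bump n c d x) \<longlonglongrightarrow> 1"
proof -
  have "(\<lambda>n. flat_bump n c d x) \<longlonglongrightarrow> (\<Prod>e\<in>(Basis::'a set). 1 * 1)"
    unfolding flat_bump_def
    using assms by (intro tendsto_intros poly_exp_1_tendsto) (auto simp: mem_box)
  then show ?thesis by simp
qed

lemma flat_bump_nonzero:
  assumes "flat_bump n c d x \<noteq> 0"
  shows "n > 0" "x \<in> cbox (c + (1 / real n) *\<^sub>R One) (d - (1 / real n) *\<^sub>R One)"
proof -
  have *: "real n * (x \<bullet> e - c \<bullet> e) - 1 > 0 \<and> real n * (d \<bullet> e - x \<bullet> e) - 1 > 0" if "e \<in> Basis" for e
  proof (rule ccontr)
    assume "\<not> ?thesis"
    then have "poly_exp 1 (real n * (x \<bullet> e - c \<bullet> e) - 1) * poly_exp 1 (real n * (d \<bullet> e - x \<bullet> e) - 1) = 0"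
      by (auto simp: poly_exp_def)
    with that assms show False unfolding flat_bump_def by auto
  qed
  show n: "n > 0"
    using *[OF SOME_Basis] by (cases n) auto
  show "x \<in> cbox (c + (1 / real n) *\<^sub>R One) (d - (1 / real n) *\<^sub>R One)"
    using * n by (auto simp: mem_box inner_simps field_simps less_imp_le)
qed

lemma C_k_flat_bump: "C_k m (\<lambda>x. complex_of_real (flat_bump n c d x))"
proof -
  have 1: "C_k m (\<lambda>x. complex_of_real (poly_exp 1 (real n * (x \<bullet> e - c \<bullet> e) - 1)))" for e
    using C_k_affine[of "\<lambda>x. real n * (x \<bullet> e)" m "\<lambda>t. complex_of_real (poly_exp 1 t)" "- real n * (c \<bullet> e) - 1"]
    by (simp add: C_k_poly_exp bounded_linear_mult_const bounded_linear_const_mult bounded_linear_inner_left algebra_simps)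
  have 2: "C_k m (\<lambda>x. complex_of_real (poly_exp 1 (real n * (d \<bullet> e - x \<bullet> e) - 1)))" for e
    using C_k_affine[of "\<lambda>x. - real n * (x \<bullet> e)" m "\<lambda>t. complex_of_real (poly_exp 1 t)" "real n * (d \<bullet> e) - 1"]
    by (simp add: C_k_poly_exp bounded_linear_minus bounded_linear_const_mult bounded_linear_inner_left algebra_simps)
  show ?thesis
    unfolding flat_bump_def of_real_prod of_real_mult
    by (intro C_k_prod C_k_mult 1 2) auto
qed

lemma test_functionsI:
  assumes "\<And>m. C_k m \<phi>" "compact K" "K \<subseteq> U" "\<And>x. x \<notin> K \<Longrightarrow> \<phi> x = 0"
  shows "\<phi> \<in> test_functions U"
proof -
  have "closure {x. \<phi> x \<noteq> 0} \<subseteq> K"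
  proof (rule closure_minimal)
    show "{x. \<phi> x \<noteq> 0} \<subseteq> K" using assms(4) by blast
  qed (rule compact_imp_closed[OF assms(2)])
  moreover from this have "compact (closure {x. \<phi> x \<noteq> 0})"
    using compact_Int_closed[OF assms(2) closed_closure] by (metis inf.absorb2)
  ultimately show ?thesis using assms(1,3) by (auto simp: test_functions_def)
qed

text \<open>The open set is a union of boxes \<open>B 0, B 1, \<dots>\<close>. If \<open>\<chi> i\<close> approximates the indicator of \<open>B i\<close>, then
  \<open>1 - (1 - \<chi> 0) * \<dots> * (1 - \<chi> (n - 1))\<close> approximates that of the union of the first \<open>n\<close> boxes; the same
  index \<open>n\<close> serves as number of boxes and as sharpness of the bumps.\<close>

lemma test_functions_approx_open:
  fixes S :: "'a::euclidean_space set"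
  assumes "open S"
  obtains \<phi> :: "nat \<Rightarrow> 'a \<Rightarrow> real" where
    "\<And>n. (\<lambda>x. complex_of_real (\<phi> n x)) \<in> test_functions S"
    "\<And>n x. 0 \<le> \<phi> n x" "\<And>n x. \<phi> n x \<le> 1"
    "\<And>x. (\<lambda>n. \<phi> n x) \<longlonglongrightarrow> indicator S x"
proof -
  obtain \<D> where \<D>: "countable \<D>" "\<Union>\<D> = S" "\<And>X. X \<in> \<D> \<Longrightarrow> \<exists>a b. X = box a b"
    using open_countable_Union_open_box[OF assms] by metis
  \<comment> \<open>The empty set is added so that an enumeration exists even for the empty open set.\<close>
  obtain B :: "nat \<Rightarrow> 'a set" where B: "range B = insert {} \<D>"
    using \<D>(1) by (metis countable_insert insert_not_empty range_from_nat_into)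
  have "\<exists>c d. B i = box c d" for i
  proof (cases "B i = {}")
    case True
    then show ?thesis by (metis box_eq_empty(1) inner_zero_left less_irrefl nonempty_Basis some_in_eq order_refl)
  next
    case False
    then have "B i \<in> \<D>" using B by auto
    then show ?thesis using \<D>(3) by blast
  qed
  then obtain c d where cd: "\<And>i. B i = box (c i) (d i)" by metis
  have US: "(\<Union>i. box (c i) (d i)) = S" using B \<D>(2) by (simp flip: cd) 
  define \<phi> where "\<phi> n x = 1 - (\<Prod>i<n. 1 - flat_bump n (c i) (d i) x)" for n x
  show thesis
  proof
    fix n
    let ?K = "\<Union>i<n. cbox (c i + (1 / real n) *\<^sub>R One) (d i - (1 / real n) *\<^sub>R One)"
    show "(\<lambda>x. complex_of_real (\<phi> n x)) \<in> test_functions S"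
    proof (rule test_functionsI)
      have eq: "(\<lambda>x. complex_of_real (\<phi> n x))
        = (\<lambda>x. 1 + (-1) * (\<Prod>i<n. 1 + (-1) * complex_of_real (flat_bump n (c i) (d i) x)))"
        by (simp add: \<phi>_def)
      show "C_k m (\<lambda>x. complex_of_real (\<phi> n x))" for m
        unfolding eq by (intro C_k_add C_k_mult C_k_prod C_k_const C_k_flat_bump) auto
      show "compact ?K" by (intro compact_UN) auto
      have "cbox (c i + (1 / real n) *\<^sub>R One) (d i - (1 / real n) *\<^sub>R One) \<subseteq> box (c i) (d i)" if "i < n" for i
        using that by (intro subset_box_imp) (auto simp: inner_simps) 
      then show "?K \<subseteq> S" using US by blast
      show "complex_of_real (\<phi> n x) = 0" if "x \<notin> ?K" for x
      proof -
        have "flat_bump n (c i) (d i) x = 0" if "i < n" for i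
          using flat_bump_nonzero[of n "c i" "d i" x] that \<open>x \<notin> ?K\<close> by blast
        then show ?thesis by (simp add: \<phi>_def)
      qed
    qed
    have "0 \<le> (\<Prod>i<n. 1 - flat_bump n (c i) (d i) x)" "(\<Prod>i<n. 1 - flat_bump n (c i) (d i) x) \<le> 1" for x
      using flat_bump_bounds by (auto intro!: prod_nonneg prod_le_1 simp: flat_bump_bounds)
    then show "0 \<le> \<phi> n x" "\<phi> n x \<le> 1" for x by (auto simp: \<phi>_def)
  next
    fix x
    show "(\<lambda>n. \<phi> n x) \<longlonglongrightarrow> indicator S x"
    proof (cases "x \<in> S")
      case True
      then obtain i where i: "x \<in> box (c i) (d i)" using US by blast
      have "(\<lambda>n. \<phi> n x) \<longlonglongrightarrow> 1"
      proof (rule tendsto_sandwich[OF _ _ flat_bump_tendsto[OF i] tendsto_const])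
        show "\<forall>\<^sub>F n in sequentially. flat_bump n (c i) (d i) x \<le> \<phi> n x"
          using eventually_gt_at_top[of i]
        proof eventually_elim
          case (elim n)
          have "(\<Prod>j<n. 1 - flat_bump n (c j) (d j) x)
             = (1 - flat_bump n (c i) (d i) x) * (\<Prod>j\<in>{..<n} - {i}. 1 - flat_bump n (c j) (d j) x)"
            using elim by (intro prod.remove) auto
          also have "\<dots> \<le> (1 - flat_bump n (c i) (d i) x) * 1"
            by (intro mult_left_mono prod_le_1) (auto simp: flat_bump_bounds)
          finally show ?case by (simp add: \<phi>_def)
        qed
        show "\<forall>\<^sub>F n in sequentially. \<phi> n x \<le> 1"
          by (intro always_eventually allI) (auto simp: \<phi>_def flat_bump_bounds intro!: prod_nonneg)
      qed
      then show ?thesis using True by simp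
    next
      case False
      have "flat_bump n (c i) (d i) x = 0" for n i
      proof (rule ccontr)
        assume nz: "\<not> ?thesis"
        have "cbox (c i + (1 / real n) *\<^sub>R One) (d i - (1 / real n) *\<^sub>R One) \<subseteq> box (c i) (d i)"
          using flat_bump_nonzero(1)[OF nz] by (intro subset_box_imp) (auto simp: inner_simps)
        then show False using flat_bump_nonzero(2)[OF nz] US False by blast
      qed
      then show ?thesis using False by (simp add: \<phi>_def)
    qed
  qed
qed

section \<open>Square-integrable functions\<close>

text \<open>Completeness of Lebesgue measure: a representative of a weak derivative is measurable as soon as
  another one is.\<close>

lemma borel_measurable_lebesgue_on_AE:
  fixes f g :: "'a::euclidean_space \<Rightarrow> 'b::euclidean_space"
  assumes f: "f \<in> borel_measurable (lebesgue_on S)" and S: "S \<in> sets lebesgue"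
    and eq: "AE x in lebesgue_on S. f x = g x"
  shows "g \<in> borel_measurable (lebesgue_on S)"
proof -
  obtain N where N: "N \<in> null_sets (lebesgue_on S)" "{x \<in> S. f x \<noteq> g x} \<subseteq> N"
    using eq by (elim AE_E) (auto simp: null_sets_def)
  have "f \<in> borel_measurable (lebesgue_on (S - N))"
    using borel_measurable_diff_null[OF N(1) S] f by blast
  then have "g \<in> borel_measurable (lebesgue_on (S - N))"
    using N(2) by (subst measurable_lebesgue_cong[of "S - N" g f]) auto
  then show ?thesis using borel_measurable_diff_null[OF N(1) S] by blast
qed

lemma L2D:
  assumes "v \<in> L2 U"
  shows "v \<in> borel_measurable (lebesgue_on U)" "integrable (lebesgue_on U) (\<lambda>x. (norm (v x))\<^sup>2)"
  using assms by (auto simp: L2_def)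

lemma L2I:
  assumes "v \<in> borel_measurable (lebesgue_on U)" "integrable (lebesgue_on U) w"
    "AE x in lebesgue_on U. (norm (v x))\<^sup>2 \<le> w x"
  shows "v \<in> L2 U"
proof -
  have "integrable (lebesgue_on U) (\<lambda>x. (norm (v x))\<^sup>2)"
  proof (rule Bochner_Integration.integrable_bound[OF assms(2)])
    show "(\<lambda>x. (norm (v x))\<^sup>2) \<in> borel_measurable (lebesgue_on U)"
      using assms(1) by measurable
    show "AE x in lebesgue_on U. norm ((norm (v x))\<^sup>2) \<le> norm (w x)"
      using assms(3) by eventually_elim auto
  qed
  then show ?thesis using assms(1) by (simp add: L2_def)
qed

lemma L2_norm_nonneg: "0 \<le> L2_norm U v"
  by (auto simp: L2_norm_def intro!: integral_nonneg_AE)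

lemma L2_norm_power2: "(L2_norm U v)\<^sup>2 = integral\<^sup>L (lebesgue_on U) (\<lambda>x. (norm (v x))\<^sup>2)"
  by (auto simp: L2_norm_def intro!: integral_nonneg_AE)

lemma L2_mult_integrable:
  assumes "v \<in> L2 U" "w \<in> L2 U"
  shows "integrable (lebesgue_on U) (\<lambda>x. v x * w x)"
proof (rule Bochner_Integration.integrable_bound)
  show "integrable (lebesgue_on U) (\<lambda>x. (norm (v x))\<^sup>2 + (norm (w x))\<^sup>2)"
    using assms by (intro Bochner_Integration.integrable_add L2D)
  show "(\<lambda>x. v x * w x) \<in> borel_measurable (lebesgue_on U)"
    using L2D(1)[OF assms(1)] L2D(1)[OF assms(2)] by measurable
  have "a * b \<le> a\<^sup>2 + b\<^sup>2" for a b :: real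
    using sum_squares_bound[of a b] zero_le_power2[of "a - b"] zero_le_power2[of "a + b"]
    by (simp add: power2_diff power2_sum)
  then show "AE x in lebesgue_on U. norm (v x * w x) \<le> norm ((norm (v x))\<^sup>2 + (norm (w x))\<^sup>2)"
    by (simp add: norm_mult)
qed

lemma L2_cmult: "v \<in> L2 U \<Longrightarrow> (\<lambda>x. c * v x) \<in> L2 U"
  by (auto simp: L2_def norm_mult power_mult_distrib intro!: borel_measurable_times)

lemma L2_cnj: "v \<in> L2 U \<Longrightarrow> (\<lambda>x. cnj (v x)) \<in> L2 U"
  by (rule L2I[of _ _ "\<lambda>x. (norm (v x))\<^sup>2"])
    (auto dest: L2D intro!: borel_measurable_continuous_on[OF _ L2D(1)[of v U]] continuous_on_cnj continuous_on_id)

lemma L2_add: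
  assumes "v \<in> L2 U" "w \<in> L2 U"
  shows "(\<lambda>x. v x + w x) \<in> L2 U"
proof (rule L2I)
  show "(\<lambda>x. v x + w x) \<in> borel_measurable (lebesgue_on U)"
    using L2D(1)[OF assms(1)] L2D(1)[OF assms(2)] by measurable
  show "integrable (lebesgue_on U) (\<lambda>x. 2 * (norm (v x))\<^sup>2 + 2 * (norm (w x))\<^sup>2)"
    using L2D(2)[OF assms(1)] L2D(2)[OF assms(2)] by simp
  have "(norm (a + b))\<^sup>2 \<le> 2 * (norm a)\<^sup>2 + 2 * (norm b)\<^sup>2" for a b :: complex
  proof -
    have "(norm (a + b))\<^sup>2 \<le> (norm a + norm b)\<^sup>2"
      by (intro power_mono norm_triangle_ineq norm_ge_zero)
    then show ?thesis
      using zero_le_power2[of "norm a - norm b"] by (simp add: power2_sum power2_diff)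
  qed
  then show "AE x in lebesgue_on U. (norm (v x + w x))\<^sup>2 \<le> 2 * (norm (v x))\<^sup>2 + 2 * (norm (w x))\<^sup>2"
    by simp
qed

lemma L2_diff: "v \<in> L2 U \<Longrightarrow> w \<in> L2 U \<Longrightarrow> (\<lambda>x. v x - w x) \<in> L2 U"
  using L2_add[of v U "\<lambda>x. (-1) * w x"] L2_cmult[of w U "-1"] by simp

lemma L2_cong_AE:
  assumes "v \<in> L2 U" "U \<in> sets lebesgue" "AE x in lebesgue_on U. v x = w x"
  shows "w \<in> L2 U"
proof (rule L2I)
  show "w \<in> borel_measurable (lebesgue_on U)"
    using borel_measurable_lebesgue_on_AE L2D(1) assms by blast
  show "integrable (lebesgue_on U) (\<lambda>x. (norm (v x))\<^sup>2)" using assms(1) by (rule L2D)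
  show "AE x in lebesgue_on U. (norm (w x))\<^sup>2 \<le> (norm (v x))\<^sup>2"
    using assms(3) by eventually_elim simp
qed

lemma L2_norm_cong_AE:
  assumes "v \<in> L2 U" "U \<in> sets lebesgue" "AE x in lebesgue_on U. v x = w x"
  shows "L2_norm U v = L2_norm U w"
  unfolding L2_norm_def
  using L2D[OF assms(1)] L2D[OF L2_cong_AE[OF assms]] assms(3)
  by (intro arg_cong[where f=sqrt] integral_cong_AE) (auto elim: eventually_mono)

lemma L2_Cauchy_Schwarz:
  assumes v: "v \<in> L2 U" and w: "w \<in> L2 U"
  shows "norm (integral\<^sup>L (lebesgue_on U) (\<lambda>x. v x * w x)) \<le> L2_norm U v * L2_norm U w"
proof -
  let ?M = "lebesgue_on U"
  define A where "A = L2_norm U v"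
  define B where "B = L2_norm U w"
  define C where "C = integral\<^sup>L ?M (\<lambda>x. norm (v x) * norm (w x))"
  have A: "A\<^sup>2 = integral\<^sup>L ?M (\<lambda>x. (norm (v x))\<^sup>2)" "A \<ge> 0"
    and B: "B\<^sup>2 = integral\<^sup>L ?M (\<lambda>x. (norm (w x))\<^sup>2)" "B \<ge> 0"
    by (simp_all add: A_def B_def L2_norm_power2 L2_norm_nonneg)
  note int = L2D(2)[OF v] L2D(2)[OF w]
  have int3: "integrable ?M (\<lambda>x. norm (v x) * norm (w x))"
    using integrable_norm[OF L2_mult_integrable[OF v w]] by (simp add: norm_mult)
  have le: "norm (integral\<^sup>L ?M (\<lambda>x. v x * w x)) \<le> C"
    using integral_norm_bound[of ?M "\<lambda>x. v x * w x"] by (simp add: C_def norm_mult)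
  have "C \<le> A * B"
  proof (cases "A = 0 \<or> B = 0")
    case True
    then have "AE x in ?M. norm (v x) * norm (w x) = 0"
    proof
      assume "A = 0"
      then have "AE x in ?M. (norm (v x))\<^sup>2 = 0"
        using A int integral_nonneg_eq_0_iff_AE[of ?M "\<lambda>x. (norm (v x))\<^sup>2"] by simp
      then show ?thesis by eventually_elim simp
    next
      assume "B = 0"
      then have "AE x in ?M. (norm (w x))\<^sup>2 = 0"
        using B int integral_nonneg_eq_0_iff_AE[of ?M "\<lambda>x. (norm (w x))\<^sup>2"] by simp
      then show ?thesis by eventually_elim simp
    qed
    then have "C = 0" unfolding C_def by (rule integral_eq_zero_AE)
    then show ?thesis using True by auto
  next
    case False
    \<comment> \<open>Expanding this square gives \<open>2 * A * B * C \<le> 2 * (A * B)\<^sup>2\<close>.\<close>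
    have "0 \<le> integral\<^sup>L ?M (\<lambda>x. (B * norm (v x) - A * norm (w x))\<^sup>2)"
      by (intro integral_nonneg_AE) auto
    also have "(\<lambda>x. (B * norm (v x) - A * norm (w x))\<^sup>2)
        = (\<lambda>x. B\<^sup>2 * (norm (v x))\<^sup>2 + A\<^sup>2 * (norm (w x))\<^sup>2 - 2 * A * B * (norm (v x) * norm (w x)))"
      by (simp add: fun_eq_iff power2_diff power_mult_distrib)
    also have "integral\<^sup>L ?M \<dots> = B\<^sup>2 * A\<^sup>2 + A\<^sup>2 * B\<^sup>2 - 2 * A * B * C"
      using int int3 by (simp add: A B C_def)
    finally have "(A * B) * C \<le> (A * B) * (A * B)"
      by (simp add: power2_eq_square algebra_simps)
    moreover have "A * B > 0" using False A(2) B(2) by simp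
    ultimately show ?thesis using mult_le_cancel_left_pos by blast
  qed
  with le show ?thesis by (simp add: A_def B_def)
qed

lemma L2_norm_cmult: "L2_norm U (\<lambda>x. c * v x) = norm c * L2_norm U v"
  by (simp add: L2_norm_def norm_mult power_mult_distrib real_sqrt_mult)

lemma L2_norm_cnj: "L2_norm U (\<lambda>x. cnj (v x)) = L2_norm U v"
  by (simp add: L2_norm_def)

lemma L2_norm_triangle:
  assumes v: "v \<in> L2 U" and w: "w \<in> L2 U"
  shows "L2_norm U (\<lambda>x. v x + w x) \<le> L2_norm U v + L2_norm U w"
proof (rule power2_le_imp_le)
  let ?M = "lebesgue_on U"
  let ?I = "integral\<^sup>L ?M (\<lambda>x. v x * cnj (w x))"
  have eq: "(norm (v x + w x))\<^sup>2 = (norm (v x))\<^sup>2 + (norm (w x))\<^sup>2 + 2 * Re (v x * cnj (w x))" for x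
    by (simp only: cmod_power2 complex_add_cnj) (simp add: power2_eq_square algebra_simps)
  have int: "integrable ?M (\<lambda>x. v x * cnj (w x))"
    by (rule L2_mult_integrable[OF v L2_cnj[OF w]])
  have "(L2_norm U (\<lambda>x. v x + w x))\<^sup>2 = (L2_norm U v)\<^sup>2 + (L2_norm U w)\<^sup>2 + 2 * Re ?I"
  proof -
    have "integrable ?M (\<lambda>x. Re (v x * cnj (w x)))"
      and "Re ?I = integral\<^sup>L ?M (\<lambda>x. Re (v x * cnj (w x)))"
      using integrable_Re[OF int] integral_Re[OF int] by simp_all
    then show ?thesis
      unfolding L2_norm_power2 eq using L2D(2)[OF v] L2D(2)[OF w]
      by (simp del: complex_cnj_mult complex_mult_cnj times_complex.sel)
  qed
  also have "Re ?I \<le> L2_norm U v * L2_norm U w"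
    using L2_Cauchy_Schwarz[OF v L2_cnj[OF w]] complex_Re_le_cmod[of ?I] by (simp add: L2_norm_cnj)
  finally show "(L2_norm U (\<lambda>x. v x + w x))\<^sup>2 \<le> (L2_norm U v + L2_norm U w)\<^sup>2"
    by (simp add: power2_sum)
qed (simp add: L2_norm_nonneg)

lemma L2_imp_integrable:
  assumes "v \<in> L2 U" "U \<in> lmeasurable"
  shows "integrable (lebesgue_on U) v"
proof -
  interpret finite_measure "lebesgue_on U" by (rule finite_measure_lebesgue_on[OF assms(2)])
  have "(\<lambda>x. 1) \<in> L2 U" by (simp add: L2_def)
  from L2_mult_integrable[OF assms(1) this] show ?thesis by simp
qed

lemma integral_lebesgue_on_support:
  fixes f :: "'a::euclidean_space \<Rightarrow> 'b::euclidean_space"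
  assumes "S \<subseteq> T" "S \<in> sets lebesgue" "T \<in> sets lebesgue" "\<And>x. x \<in> T \<Longrightarrow> x \<notin> S \<Longrightarrow> f x = 0"
  shows "integral\<^sup>L (lebesgue_on T) f = integral\<^sup>L (lebesgue_on S) f"
    and "integrable (lebesgue_on T) f \<longleftrightarrow> integrable (lebesgue_on S) f"
proof -
  have eq: "(\<lambda>x. if x \<in> T then f x else 0) = (\<lambda>x. if x \<in> S then f x else 0)"
    using assms by (auto simp: fun_eq_iff)
  show "integral\<^sup>L (lebesgue_on T) f = integral\<^sup>L (lebesgue_on S) f"
    using Lebesgue_Measure.integral_restrict_UNIV[OF assms(2), of f] Lebesgue_Measure.integral_restrict_UNIV[OF assms(3), of f] eq by simp
  show "integrable (lebesgue_on T) f \<longleftrightarrow> integrable (lebesgue_on S) f"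
    using Lebesgue_Measure.integrable_restrict_UNIV[OF assms(2), of f] Lebesgue_Measure.integrable_restrict_UNIV[OF assms(3), of f] eq by simp
qed

lemma integrable_lebesgue_on_subset:
  fixes f :: "'a::euclidean_space \<Rightarrow> 'b::euclidean_space"
  assumes "integrable (lebesgue_on T) f" "S \<subseteq> T" "S \<in> sets lebesgue" "T \<in> sets lebesgue"
  shows "integrable (lebesgue_on S) f"
proof -
  have "integrable lebesgue (\<lambda>x. if x \<in> T then f x else 0)"
    using assms Lebesgue_Measure.integrable_restrict_UNIV by blast
  then have "integrable lebesgue (\<lambda>x. indicator S x *\<^sub>R (if x \<in> T then f x else 0))"
    using assms by (intro integrable_mult_indicator) auto
  also have "(\<lambda>x. indicator S x *\<^sub>R (if x \<in> T then f x else 0)) = (\<lambda>x. if x \<in> S then f x else 0)"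
    using assms by (auto simp: fun_eq_iff indicator_def)
  finally show ?thesis using assms Lebesgue_Measure.integrable_restrict_UNIV by blast
qed

lemma L2_subset:
  assumes "v \<in> L2 T" "S \<subseteq> T" "S \<in> sets lebesgue" "T \<in> sets lebesgue"
  shows "v \<in> L2 S"
  using assms integrable_lebesgue_on_subset[of T "\<lambda>x. (norm (v x))\<^sup>2" S]
  by (auto simp: L2_def intro: measurable_restrict_mono)

section \<open>Test functions\<close>

lemma test_functionsD:
  assumes "\<phi> \<in> test_functions U"
  shows "C_k m \<phi>" "compact (closure {x. \<phi> x \<noteq> 0})" "closure {x. \<phi> x \<noteq> 0} \<subseteq> U"
    "\<phi> differentiable (at x)" "continuous_on UNIV \<phi>"
proof -
  have *: "C_k m \<phi>" for m using assms by (auto simp: test_functions_def)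
  show "C_k m \<phi>" by (rule *)
  show "\<phi> differentiable (at x)" using *[of "Suc 0"] by simp
  show "continuous_on UNIV \<phi>" using *[of 0] by simp
qed (use assms in \<open>auto simp: test_functions_def\<close>)

lemma test_functions_zero_outside: "\<phi> \<in> test_functions U \<Longrightarrow> x \<notin> U \<Longrightarrow> \<phi> x = 0"
  using closure_subset[of "{x. \<phi> x \<noteq> 0}"] test_functionsD(3)[of \<phi> U] by blast

lemma test_functions_mono: "\<phi> \<in> test_functions U \<Longrightarrow> U \<subseteq> V \<Longrightarrow> \<phi> \<in> test_functions V"
  by (auto simp: test_functions_def)

lemma test_functions_add:
  assumes "\<phi> \<in> test_functions U" "\<psi> \<in> test_functions U"
  shows "(\<lambda>x. \<phi> x + \<psi> x) \<in> test_functions U"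
proof (rule test_functionsI)
  show "compact (closure {x. \<phi> x \<noteq> 0} \<union> closure {x. \<psi> x \<noteq> 0})"
    using assms test_functionsD(2) by (intro compact_Un) auto
  show "\<phi> x + \<psi> x = 0" if "x \<notin> closure {x. \<phi> x \<noteq> 0} \<union> closure {x. \<psi> x \<noteq> 0}" for x
    using that closure_subset[of "{x. \<phi> x \<noteq> 0}"] closure_subset[of "{x. \<psi> x \<noteq> 0}"] by fastforce
  show "closure {x. \<phi> x \<noteq> 0} \<union> closure {x. \<psi> x \<noteq> 0} \<subseteq> U"
    using assms test_functionsD(3) by (intro Un_least)
qed (intro C_k_add test_functionsD(1)[OF assms(1)] test_functionsD(1)[OF assms(2)])

lemma test_functions_mult:
  assumes "\<phi> \<in> test_functions U" "\<And>m. C_k m \<psi>"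
  shows "(\<lambda>x. \<psi> x * \<phi> x) \<in> test_functions U"
proof (rule test_functionsI)
  show "compact (closure {x. \<phi> x \<noteq> 0})" using assms test_functionsD(2) by auto
  show "\<psi> x * \<phi> x = 0" if "x \<notin> closure {x. \<phi> x \<noteq> 0}" for x
    using that closure_subset[of "{x. \<phi> x \<noteq> 0}"] by auto
  show "closure {x. \<phi> x \<noteq> 0} \<subseteq> U" by (rule test_functionsD(3)[OF assms(1)])
qed (intro C_k_mult assms(2) test_functionsD(1)[OF assms(1)])

lemma test_functions_cmult: "\<phi> \<in> test_functions U \<Longrightarrow> (\<lambda>x. c * \<phi> x) \<in> test_functions U"
  by (intro test_functions_mult C_k_const)

lemma test_functions_zero: "(\<lambda>x. 0) \<in> test_functions U"
  by (rule test_functionsI[where K="{}"]) (auto intro: C_k_const)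

lemma test_functions_cnj: "\<phi> \<in> test_functions U \<Longrightarrow> (\<lambda>x. cnj (\<phi> x)) \<in> test_functions U"
  by (auto simp: test_functions_def intro: C_k_cnj)

lemma test_functions_translate:
  assumes "\<phi> \<in> test_functions U"
  shows "(\<lambda>x. \<phi> (x + c)) \<in> test_functions {x. x + c \<in> U}"
proof (rule test_functionsI)
  let ?K = "closure {x. \<phi> x \<noteq> 0}"
  have K: "(\<lambda>x. - c + x) ` ?K = {x. x + c \<in> ?K}"
    by (force simp: image_iff intro: rev_bexI[of "_ + c"])
  show "compact {x. x + c \<in> ?K}"
    unfolding K[symmetric] using assms by (intro compact_translation test_functionsD)
  show "{x. x + c \<in> ?K} \<subseteq> {x. x + c \<in> U}" using test_functionsD(3)[OF assms] by auto
  show "\<phi> (x + c) = 0" if "x \<notin> {x. x + c \<in> ?K}" for x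
    using that closure_subset[of "{x. \<phi> x \<noteq> 0}"] by auto
  show "C_k m (\<lambda>x. \<phi> (x + c))" for m
    using C_k_affine[OF bounded_linear_ident test_functionsD(1)[OF assms]] by simp
qed

lemma partial_deriv_translate:
  assumes "\<phi> differentiable (at (x + c))"
  shows "partial_deriv e (\<lambda>x. \<phi> (x + c)) x = partial_deriv e \<phi> (x + c)"
proof -
  have "((\<lambda>x. \<phi> (x + c)) has_derivative frechet_derivative \<phi> (at (x + c))) (at x)"
  proof (rule has_derivative_compose[where g=\<phi>])
    show "((\<lambda>x. x + c) has_derivative (\<lambda>h. h)) (at x)"
      by (rule has_derivative_add_const[OF has_derivative_ident])
    show "(\<phi> has_derivative frechet_derivative \<phi> (at (x + c))) (at (x + c))"
      using assms by (simp add: frechet_derivative_works)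
  qed
  then show ?thesis by (metis frechet_derivative_at)
qed

lemma test_functions_partial_deriv:
  assumes "\<phi> \<in> test_functions U" "e \<in> Basis"
  shows "partial_deriv e \<phi> \<in> test_functions U"
proof (rule test_functionsI)
  let ?K = "closure {x. \<phi> x \<noteq> 0}"
  show "C_k m (partial_deriv e \<phi>)" for m
    using test_functionsD(1)[OF assms(1), of "Suc m"] assms(2) by simp
  show "partial_deriv e \<phi> x = 0" if "x \<notin> ?K" for x
  proof -
    have "((\<lambda>x. 0::complex) has_derivative (\<lambda>h. 0)) (at x)" by simp
    then have "(\<phi> has_derivative (\<lambda>h. 0)) (at x)"
    proof (rule has_derivative_transform_within_open[where s="- ?K"])
      show "0 = \<phi> y" if "y \<in> - ?K" for y
        using that closure_subset[of "{x. \<phi> x \<noteq> 0}"] by auto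
    qed (use that in auto)
    from frechet_derivative_at[OF this] show ?thesis by (metis)
  qed
qed (rule test_functionsD(2,3)[OF assms(1)])+

lemma test_functions_bounded:
  assumes "\<phi> \<in> test_functions U"
  obtains C where "C > 0" "\<And>x. norm (\<phi> x) \<le> C"
proof -
  have "bounded (\<phi> ` closure {x. \<phi> x \<noteq> 0})"
    by (intro compact_imp_bounded compact_continuous_image test_functionsD(2)[OF assms]
        continuous_on_subset[OF test_functionsD(5)[OF assms]]) auto
  then obtain C where C: "C > 0" "\<And>y. y \<in> \<phi> ` closure {x. \<phi> x \<noteq> 0} \<Longrightarrow> norm y \<le> C"
    unfolding bounded_pos by blast
  have "norm (\<phi> x) \<le> C" for x
    using C closure_subset[of "{x. \<phi> x \<noteq> 0}"] by (cases "\<phi> x = 0") auto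
  then show thesis using C(1) that by blast
qed

lemma test_functions_measurable:
  assumes "\<phi> \<in> test_functions U" 
  shows "\<phi> \<in> borel_measurable (lebesgue_on S)"
proof -
  have "\<phi> \<in> borel_measurable lebesgue"
    by (intro measurable_completion)
      (simp add: borel_measurable_continuous_onI[OF test_functionsD(5)[OF assms]])
  then show ?thesis by (rule measurable_restrict_space1)
qed

text \<open>On the compact support of the test function, the first factor is integrable and the second one is
  bounded.\<close>

lemma integrable_times_test:
  assumes v: "locally_integrable U v" and "\<phi> \<in> test_functions U" and U: "U \<in> sets lebesgue"
  shows "integrable (lebesgue_on U) (\<lambda>x. v x * \<phi> x)"
proof -
  let ?K = "closure {x. \<phi> x \<noteq> 0}"
  obtain C where C: "C > 0" "\<And>x. norm (\<phi> x) \<le> C" using test_functions_bounded assms(2) by blast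
  note K = test_functionsD(2,3)[OF assms(2)]
  then have iv: "integrable (lebesgue_on ?K) v" using v by (auto simp: locally_integrable_def)
  have "integrable (lebesgue_on ?K) (\<lambda>x. v x * \<phi> x)"
  proof (rule Bochner_Integration.integrable_bound)
    show "integrable (lebesgue_on ?K) (\<lambda>x. of_real C * v x)" using iv by simp
    show "(\<lambda>x. v x * \<phi> x) \<in> borel_measurable (lebesgue_on ?K)"
      using borel_measurable_integrable[OF iv] test_functions_measurable[OF assms(2)]
      by (intro borel_measurable_times)
    show "AE x in lebesgue_on ?K. norm (v x * \<phi> x) \<le> norm (of_real C * v x)"
      using C by (auto simp: norm_mult mult.commute intro!: mult_right_mono)
  qed
  then show ?thesis
  proof (subst integral_lebesgue_on_support(2)[OF K(2) _ U])
    show "?K \<in> sets lebesgue" using lmeasurable_compact[OF K(1)] by auto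
    show "v x * \<phi> x = 0" if "x \<notin> ?K" for x
      using that closure_subset[of "{x. \<phi> x \<noteq> 0}"] by auto
  qed
qed

lemma L2_imp_locally_integrable:
  assumes "v \<in> L2 U" "U \<in> sets lebesgue"
  shows "locally_integrable U v"
  unfolding locally_integrable_def
proof (intro allI impI)
  fix K assume K: "compact K \<and> K \<subseteq> U"
  then have "K \<in> lmeasurable" by (intro lmeasurable_compact) simp
  then show "integrable (lebesgue_on K) v"
    using K by (intro L2_imp_integrable L2_subset[OF assms(1) _ _ assms(2)]) (auto dest: fmeasurableD)
qed

lemma test_functions_L2:
  assumes "\<phi> \<in> test_functions V" "U \<in> sets lebesgue"
  shows "\<phi> \<in> L2 U"
proof -
  have cnt: "locally_integrable UNIV (\<lambda>x. cnj (\<phi> x))"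
    unfolding locally_integrable_def
  proof (intro allI impI)
    fix K :: "'a set" assume "compact K \<and> K \<subseteq> UNIV"
    then have K: "bounded K" "K \<in> sets lebesgue"
      by (auto intro: compact_imp_bounded fmeasurableD lmeasurable_compact)
    obtain a where a: "K \<subseteq> cbox (- a) a" by (rule bounded_subset_cbox_symmetric[OF K(1)])
    have "continuous_on (cbox (- a) a) (\<lambda>x. cnj (\<phi> x))"
      using test_functionsD(5)[OF test_functions_cnj[OF assms(1)]] continuous_on_subset by blast
    then show "integrable (lebesgue_on K) (\<lambda>x. cnj (\<phi> x))"
      by (rule integrable_lebesgue_on_subset[OF continuous_imp_integrable a K(2)]) auto
  qed
  have "integrable (lebesgue_on UNIV) (\<lambda>x. cnj (\<phi> x) * \<phi> x)"
    by (intro integrable_times_test cnt test_functions_mono[OF assms(1)]) auto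
  then have "integrable (lebesgue_on U) (\<lambda>x. cnj (\<phi> x) * \<phi> x)"
    using assms(2) by (rule integrable_lebesgue_on_subset[OF _ subset_UNIV]) auto
  from integrable_norm[OF this] show ?thesis
    using test_functions_measurable[OF assms(1)] by (simp add: L2_def norm_mult power2_eq_square)
qed

section \<open>Density of the test functions\<close>

lemma AE_lebesgue_on_iff:
  "U \<in> sets lebesgue \<Longrightarrow> (AE x in lebesgue_on U. P x) \<longleftrightarrow> (AE x in lebesgue. x \<in> U \<longrightarrow> P x)"
  using AE_restrict_space_iff[of U lebesgue P] by simp

text \<open>Up to a null set, \<open>A\<close> is an intersection of a sequence of open sets. Its finite partial
  intersections, cut down to \<open>V\<close>, are open.\<close>

lemma lebesgue_approx_open:
  fixes A V :: "'a::euclidean_space set"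
  assumes A: "A \<in> sets lebesgue" "A \<subseteq> V" and V: "open V"
  obtains S :: "nat \<Rightarrow> 'a set" where "\<And>m. open (S m)" "\<And>m. S m \<subseteq> V"
    "AE x in lebesgue. (\<lambda>m. indicat_real (S m) x) \<longlonglongrightarrow> indicator A x"
proof -
  obtain C N where C: "gdelta C" "N \<in> null_sets lebesgue" "A \<union> N = C"
    using lebesgue_set_almost_gdelta[OF A(1)] by metis
  from C(1) obtain F :: "nat \<Rightarrow> 'a set" where F: "\<And>n. open (F n)" "C = \<Inter>(F ` UNIV)"
    by (auto elim: gdelta.cases)
  define S where "S m = (\<Inter>n\<le>m. F n) \<inter> V" for m
  show thesis
  proof
    show "open (S m)" for m unfolding S_def using F V by (intro open_Int open_INT) auto
    show "S m \<subseteq> V" for m by (auto simp: S_def)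
    have "(\<lambda>m. indicat_real (S m) x) \<longlonglongrightarrow> indicator A x" if "x \<notin> N" for x
    proof (cases "x \<in> A")
      case True
      then have "x \<in> S m" for m using A(2) C(3) F(2) by (auto simp: S_def)
      then show ?thesis using True by simp
    next
      case False
      then have "x \<notin> C" using that C(3) by auto
      then obtain n where n: "x \<notin> F n" using F(2) by auto
      have "\<forall>\<^sub>F m in sequentially. indicat_real (S m) x = 0"
        using eventually_ge_at_top[of n]
      proof eventually_elim
        case (elim m)
        then have "x \<notin> S m" using n by (auto simp: S_def)
        then show ?case by simp
      qed
      then show ?thesis using False by (simp add: tendsto_eventually)
    qed
    moreover have "AE x in lebesgue. x \<notin> N" using C(2) by (rule AE_not_in)
    ultimately show "AE x in lebesgue. (\<lambda>m. indicat_real (S m) x) \<longlonglongrightarrow> indicator A x"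
      by (auto elim: eventually_mono)
  qed
qed

lemma L2_norm_tendsto_0:
  assumes "\<And>n. f n \<in> borel_measurable (lebesgue_on U)" "integrable (lebesgue_on U) w"
    "\<And>n. AE x in lebesgue_on U. (norm (f n x))\<^sup>2 \<le> w x"
    "AE x in lebesgue_on U. (\<lambda>n. f n x) \<longlonglongrightarrow> 0"
  shows "(\<lambda>n. L2_norm U (f n)) \<longlonglongrightarrow> 0"
proof -
  have "(\<lambda>n. integral\<^sup>L (lebesgue_on U) (\<lambda>x. (norm (f n x))\<^sup>2)) \<longlonglongrightarrow> integral\<^sup>L (lebesgue_on U) (\<lambda>x. 0)"
  proof (rule integral_dominated_convergence[OF _ _ assms(2)])
    show "(\<lambda>x. (norm (f n x))\<^sup>2) \<in> borel_measurable (lebesgue_on U)" for n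
      using assms(1)[of n] by measurable
    show "AE x in lebesgue_on U. (\<lambda>n. (norm (f n x))\<^sup>2) \<longlonglongrightarrow> 0"
      using assms(4)
    proof eventually_elim
      case (elim x)
      from tendsto_power[OF tendsto_norm[OF elim], of 2] show ?case by simp
    qed
    show "AE x in lebesgue_on U. norm ((norm (f n x))\<^sup>2) \<le> w x" for n
      using assms(3)[of n] by simp
  qed simp
  from tendsto_real_sqrt[OF this] show ?thesis by (simp add: L2_norm_def)
qed

definition test_closure :: "'a::euclidean_space set \<Rightarrow> ('a \<Rightarrow> complex) set" where
  "test_closure D = {g \<in> L2 D. \<forall>\<epsilon>>0. \<exists>\<phi>\<in>test_functions D. L2_norm D (\<lambda>x. g x - \<phi> x) < \<epsilon>}"

lemma test_closure_limit:
  assumes g: "g \<in> L2 D" and D: "D \<in> sets lebesgue" and h: "\<And>n. h n \<in> test_closure D"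
    and lim: "(\<lambda>n. L2_norm D (\<lambda>x. g x - h n x)) \<longlonglongrightarrow> 0"
  shows "g \<in> test_closure D"
  unfolding test_closure_def
proof (intro CollectI conjI allI impI g)
  fix \<epsilon> :: real assume "\<epsilon> > 0"
  then obtain n where n: "L2_norm D (\<lambda>x. g x - h n x) < \<epsilon> / 2"
    using order_tendstoD(2)[OF lim, of "\<epsilon> / 2"] by (auto simp: eventually_sequentially)
  obtain \<phi> where \<phi>: "\<phi> \<in> test_functions D" "L2_norm D (\<lambda>x. h n x - \<phi> x) < \<epsilon> / 2"
    using h[of n] \<open>\<epsilon> > 0\<close> by (auto simp: test_closure_def dest!: spec[of _ "\<epsilon> / 2"])
  have hn: "h n \<in> L2 D" using h[of n] by (simp add: test_closure_def)
  have "L2_norm D (\<lambda>x. (g x - h n x) + (h n x - \<phi> x)) < \<epsilon>"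
    using L2_norm_triangle[OF L2_diff[OF g hn] L2_diff[OF hn test_functions_L2[OF \<phi>(1) D]]] n \<phi>(2)
    by simp
  then show "\<exists>\<phi>\<in>test_functions D. L2_norm D (\<lambda>x. g x - \<phi> x) < \<epsilon>"
    using \<phi>(1) by auto
qed

lemma test_closure_add:
  assumes D: "D \<in> sets lebesgue" and g: "g \<in> test_closure D" and h: "h \<in> test_closure D"
  shows "(\<lambda>x. g x + h x) \<in> test_closure D"
  unfolding test_closure_def
proof (intro CollectI conjI allI impI)
  have gL: "g \<in> L2 D" and hL: "h \<in> L2 D" using g h by (auto simp: test_closure_def)
  then show "(\<lambda>x. g x + h x) \<in> L2 D" by (rule L2_add)
  fix \<epsilon> :: real assume "\<epsilon> > 0"
  then obtain \<phi> \<psi> where \<phi>: "\<phi> \<in> test_functions D" "L2_norm D (\<lambda>x. g x - \<phi> x) < \<epsilon> / 2"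
    and \<psi>: "\<psi> \<in> test_functions D" "L2_norm D (\<lambda>x. h x - \<psi> x) < \<epsilon> / 2"
    using g h by (fastforce simp: test_closure_def dest!: spec[of _ "\<epsilon> / 2"])
  have "L2_norm D (\<lambda>x. (g x - \<phi> x) + (h x - \<psi> x)) < \<epsilon>"
    using L2_norm_triangle[OF L2_diff[OF gL test_functions_L2[OF \<phi>(1) D]]
        L2_diff[OF hL test_functions_L2[OF \<psi>(1) D]]] \<phi>(2) \<psi>(2)
    by simp
  then show "\<exists>\<phi>\<in>test_functions D. L2_norm D (\<lambda>x. g x + h x - \<phi> x) < \<epsilon>"
    using test_functions_add[OF \<phi>(1) \<psi>(1)]
    by (intro bexI[of _ "\<lambda>x. \<phi> x + \<psi> x"]) (auto simp: algebra_simps)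
qed

lemma test_closure_cmult:
  assumes g: "g \<in> test_closure D"
  shows "(\<lambda>x. c * g x) \<in> test_closure D"
  unfolding test_closure_def
proof (intro CollectI conjI allI impI)
  show "(\<lambda>x. c * g x) \<in> L2 D" using g by (auto simp: test_closure_def intro: L2_cmult)
  fix \<epsilon> :: real assume "\<epsilon> > 0"
  then have "\<epsilon> / (norm c + 1) > 0" by (simp add: add_nonneg_pos)
  then obtain \<phi> where \<phi>: "\<phi> \<in> test_functions D" "L2_norm D (\<lambda>x. g x - \<phi> x) < \<epsilon> / (norm c + 1)"
    using g by (auto simp: test_closure_def)
  have "L2_norm D (\<lambda>x. c * (g x - \<phi> x)) \<le> (norm c + 1) * L2_norm D (\<lambda>x. g x - \<phi> x)"
    unfolding L2_norm_cmult by (intro mult_right_mono L2_norm_nonneg) simp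
  also have "\<dots> < \<epsilon>"
    using \<phi>(2) by (subst (asm) pos_less_divide_eq) (simp_all add: add_nonneg_pos mult.commute)
  finally show "\<exists>\<phi>\<in>test_functions D. L2_norm D (\<lambda>x. c * g x - \<phi> x) < \<epsilon>"
    using test_functions_cmult[OF \<phi>(1)]
    by (intro bexI[of _ "\<lambda>x. c * \<phi> x"]) (auto simp: algebra_simps)
qed

lemma test_functions_test_closure:
  assumes "\<phi> \<in> test_functions D" "D \<in> sets lebesgue"
  shows "\<phi> \<in> test_closure D"
  using assms test_functions_L2[OF assms]
  by (auto simp: test_closure_def L2_norm_def intro!: bexI[of _ \<phi>])

lemma test_closure_sum:
  assumes "D \<in> sets lebesgue" "finite I" "\<And>i. i \<in> I \<Longrightarrow> g i \<in> test_closure D"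
  shows "(\<lambda>x. \<Sum>i\<in>I. g i x) \<in> test_closure D"
  using assms(2,3)
proof (induction I rule: finite_induct)
  case empty
  then show ?case using test_functions_test_closure[OF test_functions_zero assms(1)] by simp
next
  case (insert i I)
  then show ?case using test_closure_add[OF assms(1)] by simp
qed

text \<open>Dominated convergence is applied twice, with the constant 1 as bound: it leads from test functions
  to indicators of open sets, and from these to indicators of measurable sets.\<close>

lemma indicator_test_closure:
  fixes D :: "'a::euclidean_space set"
  assumes D: "open D" "D \<in> lmeasurable" and A: "A \<in> sets lebesgue" "A \<subseteq> D"
  shows "(\<lambda>x. indicator A x :: complex) \<in> test_closure D"
proof -
  interpret finite_measure "lebesgue_on D" by (rule finite_measure_lebesgue_on[OF D(2)])
  have Dm: "D \<in> sets lebesgue" using D by auto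
  have meas: "(\<lambda>x. indicator B x :: complex) \<in> borel_measurable (lebesgue_on D)" if "B \<in> sets lebesgue" for B
    using that by (intro borel_measurable_indicator' measurable_restrict_space1) auto
  have L2: "(\<lambda>x. indicator B x :: complex) \<in> L2 D" if "B \<in> sets lebesgue" for B
    by (rule L2I[OF meas[OF that], of "\<lambda>x. 1"]) (auto simp: indicator_def)
  have lim: "(\<lambda>x. indicator B x :: complex) \<in> test_closure D"
    if B: "B \<in> sets lebesgue" and h: "\<And>n. (\<lambda>x. complex_of_real (h n x)) \<in> test_closure D"
      and bd: "\<And>n x. 0 \<le> h n x" "\<And>n x. h n x \<le> 1"
      and conv: "AE x in lebesgue. (\<lambda>n. h n x) \<longlonglongrightarrow> indicator B x" for B and h :: "nat \<Rightarrow> 'a \<Rightarrow> real"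
  proof (rule test_closure_limit[OF L2[OF B] Dm h])
    show "(\<lambda>n. L2_norm D (\<lambda>x. indicator B x - complex_of_real (h n x))) \<longlonglongrightarrow> 0"
    proof (rule L2_norm_tendsto_0[where w="\<lambda>x. 1"])
      show "(\<lambda>x. indicator B x - complex_of_real (h n x)) \<in> borel_measurable (lebesgue_on D)" for n
        using h[of n] by (intro borel_measurable_diff meas B) (auto simp: test_closure_def L2_def)
      have "norm (indicator B x - complex_of_real (h n x)) \<le> 1" for n x
      proof -
        have "norm (complex_of_real (indicator B x - h n x)) \<le> 1"
          unfolding norm_of_real using bd[of n x] by (auto simp: indicator_def abs_if)
        moreover have "complex_of_real (indicator B x - h n x) = indicator B x - complex_of_real (h n x)"
          by (simp add: indicator_def)
        ultimately show ?thesis by simp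
      qed
      then show "AE x in lebesgue_on D. (norm (indicator B x - complex_of_real (h n x)))\<^sup>2 \<le> 1" for n
        by (simp add: power_le_one)
      show "AE x in lebesgue_on D. (\<lambda>n. indicator B x - complex_of_real (h n x)) \<longlonglongrightarrow> 0"
        unfolding AE_lebesgue_on_iff[OF Dm]
        using conv
      proof eventually_elim
        case (elim x)
        have "(\<lambda>n. complex_of_real (indicator B x - h n x)) \<longlonglongrightarrow> of_real (indicator B x - indicator B x)"
          by (intro tendsto_of_real tendsto_diff tendsto_const elim)
        then show ?case by (cases "x \<in> B") simp_all
      qed
    qed simp
  qed
  have op: "(\<lambda>x. indicator S x :: complex) \<in> test_closure D" if S: "open S" "S \<subseteq> D" for S
  proof -
    obtain \<phi> :: "nat \<Rightarrow> 'a \<Rightarrow> real" where \<phi>: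
      "\<And>n. (\<lambda>x. complex_of_real (\<phi> n x)) \<in> test_functions S"
      "\<And>n x. 0 \<le> \<phi> n x" "\<And>n x. \<phi> n x \<le> 1" "\<And>x. (\<lambda>n. \<phi> n x) \<longlonglongrightarrow> indicator S x"
      using test_functions_approx_open[OF S(1)] by blast
    show ?thesis
    proof (rule lim)
      show "S \<in> sets lebesgue" using S by auto
      show "(\<lambda>x. complex_of_real (\<phi> n x)) \<in> test_closure D" for n
        using \<phi>(1) S(2) Dm by (blast intro: test_functions_test_closure test_functions_mono)
      show "AE x in lebesgue. (\<lambda>n. \<phi> n x) \<longlonglongrightarrow> indicator S x" using \<phi>(4) by simp
    qed (rule \<phi>)+
  qed
  obtain S where S: "\<And>m. open (S m)" "\<And>m. S m \<subseteq> D"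
    "AE x in lebesgue. (\<lambda>m. indicat_real (S m) x) \<longlonglongrightarrow> indicator A x"
    by (rule lebesgue_approx_open[OF A D(1)]) (rule that)
  show ?thesis
  proof (rule lim[OF A(1) _ _ _ S(3)])
    have "(\<lambda>x. complex_of_real (indicat_real (S n) x)) = (\<lambda>x. indicator (S n) x)" for n
      by (auto simp: fun_eq_iff indicator_def)
    then show "(\<lambda>x. complex_of_real (indicat_real (S n) x)) \<in> test_closure D" for n
      using op[OF S(1,2)] by simp
  qed (auto simp: indicator_def)
qed

text \<open>Linearity leads from indicators to simple functions, and dominated convergence from simple functions
  to all of \<open>L2\<close>.\<close>

theorem test_functions_dense_L2:
  fixes D :: "'a::euclidean_space set"
  assumes D: "open D" "D \<in> lmeasurable" and g: "g \<in> L2 D"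
  shows "g \<in> test_closure D"
proof -
  let ?M = "lebesgue_on D"
  have Dm: "D \<in> sets lebesgue" using D by auto
  obtain s where s: "\<And>i. simple_function ?M (s i)" "\<And>x. x \<in> space ?M \<Longrightarrow> (\<lambda>i. s i x) \<longlonglongrightarrow> g x"
    "\<And>i x. x \<in> space ?M \<Longrightarrow> dist (s i x) 0 \<le> 2 * dist (g x) 0"
    using borel_measurable_implies_sequence_metric[OF L2D(1)[OF g], of 0] by blast
  have sm: "s i \<in> borel_measurable ?M" for i by (rule borel_measurable_simple_function[OF s(1)])
  have sL2: "s i \<in> L2 D" for i
  proof (rule L2I[OF sm])
    show "integrable ?M (\<lambda>x. 4 * (norm (g x))\<^sup>2)" using L2D(2)[OF g] by simp
    have "(norm (s i x))\<^sup>2 \<le> (2 * norm (g x))\<^sup>2" if "x \<in> space ?M" for x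
      using s(3)[OF that] by (intro power_mono) auto
    then show "AE x in ?M. (norm (s i x))\<^sup>2 \<le> 4 * (norm (g x))\<^sup>2"
      by (intro AE_I2) (auto simp: power_mult_distrib)
  qed
  have "s i \<in> test_closure D" for i
  proof -
    let ?A = "\<lambda>y. s i -` {y} \<inter> D"
    have fin: "finite (s i ` D)" using simple_functionD(1)[OF s(1)[of i]] by simp
    have "(\<lambda>x. \<Sum>y\<in>s i ` D. y * indicator (?A y) x) \<in> test_closure D"
    proof (intro test_closure_sum[OF Dm fin] test_closure_cmult indicator_test_closure D)
      fix y
      have "?A y \<in> sets ?M" using simple_functionD(2)[OF s(1)[of i], of "{y}"] by simp
      then show "?A y \<in> sets lebesgue" using sets_restrict_space_subset[OF Dm] by blast
    qed auto
    then show ?thesis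
    proof (rule test_closure_limit[OF sL2 Dm, where h="\<lambda>_ x. \<Sum>y\<in>s i ` D. y * indicator (?A y) x"])
      let ?f = "\<lambda>x. \<Sum>y\<in>s i ` D. y * indicator (?A y) x"
      have "s i x - ?f x = 0" if "x \<in> D" for x
      proof -
        have "?f x = (\<Sum>y\<in>s i ` D. if y = s i x then y else 0)"
          using that by (intro sum.cong) (auto simp: indicator_def)
        then show ?thesis using fin that by (simp add: sum.delta)
      qed
      then have "\<And>x. x \<in> D \<Longrightarrow> (norm (s i x - ?f x))\<^sup>2 = (norm (0::complex))\<^sup>2"
        by (simp only:)
      then have "L2_norm D (\<lambda>x. s i x - ?f x) = L2_norm D (\<lambda>x. 0)"
        unfolding L2_norm_def
        by (intro arg_cong[where f=sqrt] Bochner_Integration.integral_cong[OF refl])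
          (simp only: space_lebesgue_on)
      then show "(\<lambda>n. L2_norm D (\<lambda>x. s i x - ?f x)) \<longlonglongrightarrow> 0"
        by (simp add: L2_norm_def)
    qed
  qed
  then show ?thesis
  proof (rule test_closure_limit[OF g Dm])
    show "(\<lambda>n. L2_norm D (\<lambda>x. g x - s n x)) \<longlonglongrightarrow> 0"
    proof (rule L2_norm_tendsto_0)
      show "(\<lambda>x. g x - s n x) \<in> borel_measurable ?M" for n
        by (intro borel_measurable_diff sm L2D(1)[OF g])
      show "integrable ?M (\<lambda>x. 9 * (norm (g x))\<^sup>2)" using L2D(2)[OF g] by simp
      have "(norm (g x - s n x))\<^sup>2 \<le> (3 * norm (g x))\<^sup>2" if "x \<in> space ?M" for x n
        using s(3)[OF that, of n] norm_triangle_ineq4[of "g x" "s n x"] by (intro power_mono) auto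
      then show "AE x in ?M. (norm (g x - s n x))\<^sup>2 \<le> 9 * (norm (g x))\<^sup>2" for n
        by (intro AE_I2) (auto simp: power_mult_distrib)
      show "AE x in ?M. (\<lambda>n. g x - s n x) \<longlonglongrightarrow> 0"
      proof (rule AE_I2)
        fix x assume "x \<in> space ?M"
        from tendsto_diff[OF tendsto_const[of "g x"] s(2)[OF this]]
        show "(\<lambda>n. g x - s n x) \<longlonglongrightarrow> 0" by simp
      qed
    qed
  qed
qed

text \<open>The bound is applied to test functions close to the conjugate of \<open>g\<close>, for which the pairing is close
  to the squared norm of \<open>g\<close>.\<close>

lemma L2_norm_le_dual:
  fixes D :: "'a::euclidean_space set"
  assumes D: "open D" "D \<in> lmeasurable" and g: "g \<in> L2 D" and K: "K \<ge> 0"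
    and bound: "\<And>\<phi>. \<phi> \<in> test_functions D \<Longrightarrow>
      norm (integral\<^sup>L (lebesgue_on D) (\<lambda>x. g x * \<phi> x)) \<le> K * L2_norm D \<phi>"
  shows "L2_norm D g \<le> K"
proof (rule ccontr)
  assume "\<not> ?thesis"
  then have less: "K < L2_norm D g" by simp
  define N where "N = L2_norm D g"
  \<comment> \<open>An error \<open>\<epsilon>\<close> costs \<open>(K + N) * \<epsilon>\<close> below; this is half of the gap \<open>N\<^sup>2 - K * N\<close>.\<close>
  define \<epsilon> where "\<epsilon> = (N - K) * N / 2 / (K + N)"
  have N: "N > K" "N > 0" "K + N > 0" using less K by (auto simp: N_def)
  then have \<epsilon>: "\<epsilon> > 0" by (simp add: \<epsilon>_def)
  have Dm: "D \<in> sets lebesgue" using D(2) by auto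
  note gc = L2_cnj[OF g]
  obtain \<phi> where \<phi>: "\<phi> \<in> test_functions D" "L2_norm D (\<lambda>x. cnj (g x) - \<phi> x) < \<epsilon>"
    using test_functions_dense_L2[OF D gc] \<epsilon> unfolding test_closure_def by blast
  note \<phi>L = test_functions_L2[OF \<phi>(1) Dm]
  note dL = L2_diff[OF gc \<phi>L]
  have "L2_norm D (\<lambda>x. cnj (g x) - (cnj (g x) - \<phi> x)) \<le> N + \<epsilon>"
    using L2_norm_triangle[OF gc L2_cmult[OF dL, of "-1"]] \<phi>(2) L2_norm_cmult[of D "-1" "\<lambda>x. cnj (g x) - \<phi> x"]
    by (simp add: N_def L2_norm_cnj)
  then have \<phi>n: "L2_norm D \<phi> \<le> N + \<epsilon>" by simp
  have split: "integral\<^sup>L (lebesgue_on D) (\<lambda>x. g x * cnj (g x))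
      = integral\<^sup>L (lebesgue_on D) (\<lambda>x. g x * \<phi> x) + integral\<^sup>L (lebesgue_on D) (\<lambda>x. g x * (cnj (g x) - \<phi> x))"
    using L2_mult_integrable[OF g \<phi>L] L2_mult_integrable[OF g dL]
    by (subst Bochner_Integration.integral_add[symmetric]) (simp_all add: algebra_simps)
  have "N\<^sup>2 = norm (integral\<^sup>L (lebesgue_on D) (\<lambda>x. g x * cnj (g x)))"
  proof -
    have "integral\<^sup>L (lebesgue_on D) (\<lambda>x. g x * cnj (g x)) = complex_of_real (N\<^sup>2)"
      unfolding N_def L2_norm_power2 complex_norm_square[symmetric] by (simp del: of_real_power)
    then show ?thesis by (simp add: norm_of_real del: of_real_power)
  qed
  also have "\<dots> \<le> K * L2_norm D \<phi> + N * L2_norm D (\<lambda>x. cnj (g x) - \<phi> x)"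
    unfolding split
    by (rule order_trans[OF norm_triangle_ineq add_mono])
      (use bound[OF \<phi>(1)] L2_Cauchy_Schwarz[OF g dL] in \<open>simp_all add: N_def\<close>)
  also have "\<dots> \<le> K * (N + \<epsilon>) + N * \<epsilon>"
    using \<phi>n \<phi>(2) K N by (intro add_mono mult_left_mono) auto
  also have "\<dots> = K * N + (K + N) * \<epsilon>" by (simp add: algebra_simps)
  also have "(K + N) * \<epsilon> = (N - K) * N / 2"
    using N(3) unfolding \<epsilon>_def by (subst times_divide_eq_right, subst nonzero_mult_div_cancel_left) auto
  finally have "N * N \<le> K * N + (N * N - K * N) / 2" unfolding power2_eq_square left_diff_distrib .
  moreover have "K * N < N * N" using N by simp
  moreover have "y < x \<Longrightarrow> \<not> x \<le> y + (x - y) / 2" for x y :: real by (simp add: field_simps)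
  ultimately show False by blast
qed

text \<open>On a ball whose closure lies in \<open>U\<close>, the function \<open>h\<close> is integrable. There, by dominated convergence,
  the integrals of \<open>h\<close> over open sets vanish, and then those over measurable sets; so \<open>h\<close> is zero almost
  everywhere on the ball. Countably many such balls cover \<open>U\<close>.\<close>

lemma du_Bois_Reymond:
  fixes U :: "'a::euclidean_space set"
  assumes U: "open U" and h: "locally_integrable U h"
    and zero: "\<And>\<phi>. \<phi> \<in> test_functions U \<Longrightarrow> integral\<^sup>L (lebesgue_on U) (\<lambda>x. h x * \<phi> x) = 0"
  shows "AE x in lebesgue_on U. h x = 0"
proof -
  have Um: "U \<in> sets lebesgue" using U by auto
  have ball0: "AE x in lebesgue. x \<in> ball c r \<longrightarrow> h x = 0" if "cball c r \<subseteq> U" for c :: 'a and r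
  proof -
    let ?V = "ball c r" let ?N = "lebesgue_on ?V"
    have VU: "?V \<subseteq> U" using that ball_subset_cball by blast
    have Vm: "?V \<in> sets lebesgue" by auto
    have int: "integrable ?N h"
    proof (rule integrable_lebesgue_on_subset[OF _ ball_subset_cball Vm])
      show "integrable (lebesgue_on (cball c r)) h"
        using h that by (auto simp: locally_integrable_def)
    qed auto
    have hm: "h \<in> borel_measurable ?N" by (rule borel_measurable_integrable[OF int])
    have im: "(\<lambda>x. indicat_real A x) \<in> borel_measurable ?N" if "A \<in> sets lebesgue" for A
      using that by (intro borel_measurable_indicator' measurable_restrict_space1) auto
    have lim: "integral\<^sup>L ?N (\<lambda>x. indicat_real A x *\<^sub>R h x) = 0"
      if A: "A \<in> sets lebesgue" and \<phi>m: "\<And>n. \<phi> n \<in> borel_measurable ?N"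
        and bd: "\<And>n x. 0 \<le> \<phi> n x" "\<And>n x. \<phi> n x \<le> 1"
        and conv: "AE x in lebesgue. (\<lambda>n. \<phi> n x) \<longlonglongrightarrow> indicator A x"
        and z: "\<And>n. integral\<^sup>L ?N (\<lambda>x. \<phi> n x *\<^sub>R h x) = 0"
      for A and \<phi> :: "nat \<Rightarrow> 'a \<Rightarrow> real"
    proof -
      have "(\<lambda>n. integral\<^sup>L ?N (\<lambda>x. \<phi> n x *\<^sub>R h x)) \<longlonglongrightarrow> integral\<^sup>L ?N (\<lambda>x. indicat_real A x *\<^sub>R h x)"
      proof (rule integral_dominated_convergence[where w="\<lambda>x. norm (h x)"])
        show "AE x in ?N. (\<lambda>n. \<phi> n x *\<^sub>R h x) \<longlonglongrightarrow> indicat_real A x *\<^sub>R h x"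
          unfolding AE_lebesgue_on_iff[OF Vm]
          using conv by eventually_elim (auto intro!: tendsto_scaleR)
        show "AE x in ?N. norm (\<phi> n x *\<^sub>R h x) \<le> norm (h x)" for n
          using bd by (auto intro!: mult_left_le_one_le)
      qed (intro borel_measurable_scaleR im A \<phi>m hm integrable_norm int)+
      then show ?thesis unfolding z using LIMSEQ_unique[OF tendsto_const] by metis
    qed
    have op: "integral\<^sup>L ?N (\<lambda>x. indicat_real S x *\<^sub>R h x) = 0" if S: "open S" "S \<subseteq> ?V" for S
    proof -
      obtain \<phi> :: "nat \<Rightarrow> 'a \<Rightarrow> real" where \<phi>:
        "\<And>n. (\<lambda>x. complex_of_real (\<phi> n x)) \<in> test_functions S"
        "\<And>n x. 0 \<le> \<phi> n x" "\<And>n x. \<phi> n x \<le> 1" "\<And>x. (\<lambda>n. \<phi> n x) \<longlonglongrightarrow> indicator S x"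
        using test_functions_approx_open[OF S(1)] by blast
      show ?thesis
      proof (rule lim[where \<phi>=\<phi>])
        show "S \<in> sets lebesgue" using S by auto
        show "\<phi> n \<in> borel_measurable ?N" for n
          using measurable_compose[OF test_functions_measurable[OF \<phi>(1)[of n], of ?V] borel_measurable_Re]
          by simp
        show "AE x in lebesgue. (\<lambda>n. \<phi> n x) \<longlonglongrightarrow> indicator S x" using \<phi>(4) by simp
        show "integral\<^sup>L ?N (\<lambda>x. \<phi> n x *\<^sub>R h x) = 0" for n
        proof -
          have "integral\<^sup>L ?N (\<lambda>x. \<phi> n x *\<^sub>R h x) = integral\<^sup>L ?N (\<lambda>x. h x * complex_of_real (\<phi> n x))"
            by (simp add: scaleR_conv_of_real mult.commute)
          also have "\<dots> = integral\<^sup>L (lebesgue_on U) (\<lambda>x. h x * complex_of_real (\<phi> n x))"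
            using test_functions_zero_outside[OF test_functions_mono[OF \<phi>(1)[of n] S(2)]]
            by (intro integral_lebesgue_on_support(1)[symmetric] VU Vm Um) simp
          also have "\<dots> = 0" 
            using zero[OF test_functions_mono[OF \<phi>(1)[of n]]] S(2) VU by blast
          finally show ?thesis .
        qed
      qed (rule \<phi>)+
    qed
    have all: "set_lebesgue_integral ?N A h = 0" if "A \<in> sets ?N" for A
    proof -
      have A: "A \<in> sets lebesgue" "A \<subseteq> ?V"
        using that Vm by (auto simp: sets_restrict_space_iff)
      obtain S where S: "\<And>m. open (S m)" "\<And>m. S m \<subseteq> ?V"
        "AE x in lebesgue. (\<lambda>m. indicat_real (S m) x) \<longlonglongrightarrow> indicator A x"
        by (rule lebesgue_approx_open[OF A open_ball]) (rule that)
      have "integral\<^sup>L ?N (\<lambda>x. indicat_real A x *\<^sub>R h x) = 0"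
      proof (rule lim[OF A(1) _ _ _ S(3)])
        show "indicat_real (S n) \<in> borel_measurable ?N" for n
          using S(1)[of n] by (intro im) auto
        show "integral\<^sup>L ?N (\<lambda>x. indicat_real (S n) x *\<^sub>R h x) = 0" for n
          by (rule op[OF S(1,2)])
      qed auto
      then show ?thesis by (simp add: set_lebesgue_integral_def)
    qed
    interpret finite_measure ?N by (rule finite_measure_lebesgue_on) auto
    have "AE x in ?N. h x = 0" by (rule density_zero[OF int all])
    then show ?thesis by (simp add: AE_lebesgue_on_iff[OF Vm])
  qed
  define \<F> where "\<F> = {ball c r | c r. cball c r \<subseteq> U}"
  have "\<Union>\<F> = U"
  proof
    show "\<Union>\<F> \<subseteq> U" using ball_subset_cball by (fastforce simp: \<F>_def)
    show "U \<subseteq> \<Union>\<F>"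
    proof
      fix x assume "x \<in> U"
      then obtain r where "r > 0" "cball x r \<subseteq> U" using U open_contains_cball by blast
      then show "x \<in> \<Union>\<F>" by (auto simp: \<F>_def intro!: exI[of _ "ball x r"])
    qed
  qed
  moreover obtain \<F>' where \<F>': "\<F>' \<subseteq> \<F>" "countable \<F>'" "\<Union>\<F>' = \<Union>\<F>"
    using Lindelof[of \<F>] by (auto simp: \<F>_def)
  moreover have "AE x in lebesgue. \<forall>B\<in>\<F>'. x \<in> B \<longrightarrow> h x = 0"
  proof (subst AE_ball_countable[OF \<F>'(2)], intro ballI)
    fix B assume "B \<in> \<F>'"
    then obtain c r where "B = ball c r" "cball c r \<subseteq> U" using \<F>'(1) by (auto simp: \<F>_def)
    then show "AE x in lebesgue. x \<in> B \<longrightarrow> h x = 0" using ball0 by simp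
  qed
  ultimately have "AE x in lebesgue. x \<in> U \<longrightarrow> h x = 0"
    by (auto elim!: eventually_mono)
  then show ?thesis by (simp add: AE_lebesgue_on_iff[OF Um])
qed

section \<open>Translations\<close>

lemma lebesgue_translate:
  fixes c :: "'a::euclidean_space"
  shows "(\<lambda>x. x + c) \<in> lebesgue \<rightarrow>\<^sub>M lebesgue" "distr lebesgue lebesgue (\<lambda>x. x + c) = lebesgue"
proof -
  have T: "(\<lambda>x. c + (\<Sum>j\<in>Basis. (1 * (x \<bullet> j)) *\<^sub>R j)) = (\<lambda>x. x + c)"
    by (simp add: euclidean_representation add.commute)
  show "(\<lambda>x. x + c) \<in> lebesgue \<rightarrow>\<^sub>M lebesgue"
    using lebesgue_affine_measurable[of "\<lambda>_. 1" c] unfolding T by simp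
  show "distr lebesgue lebesgue (\<lambda>x. x + c) = lebesgue"
    using lebesgue_affine_euclidean[of "\<lambda>_. 1" c] unfolding T by (simp add: density_1)
qed

lemma lebesgue_on_translate:
  fixes f :: "'a::euclidean_space \<Rightarrow> 'b::euclidean_space" and c :: 'a
  assumes S: "S \<in> sets lebesgue" and f: "f \<in> borel_measurable (lebesgue_on S)"
  shows "{x. x + c \<in> S} \<in> sets lebesgue"
    and "(\<lambda>x. f (x + c)) \<in> borel_measurable (lebesgue_on {x. x + c \<in> S})"
    and "integrable (lebesgue_on {x. x + c \<in> S}) (\<lambda>x. f (x + c)) \<longleftrightarrow> integrable (lebesgue_on S) f"
    and "integral\<^sup>L (lebesgue_on {x. x + c \<in> S}) (\<lambda>x. f (x + c)) = integral\<^sup>L (lebesgue_on S) f"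
proof -
  let ?T = "\<lambda>x. x + c" let ?S = "{x. x + c \<in> S}"
  let ?F = "\<lambda>x. if x \<in> S then f x else 0"
  note tr = lebesgue_translate[of c]
  show S': "?S \<in> sets lebesgue"
    using measurable_sets[OF tr(1) S] by (simp add: vimage_def)
  have F: "?F \<in> borel_measurable lebesgue" by (rule borel_measurable_if_I[OF f S])
  have eq: "(\<lambda>x. ?F (?T x)) = (\<lambda>x. if x \<in> ?S then f (x + c) else 0)" by auto
  show "(\<lambda>x. f (x + c)) \<in> borel_measurable (lebesgue_on ?S)"
    using measurable_compose[OF tr(1) F] unfolding eq by (rule borel_measurable_if_D)
  show "integrable (lebesgue_on ?S) (\<lambda>x. f (x + c)) \<longleftrightarrow> integrable (lebesgue_on S) f"
    using integrable_distr_eq[OF tr(1) F] unfolding eq tr(2)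
      Lebesgue_Measure.integrable_restrict_UNIV[OF S] Lebesgue_Measure.integrable_restrict_UNIV[OF S'] by simp
  show "integral\<^sup>L (lebesgue_on ?S) (\<lambda>x. f (x + c)) = integral\<^sup>L (lebesgue_on S) f"
    using integral_distr[OF tr(1) F] unfolding eq tr(2)
      Lebesgue_Measure.integral_restrict_UNIV[OF S] Lebesgue_Measure.integral_restrict_UNIV[OF S'] by simp
qed

lemma L2_translate:
  assumes "v \<in> L2 S" "S \<in> sets lebesgue"
  shows "(\<lambda>x. v (x + c)) \<in> L2 {x. x + c \<in> S}"
    and "L2_norm {x. x + c \<in> S} (\<lambda>x. v (x + c)) = L2_norm S v"
proof -
  have m: "(\<lambda>x. (norm (v x))\<^sup>2) \<in> borel_measurable (lebesgue_on S)"
    using L2D(1)[OF assms(1)] by measurable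
  show "(\<lambda>x. v (x + c)) \<in> L2 {x. x + c \<in> S}"
    using lebesgue_on_translate(2)[OF assms(2) L2D(1)[OF assms(1)], of c]
      lebesgue_on_translate(3)[OF assms(2) m, of c] L2D(2)[OF assms(1)] by (simp add: L2_def)
  show "L2_norm {x. x + c \<in> S} (\<lambda>x. v (x + c)) = L2_norm S v"
    using lebesgue_on_translate(4)[OF assms(2) m, of c] by (simp add: L2_norm_def)
qed

section \<open>Translating a test function in a pairing\<close>

lemma partial_deriv_along_line:
  assumes "\<And>x. \<phi> differentiable (at x)"
  shows "((\<lambda>t. \<phi> (y - t *\<^sub>R e)) has_vector_derivative - partial_deriv e \<phi> (y - s *\<^sub>R e)) (at s)"
proof -
  let ?D = "frechet_derivative \<phi> (at (y - s *\<^sub>R e))"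
  have D: "(\<phi> has_derivative ?D) (at (y - s *\<^sub>R e))"
    using assms by (simp add: frechet_derivative_works)
  have "((\<lambda>t. y - t *\<^sub>R e) has_derivative (\<lambda>h. - (h *\<^sub>R e))) (at s)"
    by (auto intro!: derivative_eq_intros)
  from has_derivative_compose[OF this D]
  have "((\<lambda>t. \<phi> (y - t *\<^sub>R e)) has_derivative (\<lambda>h. ?D (- (h *\<^sub>R e)))) (at s)" .
  moreover have "?D (- (h *\<^sub>R e)) = h *\<^sub>R (- ?D e)" for h
    using has_derivative_linear[OF D] by (simp add: linear_neg linear_cmul)
  ultimately show ?thesis by (simp add: has_vector_derivative_def)
qed

lemma test_function_shift_bound:
  assumes \<phi>: "\<And>x. \<phi> differentiable (at x)" and C: "\<And>x. norm (partial_deriv e \<phi> x) \<le> C"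
  shows "norm (\<phi> (y - t *\<^sub>R e) - \<phi> (y - s *\<^sub>R e)) \<le> C * \<bar>t - s\<bar>"
proof -
  have "norm ((\<lambda>t. \<phi> (y - t *\<^sub>R e)) t - (\<lambda>t. \<phi> (y - t *\<^sub>R e)) s) \<le> C * norm (t - s)"
  proof (rule differentiable_bound[where S=UNIV])
    fix x :: real
    show "((\<lambda>t. \<phi> (y - t *\<^sub>R e)) has_derivative (\<lambda>h. h *\<^sub>R (- partial_deriv e \<phi> (y - x *\<^sub>R e)))) (at x within UNIV)"
      using partial_deriv_along_line[OF \<phi>] by (simp add: has_vector_derivative_def)
    show "onorm (\<lambda>h. h *\<^sub>R (- partial_deriv e \<phi> (y - x *\<^sub>R e))) \<le> C"
      by (intro onorm_le) (simp add: mult.commute[of C] mult_left_mono C)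
  qed auto
  then show ?thesis by simp
qed

text \<open>All regularity rests on \<open>\<phi>\<close>: its difference quotients converge pointwise and are bounded by the
  supremum of its derivative, so dominated convergence allows differentiation under the integral.\<close>

lemma shifted_pairing_has_derivative:
  fixes e :: "'a::euclidean_space"
  assumes z: "integrable (lebesgue_on U) z" and \<phi>: "\<phi> \<in> test_functions V" and e: "e \<in> Basis"
  shows "((\<lambda>t. integral\<^sup>L (lebesgue_on U) (\<lambda>y. z y * \<phi> (y - t *\<^sub>R e))) has_vector_derivative
           - integral\<^sup>L (lebesgue_on U) (\<lambda>y. z y * partial_deriv e \<phi> (y - s *\<^sub>R e))) (at s)"
proof -
  let ?M = "lebesgue_on U"
  note d = test_functionsD(4)[OF \<phi>]
  obtain C where C: "C > 0" "\<And>x. norm (partial_deriv e \<phi> x) \<le> C"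
    using test_functions_bounded[OF test_functions_partial_deriv[OF \<phi> e]] by blast
  have zm: "z \<in> borel_measurable ?M" by (rule borel_measurable_integrable[OF z])
  have int: "integrable ?M (\<lambda>y. z y * \<psi> (y - t *\<^sub>R e))" if \<psi>: "\<psi> \<in> test_functions V" for \<psi> t
  proof -
    obtain B where B: "B > 0" "\<And>x. norm (\<psi> x) \<le> B" using test_functions_bounded[OF \<psi>] by blast
    have tr: "(\<lambda>y. \<psi> (y - t *\<^sub>R e)) \<in> borel_measurable ?M"
      using test_functions_measurable[OF test_functions_translate[OF \<psi>, of "- t *\<^sub>R e"]] by simp
    show ?thesis
    proof (rule Bochner_Integration.integrable_bound)
      show "integrable ?M (\<lambda>y. of_real B * z y)" using z by simp
      show "(\<lambda>y. z y * \<psi> (y - t *\<^sub>R e)) \<in> borel_measurable ?M" by (rule borel_measurable_times[OF zm tr])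
      show "AE y in ?M. norm (z y * \<psi> (y - t *\<^sub>R e)) \<le> norm (of_real B * z y)"
        using B by (intro AE_I2) (simp add: norm_mult mult.commute[of B] mult_left_mono)
    qed
  qed
  define h where "h t = integral\<^sup>L ?M (\<lambda>y. z y * \<phi> (y - t *\<^sub>R e))" for t
  define L where "L = - integral\<^sup>L ?M (\<lambda>y. z y * partial_deriv e \<phi> (y - s *\<^sub>R e))"
  \<comment> \<open>The remainder of the first order expansion in \<open>t\<close>.\<close>
  define r where "r t y = \<phi> (y - (s + t) *\<^sub>R e) - \<phi> (y - s *\<^sub>R e) - t *\<^sub>R (- partial_deriv e \<phi> (y - s *\<^sub>R e))" for t y
  have intp: "integrable ?M (\<lambda>y. z y * partial_deriv e \<phi> (y - s *\<^sub>R e))"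
    by (rule int[OF test_functions_partial_deriv[OF \<phi> e]])
  have int_r: "integrable ?M (\<lambda>y. z y * r t y)" for t
    using int[OF \<phi>, of "s + t"] int[OF \<phi>, of s] intp
    by (simp add: r_def algebra_simps scaleR_conv_of_real)
  have eq: "h (s + t) - h s - t *\<^sub>R L = integral\<^sup>L ?M (\<lambda>y. z y * r t y)" for t
  proof -
    have "(\<lambda>y. z y * r t y) = (\<lambda>y. z y * \<phi> (y - (s + t) *\<^sub>R e) - z y * \<phi> (y - s *\<^sub>R e)
        + of_real t * (z y * partial_deriv e \<phi> (y - s *\<^sub>R e)))"
      by (simp add: r_def fun_eq_iff algebra_simps scaleR_conv_of_real)
    then show ?thesis
      using int[OF \<phi>, of "s + t"] int[OF \<phi>, of s] intp
      by (simp add: h_def L_def scaleR_conv_of_real)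
  qed
  have r_bound: "norm (r t y) \<le> 2 * C * \<bar>t\<bar>" for t y
  proof -
    have "norm (r t y) \<le> norm (\<phi> (y - (s + t) *\<^sub>R e) - \<phi> (y - s *\<^sub>R e)) + norm (t *\<^sub>R (- partial_deriv e \<phi> (y - s *\<^sub>R e)))"
      unfolding r_def by (rule norm_triangle_ineq4)
    also have "\<dots> \<le> C * \<bar>t\<bar> + \<bar>t\<bar> * C"
      using test_function_shift_bound[OF d C(2), of y "s + t" s] C(2)
      by (intro add_mono) (auto intro: mult_left_mono)
    finally show ?thesis by simp
  qed
  have "(\<lambda>t. norm (h (s + t) - h s - t *\<^sub>R L) / norm t) \<midarrow>0\<rightarrow> 0"
    unfolding tendsto_at_iff_sequentially
  proof (intro allI impI)
    fix X :: "nat \<Rightarrow> real" assume X: "\<forall>i. X i \<in> UNIV - {0}" "X \<longlonglongrightarrow> 0"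
    have "(\<lambda>i. integral\<^sup>L ?M (\<lambda>y. (z y * r (X i) y) / of_real \<bar>X i\<bar>)) \<longlonglongrightarrow> integral\<^sup>L ?M (\<lambda>y. 0)"
    proof (rule integral_dominated_convergence[where w="\<lambda>y. norm (z y) * (2 * C)"])
      show "(\<lambda>y. (z y * r (X i) y) / of_real \<bar>X i\<bar>) \<in> borel_measurable ?M" for i
        using int_r[of "X i"] by (intro borel_measurable_divide borel_measurable_integrable) auto
      show "integrable ?M (\<lambda>y. norm (z y) * (2 * C))" using z by simp
      show "AE y in ?M. norm (z y * r (X i) y / of_real \<bar>X i\<bar>) \<le> norm (z y) * (2 * C)" for i
      proof (rule AE_I2)
        fix y
        have "norm (r (X i) y) / \<bar>X i\<bar> \<le> 2 * C"
          using r_bound[of "X i" y] X(1) by (simp add: divide_le_eq)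
        then show "norm (z y * r (X i) y / of_real \<bar>X i\<bar>) \<le> norm (z y) * (2 * C)"
          using mult_left_mono[of "norm (r (X i) y) / \<bar>X i\<bar>" "2 * C" "norm (z y)"]
          by (simp add: norm_mult norm_divide)
      qed
      show "AE y in ?M. (\<lambda>i. z y * r (X i) y / of_real \<bar>X i\<bar>) \<longlonglongrightarrow> 0"
      proof (rule AE_I2)
        fix y
        have "(\<lambda>t. norm (r t y) / norm t) \<midarrow>0\<rightarrow> 0"
          using partial_deriv_along_line[OF d, of y e s]
          unfolding has_vector_derivative_def has_derivative_at r_def by blast
        then have "(\<lambda>i. norm (r (X i) y) / \<bar>X i\<bar>) \<longlonglongrightarrow> 0"
          using X unfolding tendsto_at_iff_sequentially comp_def by simp
        then have "(\<lambda>i. norm (z y) * (norm (r (X i) y) / \<bar>X i\<bar>)) \<longlonglongrightarrow> norm (z y) * 0"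
          by (intro tendsto_intros)
        then have "(\<lambda>i. norm (z y * r (X i) y / of_real \<bar>X i\<bar>)) \<longlonglongrightarrow> 0"
          by (simp add: norm_mult norm_divide)
        then show "(\<lambda>i. z y * r (X i) y / of_real \<bar>X i\<bar>) \<longlonglongrightarrow> 0"
          by (rule tendsto_norm_zero_cancel)
      qed
    qed simp
    then have "(\<lambda>i. norm (integral\<^sup>L ?M (\<lambda>y. (z y * r (X i) y) / of_real \<bar>X i\<bar>))) \<longlonglongrightarrow> 0"
      by (intro tendsto_norm_zero) simp
    moreover have "norm (integral\<^sup>L ?M (\<lambda>y. (z y * r (X i) y) / of_real \<bar>X i\<bar>))
        = norm (h (s + X i) - h s - X i *\<^sub>R L) / norm (X i)" for i
      unfolding eq by (simp add: norm_divide)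
    ultimately show "((\<lambda>t. norm (h (s + t) - h s - t *\<^sub>R L) / norm t) \<circ> X) \<longlonglongrightarrow> 0"
      by (simp add: comp_def)
  qed
  then have "(h has_derivative (\<lambda>t. t *\<^sub>R L)) (at s)"
    by (simp add: has_derivative_at bounded_linear_scaleR_left)
  then show ?thesis by (simp add: has_vector_derivative_def h_def[abs_def] L_def)
qed

text \<open>The integral of a translate of \<open>\<phi>\<close> is constant in the translation parameter, and its derivative
  with respect to that parameter is minus the integral of the partial derivative.\<close>

lemma integral_partial_deriv_zero:
  fixes U :: "'a::euclidean_space set"
  assumes \<phi>: "\<phi> \<in> test_functions U" and U: "open U" and e: "e \<in> Basis"
  shows "integral\<^sup>L (lebesgue_on U) (partial_deriv e \<phi>) = 0"
proof -
  let ?K = "closure {x. \<phi> x \<noteq> 0}"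
  obtain \<rho> where \<rho>: "?K \<subseteq> ball 0 \<rho>"
    using test_functionsD(2)[OF \<phi>] bounded_subset_ballD compact_imp_bounded by blast
  \<comment> \<open>This ball contains the supports of all translates of \<open>\<phi>\<close> by less than 1.\<close>
  let ?B = "ball (0::'a) (\<rho> + 1)"
  have K: "\<phi> \<in> test_functions (ball 0 \<rho>)" using \<phi> \<rho> by (auto simp: test_functions_def)
  have B: "integrable (lebesgue_on ?B) (\<lambda>x. 1 :: complex)"
  proof -
    interpret finite_measure "lebesgue_on ?B" by (rule finite_measure_lebesgue_on) auto
    show ?thesis by simp
  qed
  have const: "integral\<^sup>L (lebesgue_on ?B) (\<lambda>y. 1 * \<phi> (y - t *\<^sub>R e)) = integral\<^sup>L lebesgue \<phi>" if "\<bar>t\<bar> < 1" for t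
  proof -
    have "\<phi> (y - t *\<^sub>R e) = 0" if "y \<notin> ?B" for y
    proof -
      have "norm y \<le> norm (y - t *\<^sub>R e) + norm (t *\<^sub>R e)" by (metis diff_add_cancel norm_triangle_ineq)
      then have "y - t *\<^sub>R e \<notin> ball 0 \<rho>" using that \<open>\<bar>t\<bar> < 1\<close> e by auto
      then show ?thesis by (rule test_functions_zero_outside[OF K])
    qed
    then have "integral\<^sup>L (lebesgue_on ?B) (\<lambda>y. 1 * \<phi> (y - t *\<^sub>R e)) = integral\<^sup>L (lebesgue_on UNIV) (\<lambda>y. \<phi> (y + - t *\<^sub>R e))"
      by (subst integral_lebesgue_on_support(1)[of ?B UNIV]) auto
    also have "\<dots> = integral\<^sup>L (lebesgue_on UNIV) \<phi>"
      using lebesgue_on_translate(4)[of UNIV \<phi> "- t *\<^sub>R e"] test_functions_measurable[OF \<phi>] by simp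
    finally show ?thesis by (simp add: lebesgue_on_UNIV_eq)
  qed
  have "((\<lambda>t. integral\<^sup>L (lebesgue_on ?B) (\<lambda>y. 1 * \<phi> (y - t *\<^sub>R e))) has_vector_derivative
           - integral\<^sup>L (lebesgue_on ?B) (\<lambda>y. 1 * partial_deriv e \<phi> (y - 0 *\<^sub>R e))) (at 0)"
    by (rule shifted_pairing_has_derivative[OF B \<phi> e])
  moreover have "((\<lambda>t. integral\<^sup>L (lebesgue_on ?B) (\<lambda>y. 1 * \<phi> (y - t *\<^sub>R e))) has_vector_derivative 0) (at 0)"
    by (rule has_vector_derivative_transform_within_open[where S="ball 0 1" and f="\<lambda>t. integral\<^sup>L lebesgue \<phi>"])
      (auto simp: const[simplified])
  ultimately have "integral\<^sup>L (lebesgue_on ?B) (partial_deriv e \<phi>) = 0"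
    using vector_derivative_unique_at by fastforce
  moreover have "integral\<^sup>L (lebesgue_on ?B) (partial_deriv e \<phi>) = integral\<^sup>L (lebesgue_on UNIV) (partial_deriv e \<phi>)"
    using test_functions_zero_outside[OF test_functions_partial_deriv[OF K e]]
    by (intro integral_lebesgue_on_support(1)[symmetric]) auto
  moreover have "integral\<^sup>L (lebesgue_on UNIV) (partial_deriv e \<phi>) = integral\<^sup>L (lebesgue_on U) (partial_deriv e \<phi>)"
    using test_functions_zero_outside[OF test_functions_partial_deriv[OF \<phi> e]] U
    by (intro integral_lebesgue_on_support(1)) auto
  ultimately show ?thesis by simp
qed

section \<open>Weak derivatives\<close>

lemma locally_integrable_cong_AE:
  assumes v: "locally_integrable U v" and U: "U \<in> sets lebesgue" and eq: "AE x in lebesgue_on U. v x = w x"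
  shows "locally_integrable U w"
  unfolding locally_integrable_def
proof (intro allI impI)
  fix K assume K: "compact K \<and> K \<subseteq> U"
  then have Km: "K \<in> sets lebesgue" by (auto dest: lmeasurable_compact fmeasurableD)
  have i: "integrable (lebesgue_on K) v" using v K by (simp add: locally_integrable_def)
  have a: "AE x in lebesgue_on K. v x = w x"
    using eq K unfolding AE_lebesgue_on_iff[OF U] AE_lebesgue_on_iff[OF Km]
    by (auto elim!: eventually_mono)
  show "integrable (lebesgue_on K) w"
    by (rule integrable_cong_AE_imp[OF i borel_measurable_lebesgue_on_AE[OF borel_measurable_integrable[OF i] Km a] a])
qed

lemma locally_integrable_lin:
  assumes "locally_integrable U v" "locally_integrable U w"
  shows "locally_integrable U (\<lambda>x. c * v x + d * w x)"
  using assms unfolding locally_integrable_def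
  by (intro allI impI Bochner_Integration.integrable_add integrable_mult_right) blast+

lemma is_weak_partialD:
  assumes "is_weak_partial U e v g"
  shows "locally_integrable U v" "locally_integrable U g"
    "\<phi> \<in> test_functions U \<Longrightarrow> integral\<^sup>L (lebesgue_on U) (\<lambda>x. v x * partial_deriv e \<phi> x)
          = - integral\<^sup>L (lebesgue_on U) (\<lambda>x. g x * \<phi> x)"
  using assms unfolding is_weak_partial_def by blast+

lemma is_weak_partial_cong_AE:
  assumes w: "is_weak_partial U e v g" and U: "U \<in> sets lebesgue" and e: "e \<in> Basis"
    and v: "AE x in lebesgue_on U. v x = v' x" and g: "AE x in lebesgue_on U. g x = g' x"
  shows "is_weak_partial U e v' g'"
  unfolding is_weak_partial_def
proof (intro conjI ballI)
  show lv: "locally_integrable U v'" by (rule locally_integrable_cong_AE[OF is_weak_partialD(1)[OF w] U v])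
  show lg: "locally_integrable U g'" by (rule locally_integrable_cong_AE[OF is_weak_partialD(2)[OF w] U g])
  fix \<phi> assume \<phi>: "\<phi> \<in> test_functions U"
  note \<phi>' = test_functions_partial_deriv[OF \<phi> e]
  have "integral\<^sup>L (lebesgue_on U) (\<lambda>x. v' x * partial_deriv e \<phi> x) = integral\<^sup>L (lebesgue_on U) (\<lambda>x. v x * partial_deriv e \<phi> x)"
    using v by (intro integral_cong_AE borel_measurable_integrable integrable_times_test lv \<phi>' U
        is_weak_partialD(1)[OF w]) (auto elim: eventually_mono)
  moreover have "integral\<^sup>L (lebesgue_on U) (\<lambda>x. g' x * \<phi> x) = integral\<^sup>L (lebesgue_on U) (\<lambda>x. g x * \<phi> x)"
    using g by (intro integral_cong_AE borel_measurable_integrable integrable_times_test lg \<phi> U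
        is_weak_partialD(2)[OF w]) (auto elim: eventually_mono)
  ultimately show "integral\<^sup>L (lebesgue_on U) (\<lambda>x. v' x * partial_deriv e \<phi> x)
       = - integral\<^sup>L (lebesgue_on U) (\<lambda>x. g' x * \<phi> x)"
    using is_weak_partialD(3)[OF w \<phi>] by simp
qed

lemma is_weak_partial_lin:
  assumes v: "is_weak_partial U e v g" and w: "is_weak_partial U e w h"
    and U: "U \<in> sets lebesgue" and e: "e \<in> Basis"
  shows "is_weak_partial U e (\<lambda>x. c * v x + d * w x) (\<lambda>x. c * g x + d * h x)"
  unfolding is_weak_partial_def
proof (intro conjI ballI)
  show "locally_integrable U (\<lambda>x. c * v x + d * w x)" "locally_integrable U (\<lambda>x. c * g x + d * h x)"
    using v w by (auto intro!: locally_integrable_lin dest: is_weak_partialD)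
  fix \<phi> assume \<phi>: "\<phi> \<in> test_functions U"
  note \<phi>' = test_functions_partial_deriv[OF \<phi> e]
  have lin: "integral\<^sup>L (lebesgue_on U) (\<lambda>x. (c * p x + d * q x) * \<psi> x)
     = c * integral\<^sup>L (lebesgue_on U) (\<lambda>x. p x * \<psi> x) + d * integral\<^sup>L (lebesgue_on U) (\<lambda>x. q x * \<psi> x)"
    if "locally_integrable U p" "locally_integrable U q" "\<psi> \<in> test_functions U" for p q \<psi>
    using integrable_times_test[OF that(1,3) U] integrable_times_test[OF that(2,3) U]
    by (simp add: algebra_simps)
  show "integral\<^sup>L (lebesgue_on U) (\<lambda>x. (c * v x + d * w x) * partial_deriv e \<phi> x)
     = - integral\<^sup>L (lebesgue_on U) (\<lambda>x. (c * g x + d * h x) * \<phi> x)"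
    using lin[OF is_weak_partialD(1)[OF v] is_weak_partialD(1)[OF w] \<phi>']
      lin[OF is_weak_partialD(2)[OF v] is_weak_partialD(2)[OF w] \<phi>]
      is_weak_partialD(3)[OF v \<phi>] is_weak_partialD(3)[OF w \<phi>] by simp
qed

lemma is_weak_partial_unique:
  assumes g: "is_weak_partial U e v g" and h: "is_weak_partial U e v h" and U: "open U"
  shows "AE x in lebesgue_on U. g x = h x"
proof -
  have Um: "U \<in> sets lebesgue" using U by auto
  have "AE x in lebesgue_on U. 1 * g x + (-1) * h x = 0"
  proof (rule du_Bois_Reymond[OF U])
    show "locally_integrable U (\<lambda>x. 1 * g x + (-1) * h x)"
      using g h by (intro locally_integrable_lin) (auto dest: is_weak_partialD)
    fix \<phi> assume \<phi>: "\<phi> \<in> test_functions U"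
    have "integral\<^sup>L (lebesgue_on U) (\<lambda>x. (1 * g x + (-1) * h x) * \<phi> x)
       = integral\<^sup>L (lebesgue_on U) (\<lambda>x. g x * \<phi> x) - integral\<^sup>L (lebesgue_on U) (\<lambda>x. h x * \<phi> x)"
      using integrable_times_test[OF is_weak_partialD(2)[OF g] \<phi> Um]
        integrable_times_test[OF is_weak_partialD(2)[OF h] \<phi> Um]
      by (simp add: left_diff_distrib)
    then show "integral\<^sup>L (lebesgue_on U) (\<lambda>x. (1 * g x + (-1) * h x) * \<phi> x) = 0"
      using is_weak_partialD(3)[OF g \<phi>] is_weak_partialD(3)[OF h \<phi>] by simp
  qed
  then show ?thesis by eventually_elim simp
qed

lemma is_weak_partial_weak_partial:
  "is_weak_partial U e v g \<Longrightarrow> is_weak_partial U e v (weak_partial U e v)"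
  unfolding weak_partial_def by (rule someI[of "is_weak_partial U e v"])

text \<open>Whichever representative the choice operator selects, it may be replaced by any known weak
  derivative.\<close>

lemma weak_partial_eq:
  "is_weak_partial U e v g \<Longrightarrow> open U \<Longrightarrow> AE x in lebesgue_on U. weak_partial U e v x = g x"
  using is_weak_partial_unique[OF is_weak_partial_weak_partial] .

lemma integral_times_test_translate:
  fixes c :: "'a::euclidean_space"
  assumes q: "locally_integrable U q" and \<phi>: "\<phi> \<in> test_functions V"
    and U: "open U" and V: "open V" and VU: "\<And>x. x \<in> V \<Longrightarrow> x + c \<in> U"
  shows "(\<lambda>x. \<phi> (x - c)) \<in> test_functions U"
    and "integral\<^sup>L (lebesgue_on V) (\<lambda>x. q (x + c) * \<phi> x) = integral\<^sup>L (lebesgue_on U) (\<lambda>x. q x * \<phi> (x - c))"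
proof -
  let ?W = "{x. x + c \<in> U}"
  have Um: "U \<in> sets lebesgue" and Vm: "V \<in> sets lebesgue" using U V by auto
  have VW: "V \<subseteq> ?W" using VU by auto
  have "(\<lambda>x. \<phi> (x - c)) \<in> test_functions {x. x - c \<in> V}"
    using test_functions_translate[OF \<phi>, of "- c"] by simp
  then show \<psi>: "(\<lambda>x. \<phi> (x - c)) \<in> test_functions U"
    by (rule test_functions_mono) (use VU in force)
  note m = borel_measurable_integrable[OF integrable_times_test[OF q \<psi> Um]]
  have "integral\<^sup>L (lebesgue_on ?W) (\<lambda>x. q (x + c) * \<phi> (x + c - c)) = integral\<^sup>L (lebesgue_on U) (\<lambda>x. q x * \<phi> (x - c))"
    by (rule lebesgue_on_translate(4)[OF Um m])
  moreover have "integral\<^sup>L (lebesgue_on ?W) (\<lambda>x. q (x + c) * \<phi> x) = integral\<^sup>L (lebesgue_on V) (\<lambda>x. q (x + c) * \<phi> x)"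
    using test_functions_zero_outside[OF \<phi>]
    by (intro integral_lebesgue_on_support(1)[OF VW Vm] lebesgue_on_translate(1)[OF Um m]) simp
  ultimately show "integral\<^sup>L (lebesgue_on V) (\<lambda>x. q (x + c) * \<phi> x) = integral\<^sup>L (lebesgue_on U) (\<lambda>x. q x * \<phi> (x - c))"
    by simp
qed

lemma is_weak_partial_translate:
  assumes w: "is_weak_partial U e v g" and U: "open U" and V: "open V" and VU: "\<And>x. x \<in> V \<Longrightarrow> x + c \<in> U"
    and e: "e \<in> Basis"
  shows "is_weak_partial V e (\<lambda>x. v (x + c)) (\<lambda>x. g (x + c))"
  unfolding is_weak_partial_def
proof (intro conjI ballI)
  have loc: "locally_integrable V (\<lambda>x. q (x + c))" if q: "locally_integrable U q" for q
    unfolding locally_integrable_def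
  proof (intro allI impI)
    fix K assume K: "compact K \<and> K \<subseteq> V"
    define K' where "K' = (\<lambda>x. c + x) ` K"
    have K': "compact K'" "K' \<subseteq> U" "{x. x + c \<in> K'} = K"
      using K VU compact_translation[of K c] by (auto simp: K'_def add.commute)
    then have i: "integrable (lebesgue_on K') q" using q by (simp add: locally_integrable_def)
    have "K' \<in> sets lebesgue" using lmeasurable_compact[OF K'(1)] by (rule fmeasurableD)
    from lebesgue_on_translate(3)[OF this borel_measurable_integrable[OF i], of c] i K'(3)
    show "integrable (lebesgue_on K) (\<lambda>x. q (x + c))" by simp
  qed
  show "locally_integrable V (\<lambda>x. v (x + c))" "locally_integrable V (\<lambda>x. g (x + c))"
    using w by (auto intro!: loc dest: is_weak_partialD)
  fix \<phi> assume \<phi>: "\<phi> \<in> test_functions V"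
  note tr = integral_times_test_translate[OF _ _ U V VU]
  have \<psi>': "partial_deriv e (\<lambda>x. \<phi> (x - c)) x = partial_deriv e \<phi> (x - c)" for x
    using partial_deriv_translate[of \<phi> x "- c" e] test_functionsD(4)[OF \<phi>] by simp
  show "integral\<^sup>L (lebesgue_on V) (\<lambda>x. v (x + c) * partial_deriv e \<phi> x)
      = - integral\<^sup>L (lebesgue_on V) (\<lambda>x. g (x + c) * \<phi> x)"
    using is_weak_partialD(3)[OF w tr(1)[OF is_weak_partialD(1)[OF w] \<phi>]]
      tr(2)[OF is_weak_partialD(1)[OF w] test_functions_partial_deriv[OF \<phi> e]]
      tr(2)[OF is_weak_partialD(2)[OF w] \<phi>]
    by (simp add: \<psi>')
qed

lemma is_weak_partial_cnj:
  assumes w: "is_weak_partial U e v g" and U: "U \<in> sets lebesgue" and e: "e \<in> Basis"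
  shows "is_weak_partial U e (\<lambda>x. cnj (v x)) (\<lambda>x. cnj (g x))"
  unfolding is_weak_partial_def
proof (intro conjI ballI)
  have loc: "locally_integrable U (\<lambda>x. cnj (q x))" if "locally_integrable U q" for q
    using that integrable_cnj unfolding locally_integrable_def by blast
  show "locally_integrable U (\<lambda>x. cnj (v x))" "locally_integrable U (\<lambda>x. cnj (g x))"
    using w by (auto intro!: loc dest: is_weak_partialD)
  fix \<phi> assume \<phi>: "\<phi> \<in> test_functions U"
  have "cnj (integral\<^sup>L (lebesgue_on U) (\<lambda>x. v x * partial_deriv e (\<lambda>x. cnj (\<phi> x)) x))
      = cnj (- integral\<^sup>L (lebesgue_on U) (\<lambda>x. g x * cnj (\<phi> x)))"
    using is_weak_partialD(3)[OF w test_functions_cnj[OF \<phi>]] by simp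
  then show "integral\<^sup>L (lebesgue_on U) (\<lambda>x. cnj (v x) * partial_deriv e \<phi> x)
      = - integral\<^sup>L (lebesgue_on U) (\<lambda>x. cnj (g x) * \<phi> x)"
    unfolding partial_deriv_cnj[OF test_functionsD(4)[OF \<phi>]] complex_cnj_minus
      Bochner_Integration.integral_cnj[symmetric] complex_cnj_mult complex_cnj_cnj .
qed

lemma is_weak_partial_subset:
  assumes "is_weak_partial U e v g" "open U" "open V" "V \<subseteq> U" "e \<in> Basis"
  shows "is_weak_partial V e v g"
  using is_weak_partial_translate[OF assms(1-3), of 0] assms(4,5) by auto

text \<open>By the product rule, the claim says that the integral of a partial derivative of a test function
  vanishes.\<close>

lemma is_weak_partial_test_function:
  fixes U :: "'a::euclidean_space set"
  assumes \<phi>: "\<phi> \<in> test_functions U" and U: "open U" and e: "e \<in> Basis"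
  shows "is_weak_partial U e \<phi> (partial_deriv e \<phi>)"
  unfolding is_weak_partial_def
proof (intro conjI ballI)
  have Um: "U \<in> sets lebesgue" using U by auto
  note \<phi>' = test_functions_partial_deriv[OF \<phi> e]
  show l: "locally_integrable U \<phi>" "locally_integrable U (partial_deriv e \<phi>)"
    using \<phi> \<phi>' Um by (auto intro!: L2_imp_locally_integrable test_functions_L2)
  fix \<psi> assume \<psi>: "\<psi> \<in> test_functions U"
  note \<psi>' = test_functions_partial_deriv[OF \<psi> e]
  have der: "((\<lambda>x. \<phi> x * \<psi> x) has_derivative
      (\<lambda>h. \<phi> x * frechet_derivative \<psi> (at x) h + frechet_derivative \<phi> (at x) h * \<psi> x)) (at x)" for x
    using test_functionsD(4)[OF \<phi>] test_functionsD(4)[OF \<psi>]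
    by (intro has_derivative_mult) (auto simp: frechet_derivative_works)
  have "partial_deriv e (\<lambda>x. \<phi> x * \<psi> x) = (\<lambda>x. \<phi> x * partial_deriv e \<psi> x + partial_deriv e \<phi> x * \<psi> x)"
    by (simp add: fun_eq_iff flip: frechet_derivative_at[OF der])
  moreover have "integral\<^sup>L (lebesgue_on U) (partial_deriv e (\<lambda>x. \<phi> x * \<psi> x)) = 0"
    by (intro integral_partial_deriv_zero[OF _ U e] test_functions_mult[OF \<psi>] test_functionsD(1)[OF \<phi>])
  ultimately show "integral\<^sup>L (lebesgue_on U) (\<lambda>x. \<phi> x * partial_deriv e \<psi> x)
      = - integral\<^sup>L (lebesgue_on U) (\<lambda>x. partial_deriv e \<phi> x * \<psi> x)"
    using integrable_times_test[OF l(1) \<psi>' Um] integrable_times_test[OF l(2) \<psi> Um]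
    by (simp add: eq_neg_iff_add_eq_0)
qed

lemma H1D:
  assumes v: "v \<in> H1 U" and U: "open U" and e: "e \<in> Basis"
  shows "v \<in> L2 U" "is_weak_partial U e v (weak_partial U e v)" "weak_partial U e v \<in> L2 U"
proof -
  show "v \<in> L2 U" using v by (simp add: H1_def)
  obtain g where g: "g \<in> L2 U" "is_weak_partial U e v g" using v e by (auto simp: H1_def)
  show "is_weak_partial U e v (weak_partial U e v)" by (rule is_weak_partial_weak_partial[OF g(2)])
  have "AE x in lebesgue_on U. g x = weak_partial U e v x"
    using weak_partial_eq[OF g(2) U] by eventually_elim simp
  then show "weak_partial U e v \<in> L2 U" using L2_cong_AE[OF g(1)] U by simp
qed

lemma grad_L2_norm_power2:
  assumes v: "v \<in> H1 U" and U: "open U"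
  shows "(grad_L2_norm U v)\<^sup>2 = (\<Sum>e\<in>Basis. (L2_norm U (weak_partial U e v))\<^sup>2)"
proof -
  have "(grad_L2_norm U v)\<^sup>2 = integral\<^sup>L (lebesgue_on U) (\<lambda>x. \<Sum>e\<in>Basis. (norm (weak_partial U e v x))\<^sup>2)"
    unfolding grad_L2_norm_def
    by (intro real_sqrt_pow2 integral_nonneg_AE) (auto intro!: sum_nonneg)
  also have "\<dots> = (\<Sum>e\<in>Basis. (L2_norm U (weak_partial U e v))\<^sup>2)"
    unfolding L2_norm_power2
    by (intro Bochner_Integration.integral_sum L2D(2) H1D(3)[OF v U])
  finally show ?thesis .
qed

text \<open>For a test function in place of \<open>w\<close> this is the definition of the weak derivative of \<open>z\<close>, applied to
  the conjugate; both sides depend continuously on \<open>w\<close> in the \<open>H1\<close> norm.\<close>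

lemma integration_by_parts_H1_0:
  fixes D :: "'a::euclidean_space set"
  assumes D: "open D" and z: "z \<in> L2 D" "z' \<in> L2 D" "is_weak_partial D e z z'"
    and w: "w \<in> H1_0 D" and e: "e \<in> Basis"
  shows "integral\<^sup>L (lebesgue_on D) (\<lambda>x. z' x * cnj (w x))
       = - integral\<^sup>L (lebesgue_on D) (\<lambda>x. z x * cnj (weak_partial D e w x))"
proof -
  let ?M = "lebesgue_on D" let ?w = "weak_partial D e w"
  have Dm: "D \<in> sets lebesgue" using D by auto
  have w1: "w \<in> H1 D" using w by (simp add: H1_0_def)
  note wD = H1D[OF w1 D e]
  define I where "I = integral\<^sup>L ?M (\<lambda>x. z' x * cnj (w x)) + integral\<^sup>L ?M (\<lambda>x. z x * cnj (?w x))"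
  have bound: "norm I \<le> (L2_norm D z' + L2_norm D z) * \<epsilon>" if \<epsilon>: "\<epsilon> > 0" for \<epsilon>
  proof -
    obtain \<phi> where \<phi>: "\<phi> \<in> test_functions D" "H1_norm D (\<lambda>x. w x - \<phi> x) < \<epsilon>"
      using w \<epsilon> unfolding H1_0_def by blast
    note \<phi>' = test_functions_partial_deriv[OF \<phi>(1)]
    have diff: "is_weak_partial D e' (\<lambda>x. w x - \<phi> x) (\<lambda>x. weak_partial D e' w x - partial_deriv e' \<phi> x)"
      if "e' \<in> Basis" for e'
      using is_weak_partial_lin[OF H1D(2)[OF w1 D that] is_weak_partial_test_function[OF \<phi>(1) D that] Dm that, of 1 "-1"]
      by simp
    have L2d: "(\<lambda>x. weak_partial D e' w x - partial_deriv e' \<phi> x) \<in> L2 D" if "e' \<in> Basis" for e'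
      by (intro L2_diff H1D(3)[OF w1 D that] test_functions_L2[OF \<phi>'[OF that] Dm])
    have L2d0: "(\<lambda>x. w x - \<phi> x) \<in> L2 D" by (intro L2_diff wD(1) test_functions_L2[OF \<phi>(1) Dm])
    have d1: "(\<lambda>x. w x - \<phi> x) \<in> H1 D"
      unfolding H1_def using diff L2d L2d0 by auto
    have n0: "L2_norm D (\<lambda>x. w x - \<phi> x) \<le> \<epsilon>"
    proof (rule order_trans[OF _ less_imp_le[OF \<phi>(2)]])
      show "L2_norm D (\<lambda>x. w x - \<phi> x) \<le> H1_norm D (\<lambda>x. w x - \<phi> x)"
        unfolding H1_norm_def by (rule real_sqrt_sum_squares_ge1)
    qed
    have "(L2_norm D (weak_partial D e (\<lambda>x. w x - \<phi> x)))\<^sup>2 \<le> (grad_L2_norm D (\<lambda>x. w x - \<phi> x))\<^sup>2"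
      unfolding grad_L2_norm_power2[OF d1 D] by (rule member_le_sum) (use e in auto)
    then have "L2_norm D (weak_partial D e (\<lambda>x. w x - \<phi> x)) \<le> grad_L2_norm D (\<lambda>x. w x - \<phi> x)"
      by (rule power2_le_imp_le) (auto simp: grad_L2_norm_def intro!: integral_nonneg_AE sum_nonneg)
    moreover have "L2_norm D (weak_partial D e (\<lambda>x. w x - \<phi> x)) = L2_norm D (\<lambda>x. ?w x - partial_deriv e \<phi> x)"
      by (rule L2_norm_cong_AE[OF H1D(3)[OF d1 D e] Dm weak_partial_eq[OF diff[OF e] D]])
    moreover have "grad_L2_norm D (\<lambda>x. w x - \<phi> x) \<le> H1_norm D (\<lambda>x. w x - \<phi> x)"
      unfolding H1_norm_def by (rule real_sqrt_sum_squares_ge2)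
    ultimately have n1: "L2_norm D (\<lambda>x. ?w x - partial_deriv e \<phi> x) \<le> \<epsilon>"
      using \<phi>(2) by linarith
    note pd = partial_deriv_cnj[OF test_functionsD(4)[OF \<phi>(1)]]
    have 0: "integral\<^sup>L ?M (\<lambda>x. z' x * cnj (\<phi> x)) + integral\<^sup>L ?M (\<lambda>x. z x * cnj (partial_deriv e \<phi> x)) = 0"
      using is_weak_partialD(3)[OF z(3) test_functions_cnj[OF \<phi>(1)]] by (simp add: pd)
    have I: "I = integral\<^sup>L ?M (\<lambda>x. z' x * cnj (w x - \<phi> x)) + integral\<^sup>L ?M (\<lambda>x. z x * cnj (?w x - partial_deriv e \<phi> x))"
    proof -
      have A: "integral\<^sup>L ?M (\<lambda>x. z' x * cnj (w x - \<phi> x)) = integral\<^sup>L ?M (\<lambda>x. z' x * cnj (w x)) - integral\<^sup>L ?M (\<lambda>x. z' x * cnj (\<phi> x))"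
        unfolding complex_cnj_diff right_diff_distrib
        by (intro Bochner_Integration.integral_diff L2_mult_integrable L2_cnj z wD(1) test_functions_L2[OF \<phi>(1) Dm])
      have B: "integral\<^sup>L ?M (\<lambda>x. z x * cnj (?w x - partial_deriv e \<phi> x)) = integral\<^sup>L ?M (\<lambda>x. z x * cnj (?w x)) - integral\<^sup>L ?M (\<lambda>x. z x * cnj (partial_deriv e \<phi> x))"
        unfolding complex_cnj_diff right_diff_distrib
        by (intro Bochner_Integration.integral_diff L2_mult_integrable L2_cnj z wD(3) test_functions_L2[OF \<phi>'[OF e] Dm])
      show ?thesis unfolding I_def A B add_diff_add[symmetric] 0 by (rule diff_zero[symmetric])
    qed
    have "norm I \<le> L2_norm D z' * L2_norm D (\<lambda>x. w x - \<phi> x) + L2_norm D z * L2_norm D (\<lambda>x. ?w x - partial_deriv e \<phi> x)"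
      unfolding I using L2_Cauchy_Schwarz[OF z(2) L2_cnj[OF L2d0]]
        L2_Cauchy_Schwarz[OF z(1) L2_cnj[OF L2d[OF e]]]
      unfolding L2_norm_cnj by (rule order_trans[OF norm_triangle_ineq add_mono])
    also have "\<dots> \<le> L2_norm D z' * \<epsilon> + L2_norm D z * \<epsilon>"
      by (intro add_mono mult_left_mono n0 n1 L2_norm_nonneg)
    finally show ?thesis by (simp add: algebra_simps)
  qed
  have "norm I \<le> 0"
  proof (rule field_le_epsilon)
    fix \<delta> :: real assume "\<delta> > 0"
    define B where "B = L2_norm D z' + L2_norm D z + 1"
    have B: "B > 0" using L2_norm_nonneg[of D z'] L2_norm_nonneg[of D z] by (simp add: B_def)
    have "norm I \<le> (B - 1) * (\<delta> / B)"
      using bound[of "\<delta> / B"] \<open>\<delta> > 0\<close> B by (simp add: B_def)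
    also have "\<dots> \<le> B * (\<delta> / B)" using \<open>\<delta> > 0\<close> B by (intro mult_right_mono) auto
    finally show "norm I \<le> 0 + \<delta>" using B by simp
  qed
  then show ?thesis by (simp add: I_def eq_neg_iff_add_eq_0)
qed

section \<open>Difference quotients of periodic functions\<close>

lemma integral_split_AE:
  fixes p :: "'a::euclidean_space \<Rightarrow> 'b::euclidean_space"
  assumes S: "S \<in> sets lebesgue" "A \<in> sets lebesgue" "B \<in> sets lebesgue"
    and AB: "A \<subseteq> S" "B \<subseteq> S" "A \<inter> B = {}" and null: "negligible (S - (A \<union> B))"
    and p: "integrable (lebesgue_on S) p"
  shows "integral\<^sup>L (lebesgue_on S) p = integral\<^sup>L (lebesgue_on A) p + integral\<^sup>L (lebesgue_on B) p"
proof -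
  let ?F = "\<lambda>T x. if x \<in> T then p x else 0"
  note I = Lebesgue_Measure.integrable_restrict_UNIV
  note R = Lebesgue_Measure.integral_restrict_UNIV
  have iS: "integrable lebesgue (?F S)" using I[OF S(1)] p by blast
  have iA: "integrable lebesgue (?F A)" 
    using I[OF S(2)] integrable_lebesgue_on_subset[OF p AB(1) S(2,1)] by blast
  have iB: "integrable lebesgue (?F B)" 
    using I[OF S(3)] integrable_lebesgue_on_subset[OF p AB(2) S(3,1)] by blast
  have "AE x in lebesgue. x \<notin> S - (A \<union> B)"
    using null by (intro AE_not_in) (simp add: negligible_iff_null_sets)
  then have "AE x in lebesgue. ?F S x = ?F A x + ?F B x"
    by eventually_elim (use AB in auto)
  then have "integral\<^sup>L lebesgue (?F S) = integral\<^sup>L lebesgue (\<lambda>x. ?F A x + ?F B x)"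
    using iS iA iB by (intro integral_cong_AE borel_measurable_integrable Bochner_Integration.integrable_add)
  also have "\<dots> = integral\<^sup>L lebesgue (?F A) + integral\<^sup>L lebesgue (?F B)"
    by (rule Bochner_Integration.integral_add[OF iA iB])
  finally show ?thesis unfolding R[OF S(1)] R[OF S(2)] R[OF S(3)] .
qed

text \<open>A period cell and one coordinate direction. Only translations in that direction, by at most one
  period, are used, so it is enough to have the functions on a bounded open set \<open>U\<close> that contains the
  cell translated in this way.\<close>

locale period_cell =
  fixes a b e :: "'a::euclidean_space" and U :: "'a set"
  assumes e: "e \<in> Basis" and U: "open U" "bounded U"
    and L_pos: "a \<bullet> e < b \<bullet> e"
    and cell_shift: "\<And>x t. x \<in> box a b \<Longrightarrow> 0 \<le> t \<Longrightarrow> t \<le> (b - a) \<bullet> e \<Longrightarrow> x + t *\<^sub>R e \<in> U"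
begin

abbreviation "D \<equiv> box a b"
abbreviation "L \<equiv> (b - a) \<bullet> e"

definition periodic :: "('a \<Rightarrow> 'b) \<Rightarrow> bool" where
  "periodic v \<longleftrightarrow> (AE x in lebesgue_on D. v (x + L *\<^sub>R e) = v x)"

lemma L_gt_0: "0 < L" using L_pos by (simp add: inner_diff_left)

lemma D_subset_U: "D \<subseteq> U"
  using cell_shift[of _ 0] L_gt_0 by force

lemma U_measurable: "U \<in> sets lebesgue" "U \<in> lmeasurable"
  using U by (auto intro: lmeasurable_open)

lemma D_measurable: "D \<in> sets lebesgue" "D \<in> lmeasurable"
  by (auto intro: lmeasurable_open)

text \<open>The translated cell is cut at the face \<open>x \<bullet> e = b \<bullet> e\<close>. What lies beyond is the translate, by a full
  period, of the part of the cell that the translation has left behind. The cuts are null sets.\<close>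

lemma periodic_integral_shift:
  fixes p :: "'a \<Rightarrow> 'c::euclidean_space"
  assumes p: "integrable (lebesgue_on U) p" "periodic p" and t: "0 < t" "t < L"
  shows "integral\<^sup>L (lebesgue_on D) (\<lambda>x. p (x + t *\<^sub>R e)) = integral\<^sup>L (lebesgue_on D) p"
proof -
  define E where "E = {y. y - t *\<^sub>R e \<in> D}"
  \<comment> \<open>\<open>?C\<close> is left behind, \<open>?F\<close> is the part beyond the face, \<open>?G\<close> is common to both cells.\<close>
  let ?C = "{x \<in> D. x \<bullet> e < a \<bullet> e + t}" and ?G = "{x \<in> D. x \<bullet> e > a \<bullet> e + t}"
  let ?F = "{y \<in> E. y \<bullet> e > b \<bullet> e}"
  have ee: "e \<bullet> e = 1" using e by simp
  have eo: "e \<bullet> i = 0" if "i \<in> Basis" "i \<noteq> e" for i using e that by (simp add: inner_not_same_Basis)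
  have Lt: "a \<bullet> e + t < b \<bullet> e" using t by (simp add: inner_diff_left)
  have oE: "open E"
    using open_vimage[OF open_box, of "\<lambda>y. y - t *\<^sub>R e" a b]
    by (simp add: E_def vimage_def continuous_on_diff)
  have h1: "open {x. x \<bullet> e < c}" "open {x. c < x \<bullet> e}" for c
    by (auto intro!: open_Collect_less continuous_intros)
  have op: "open ?C" "open ?G" "open ?F"
    using open_Int[OF open_box[of a b] h1(1)[of "a \<bullet> e + t"]] open_Int[OF open_box[of a b] h1(2)[of "a \<bullet> e + t"]]
      open_Int[OF oE h1(2)[of "b \<bullet> e"]] by (simp_all add: Int_def)
  have EU: "E \<subseteq> U"
  proof
    fix y assume "y \<in> E"
    then have "y - t *\<^sub>R e + t *\<^sub>R e \<in> U" using t by (intro cell_shift) (auto simp: E_def)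
    then show "y \<in> U" by simp
  qed
  have pD: "integrable (lebesgue_on D) p" and pE: "integrable (lebesgue_on E) p"
    using EU D_subset_U oE U by (auto intro!: integrable_lebesgue_on_subset[OF p(1)])
  have pF: "integrable (lebesgue_on ?F) p"
    using op oE by (intro integrable_lebesgue_on_subset[OF pE]) auto
  have comp: "(y + s *\<^sub>R e) \<bullet> i = (if i = e then y \<bullet> e + s else y \<bullet> i)" if "i \<in> Basis" for y s i
    using that by (auto simp: inner_add_left ee eo)
  have comp': "(y - s *\<^sub>R e) \<bullet> i = (if i = e then y \<bullet> e - s else y \<bullet> i)" if "i \<in> Basis" for y s i
    using that by (auto simp: inner_diff_left ee eo)
  have hyp: "negligible (S - (A \<union> B))" if "S - (A \<union> B) \<subseteq> {x. x \<bullet> e = c}" for S A B c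
    using negligible_subset[OF negligible_standard_hyperplane[OF e]] that by blast
  have E_iff: "y \<in> E \<longleftrightarrow> a \<bullet> e + t < y \<bullet> e \<and> y \<bullet> e < b \<bullet> e + t \<and> (\<forall>i\<in>Basis. i \<noteq> e \<longrightarrow> a \<bullet> i < y \<bullet> i \<and> y \<bullet> i < b \<bullet> i)" for y
    using e by (auto simp: E_def mem_box comp')
  have D_iff: "y \<in> D \<longleftrightarrow> a \<bullet> e < y \<bullet> e \<and> y \<bullet> e < b \<bullet> e \<and> (\<forall>i\<in>Basis. i \<noteq> e \<longrightarrow> a \<bullet> i < y \<bullet> i \<and> y \<bullet> i < b \<bullet> i)" for y
    using e by (auto simp: mem_box)
  have "{x. x + t *\<^sub>R e \<in> E} = D" by (simp add: E_def)
  then have "integral\<^sup>L (lebesgue_on D) (\<lambda>x. p (x + t *\<^sub>R e)) = integral\<^sup>L (lebesgue_on E) p"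
    using lebesgue_on_translate(4)[of E p "t *\<^sub>R e"] oE borel_measurable_integrable[OF pE] by simp
  also have "\<dots> = integral\<^sup>L (lebesgue_on ?F) p + integral\<^sup>L (lebesgue_on ?G) p"
  proof (rule integral_split_AE)
    show "?G \<subseteq> E" using t by (auto simp only: E_iff D_iff mem_Collect_eq)
    have "E - (?F \<union> ?G) \<subseteq> {x. x \<bullet> e = b \<bullet> e}"
      using t Lt by (auto simp only: E_iff D_iff mem_Collect_eq)
    then show "negligible (E - (?F \<union> ?G))" by (rule hyp)
    show "?F \<inter> ?G = {}" by (auto simp only: E_iff D_iff mem_Collect_eq)
  qed (use op oE pE in auto)
  also have "integral\<^sup>L (lebesgue_on ?F) p = integral\<^sup>L (lebesgue_on ?C) p"
  proof -
    have FC: "{x. x + L *\<^sub>R e \<in> ?F} = ?C"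
    proof (rule set_eqI)
      fix x show "x \<in> {x. x + L *\<^sub>R e \<in> ?F} \<longleftrightarrow> x \<in> ?C"
        unfolding mem_Collect_eq E_iff D_iff using comp[OF e] comp t Lt by (auto simp: inner_diff_left)
    qed
    have Fm: "?F \<in> sets lebesgue" and Cm: "?C \<in> sets lebesgue" using op by auto
    note tr = lebesgue_on_translate[OF Fm borel_measurable_integrable[OF pF], of "L *\<^sub>R e", unfolded FC]
    have "integral\<^sup>L (lebesgue_on ?F) p = integral\<^sup>L (lebesgue_on ?C) (\<lambda>x. p (x + L *\<^sub>R e))"
      using tr(4) by simp
    also have "\<dots> = integral\<^sup>L (lebesgue_on ?C) p"
    proof (rule integral_cong_AE[OF tr(2)])
      show "p \<in> borel_measurable (lebesgue_on ?C)"
        by (intro borel_measurable_integrable integrable_lebesgue_on_subset[OF pD _ Cm D_measurable(1)]) auto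
      show "AE x in lebesgue_on ?C. p (x + L *\<^sub>R e) = p x"
        using p(2) unfolding periodic_def AE_lebesgue_on_iff[OF Cm] AE_lebesgue_on_iff[OF D_measurable(1)]
        by eventually_elim simp
    qed
    finally show ?thesis .
  qed
  also have "integral\<^sup>L (lebesgue_on ?C) p + integral\<^sup>L (lebesgue_on ?G) p = integral\<^sup>L (lebesgue_on D) p"
  proof (rule integral_split_AE[symmetric])
    have "D - (?C \<union> ?G) \<subseteq> {x. x \<bullet> e = a \<bullet> e + t}" by auto
    then show "negligible (D - (?C \<union> ?G))" by (rule hyp)
  qed (use op pD in auto)
  finally show ?thesis .
qed

lemma L2_shift:
  assumes "v \<in> L2 U" "0 \<le> t" "t \<le> L"
  shows "(\<lambda>x. v (x + t *\<^sub>R e)) \<in> L2 D"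
proof (rule L2_subset[OF L2_translate(1)[OF assms(1) U_measurable(1)] _ D_measurable(1)])
  show "D \<subseteq> {x. x + t *\<^sub>R e \<in> U}" using cell_shift assms by auto
  show "{x. x + t *\<^sub>R e \<in> U} \<in> sets lebesgue"
    by (rule lebesgue_on_translate(1)[OF U_measurable(1) L2D(1)[OF assms(1)]])
qed

lemma L2_on_cell: "v \<in> L2 U \<Longrightarrow> v \<in> L2 D"
  using L2_shift[of v 0] L_gt_0 by simp

lemma L2_norm_shift:
  assumes v: "v \<in> L2 U" "periodic v" and t: "0 \<le> t" "t < L"
  shows "L2_norm D (\<lambda>x. v (x + t *\<^sub>R e)) = L2_norm D v"
proof (cases "t = 0")
  case False
  have "periodic (\<lambda>x. (norm (v x))\<^sup>2)"
    using v(2) unfolding periodic_def by eventually_elim simp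
  with periodic_integral_shift[OF L2D(2)[OF v(1)], of t] t False
  show ?thesis by (simp add: L2_norm_def)
qed simp

definition weak_pair :: "('a \<Rightarrow> complex) \<Rightarrow> ('a \<Rightarrow> complex) \<Rightarrow> bool" where
  "weak_pair z z' \<longleftrightarrow> z \<in> L2 U \<and> z' \<in> L2 U \<and> is_weak_partial U e z z' \<and> periodic z \<and> periodic z'"

context
  fixes z z' :: "'a \<Rightarrow> complex"
  assumes z: "weak_pair z z'"
begin

lemma weak_pairD: "z \<in> L2 U" "z' \<in> L2 U" "is_weak_partial U e z z'" "periodic z" "periodic z'"
  using z by (auto simp: weak_pair_def)

lemma difference_in_L2: "0 \<le> t \<Longrightarrow> t \<le> L \<Longrightarrow> (\<lambda>x. z (x + t *\<^sub>R e) - z x) \<in> L2 D"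
  by (intro L2_diff L2_shift L2_on_cell weak_pairD)

text \<open>The translation is moved onto \<open>\<phi>\<close>, which makes the pairing differentiable; the definition of the
  weak derivative then moves the derivative from \<open>\<phi>\<close> to \<open>z\<close>.\<close>

lemma shift_pairing_derivative:
  assumes \<phi>: "\<phi> \<in> test_functions D" and t: "0 \<le> t" "t < L"
  shows "((\<lambda>t. integral\<^sup>L (lebesgue_on D) (\<lambda>x. z (x + t *\<^sub>R e) * \<phi> x)) has_vector_derivative
           integral\<^sup>L (lebesgue_on D) (\<lambda>x. z' (x + t *\<^sub>R e) * \<phi> x)) (at t within {0..<L})"
proof -
  let ?H = "\<lambda>t. integral\<^sup>L (lebesgue_on U) (\<lambda>y. z y * \<phi> (y - t *\<^sub>R e))"
  have DU: "x + s *\<^sub>R e \<in> U" if "x \<in> D" "s \<in> {0..<L}" for x s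
    using cell_shift that by auto
  note tr = integral_times_test_translate[OF _ \<phi> U(1) open_box DU]
  have locz: "locally_integrable U z" "locally_integrable U z'"
    using weak_pairD U_measurable by (auto intro: L2_imp_locally_integrable)
  have eq: "integral\<^sup>L (lebesgue_on D) (\<lambda>x. z (x + s *\<^sub>R e) * \<phi> x) = ?H s" if "s \<in> {0..<L}" for s
    using tr(2)[OF locz(1) _ that] by simp
  have t': "t \<in> {0..<L}" using t by simp
  have \<phi>t: "(\<lambda>x. \<phi> (x - t *\<^sub>R e)) \<in> test_functions U" using tr(1)[OF locz(1) _ t'] by simp
  have pd: "partial_deriv e (\<lambda>x. \<phi> (x - t *\<^sub>R e)) x = partial_deriv e \<phi> (x - t *\<^sub>R e)" for x
    using partial_deriv_translate[of \<phi> x "- t *\<^sub>R e" e] test_functionsD(4)[OF \<phi>] by simp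
  have "- integral\<^sup>L (lebesgue_on U) (\<lambda>y. z y * partial_deriv e \<phi> (y - t *\<^sub>R e))
      = integral\<^sup>L (lebesgue_on U) (\<lambda>y. z' y * \<phi> (y - t *\<^sub>R e))"
    using is_weak_partialD(3)[OF weak_pairD(3) \<phi>t] by (simp add: pd)
  also have "\<dots> = integral\<^sup>L (lebesgue_on D) (\<lambda>x. z' (x + t *\<^sub>R e) * \<phi> x)"
    using tr(2)[OF locz(2) _ t'] by simp
  finally have val: "- integral\<^sup>L (lebesgue_on U) (\<lambda>y. z y * partial_deriv e \<phi> (y - t *\<^sub>R e))
      = integral\<^sup>L (lebesgue_on D) (\<lambda>x. z' (x + t *\<^sub>R e) * \<phi> x)" .
  have "(?H has_vector_derivative integral\<^sup>L (lebesgue_on D) (\<lambda>x. z' (x + t *\<^sub>R e) * \<phi> x)) (at t within {0..<L})"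
    using shifted_pairing_has_derivative[OF L2_imp_integrable[OF weak_pairD(1) U_measurable(2)] \<phi> e, of t]
    unfolding val by (rule has_vector_derivative_at_within)
  then show ?thesis
    by (rule has_vector_derivative_transform[OF t' eq, rotated])
qed

text \<open>The mean value inequality; by periodicity the norm of \<open>z'\<close> over a translated cell is that over the
  cell, which bounds the derivative uniformly.\<close>

lemma difference_pairing_bound:
  assumes \<phi>: "\<phi> \<in> test_functions D" and t: "0 \<le> t" "t < L"
  shows "norm (integral\<^sup>L (lebesgue_on D) (\<lambda>x. (z (x + t *\<^sub>R e) - z x) * \<phi> x)) \<le> t * L2_norm D z' * L2_norm D \<phi>"
proof -
  let ?h = "\<lambda>t. integral\<^sup>L (lebesgue_on D) (\<lambda>x. z (x + t *\<^sub>R e) * \<phi> x)"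
  let ?h' = "\<lambda>t. integral\<^sup>L (lebesgue_on D) (\<lambda>x. z' (x + t *\<^sub>R e) * \<phi> x)"
  note \<phi>L = test_functions_L2[OF \<phi> D_measurable(1)]
  have "norm (?h t - ?h 0) \<le> (L2_norm D z' * L2_norm D \<phi>) * norm (t - 0)"
  proof (rule differentiable_bound[where S="{0..<L}"])
    fix s assume s: "s \<in> {0..<L}"
    show "(?h has_derivative (\<lambda>u. u *\<^sub>R ?h' s)) (at s within {0..<L})"
      using shift_pairing_derivative[OF \<phi>, of s] s by (simp add: has_vector_derivative_def)
    have "norm (?h' s) \<le> L2_norm D z' * L2_norm D \<phi>"
      using L2_Cauchy_Schwarz[OF L2_shift[OF weak_pairD(2), of s] \<phi>L] s
        L2_norm_shift[OF weak_pairD(2,5), of s] by simp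
    then show "onorm (\<lambda>u. u *\<^sub>R ?h' s) \<le> L2_norm D z' * L2_norm D \<phi>"
      by (intro onorm_le) (simp add: mult.commute[of "L2_norm D z' * L2_norm D \<phi>"] mult_left_mono)
  qed (use t L_gt_0 in auto)
  moreover have "integral\<^sup>L (lebesgue_on D) (\<lambda>x. (z (x + t *\<^sub>R e) - z x) * \<phi> x) = ?h t - ?h 0"
    using L2_mult_integrable[OF L2_shift[OF weak_pairD(1), of t] \<phi>L] L2_mult_integrable[OF L2_on_cell[OF weak_pairD(1)] \<phi>L] t
    by (simp add: left_diff_distrib)
  ultimately show ?thesis using t by (simp add: mult_ac)
qed

lemma L2_norm_difference:
  assumes t: "0 \<le> t" "t < L"
  shows "L2_norm D (\<lambda>x. z (x + t *\<^sub>R e) - z x) \<le> t * L2_norm D z'"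
proof (rule L2_norm_le_dual[OF open_box D_measurable(2)])
  show "(\<lambda>x. z (x + t *\<^sub>R e) - z x) \<in> L2 D" using difference_in_L2 t by simp
  show "0 \<le> t * L2_norm D z'" using t by (simp add: L2_norm_nonneg)
qed (use difference_pairing_bound t in simp)

lemma difference_quotient_tendsto_test:
  assumes \<phi>: "\<phi> \<in> test_functions D"
  shows "((\<lambda>t. integral\<^sup>L (lebesgue_on D) (\<lambda>x. (z (x + t *\<^sub>R e) - z x) * \<phi> x) /\<^sub>R t) \<longlongrightarrow>
           integral\<^sup>L (lebesgue_on D) (\<lambda>x. z' x * \<phi> x)) (at_right 0)"
proof -
  let ?h = "\<lambda>t. integral\<^sup>L (lebesgue_on D) (\<lambda>x. z (x + t *\<^sub>R e) * \<phi> x)"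
  let ?l = "integral\<^sup>L (lebesgue_on D) (\<lambda>x. z' x * \<phi> x)"
  note \<phi>L = test_functions_L2[OF \<phi> D_measurable(1)]
  have nhd: "at 0 within {0..<L} = at_right 0"
    by (rule at_within_nhd[of 0 "{..<L}"]) (use L_gt_0 in auto)
  have "(?h has_derivative (\<lambda>u. u *\<^sub>R ?l)) (at 0 within {0..<L})"
    using shift_pairing_derivative[OF \<phi>, of 0] L_gt_0 by (simp add: has_vector_derivative_def)
  then have "((\<lambda>t. (1 / norm (t - 0)) *\<^sub>R (?h t - (?h 0 + (t - 0) *\<^sub>R ?l))) \<longlongrightarrow> 0) (at 0 within {0..<L})"
    unfolding has_derivative_within by blast
  then have "((\<lambda>t. (1 / norm (t - 0)) *\<^sub>R (?h t - (?h 0 + (t - 0) *\<^sub>R ?l))) \<longlongrightarrow> 0) (at_right 0)"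
    by (simp only: nhd)
  then have "((\<lambda>t. (1 / norm (t - 0)) *\<^sub>R (?h t - (?h 0 + (t - 0) *\<^sub>R ?l)) + ?l) \<longlongrightarrow> 0 + ?l) (at_right 0)"
    by (intro tendsto_intros)
  moreover have "eventually (\<lambda>t. t \<in> {0<..<L}) (at_right 0)"
    by (rule eventually_at_right_real[OF L_gt_0])
  then have "eventually (\<lambda>t. (1 / norm (t - 0)) *\<^sub>R (?h t - (?h 0 + (t - 0) *\<^sub>R ?l)) + ?l
     = integral\<^sup>L (lebesgue_on D) (\<lambda>x. (z (x + t *\<^sub>R e) - z x) * \<phi> x) /\<^sub>R t) (at_right 0)"
  proof eventually_elim
    case (elim t)
    have eq: "integral\<^sup>L (lebesgue_on D) (\<lambda>x. (z (x + t *\<^sub>R e) - z x) * \<phi> x) = ?h t - ?h 0"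
      using L2_mult_integrable[OF L2_shift[OF weak_pairD(1), of t] \<phi>L] L2_mult_integrable[OF L2_on_cell[OF weak_pairD(1)] \<phi>L] elim
      by (simp add: left_diff_distrib)
    have "(1 / norm (t - 0)) *\<^sub>R (A - (B + (t - 0) *\<^sub>R l)) + l = (A - B) /\<^sub>R t" for A B l :: complex
      using elim by (simp add: algebra_simps inverse_eq_divide)
    then show ?case unfolding eq .
  qed
  ultimately show ?thesis by (simp add: filterlim_cong[OF refl refl])
qed

text \<open>The difference quotients are bounded in \<open>L2\<close> and converge against test functions, which are dense.
  Hence they converge weakly.\<close>

lemma difference_quotient_tendsto:
  assumes W: "W \<in> L2 D"
  shows "((\<lambda>t. integral\<^sup>L (lebesgue_on D) (\<lambda>x. (z (x + t *\<^sub>R e) - z x) * W x) /\<^sub>R t) \<longlongrightarrow>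
           integral\<^sup>L (lebesgue_on D) (\<lambda>x. z' x * W x)) (at_right 0)"
proof (rule tendstoI)
  fix \<epsilon> :: real assume \<epsilon>: "\<epsilon> > 0"
  \<comment> \<open>Replacing \<open>W\<close> by \<open>\<phi>\<close> costs the norm of \<open>z'\<close> twice, in the quotient and in the limit; adding 1
    keeps \<open>K\<close> positive.\<close>
  define K where "K = 2 * L2_norm D z' + 1"
  have K: "K > 0" using L2_norm_nonneg[of D z'] by (simp add: K_def)
  then have "\<epsilon> / (2 * K) > 0" using \<epsilon> by simp
  then obtain \<phi> where \<phi>: "\<phi> \<in> test_functions D" "L2_norm D (\<lambda>x. W x - \<phi> x) < \<epsilon> / (2 * K)"
    using test_functions_dense_L2[OF open_box D_measurable(2) W] unfolding test_closure_def by blast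
  note \<phi>L = test_functions_L2[OF \<phi>(1) D_measurable(1)]
  note dL = L2_diff[OF W \<phi>L]
  let ?I = "\<lambda>t \<psi>. integral\<^sup>L (lebesgue_on D) (\<lambda>x. (z (x + t *\<^sub>R e) - z x) * \<psi> x) /\<^sub>R t"
  let ?J = "\<lambda>\<psi>. integral\<^sup>L (lebesgue_on D) (\<lambda>x. z' x * \<psi> x)"
  let ?d = "\<lambda>x. W x - \<phi> x"
  have pos: "eventually (\<lambda>t. t \<in> {0<..<L}) (at_right 0)"
    by (rule eventually_at_right_real[OF L_gt_0])
  have "eventually (\<lambda>t. dist (?I t \<phi>) (?J \<phi>) < \<epsilon> / 2) (at_right 0)"
    using tendstoD[OF difference_quotient_tendsto_test[OF \<phi>(1)], of "\<epsilon> / 2"] \<epsilon> by simp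
  with pos show "eventually (\<lambda>t. dist (?I t W) (?J W) < \<epsilon>) (at_right 0)"
  proof eventually_elim
    case (elim t)
    note g = difference_in_L2[of t]
    have gL: "(\<lambda>x. z (x + t *\<^sub>R e) - z x) \<in> L2 D" using g elim by simp
    have I: "?I t W = ?I t \<phi> + ?I t ?d"
    proof -
      have "integral\<^sup>L (lebesgue_on D) (\<lambda>x. (z (x + t *\<^sub>R e) - z x) * W x)
        = integral\<^sup>L (lebesgue_on D) (\<lambda>x. (z (x + t *\<^sub>R e) - z x) * \<phi> x) + integral\<^sup>L (lebesgue_on D) (\<lambda>x. (z (x + t *\<^sub>R e) - z x) * ?d x)"
        by (subst Bochner_Integration.integral_add[OF L2_mult_integrable[OF gL \<phi>L] L2_mult_integrable[OF gL dL], symmetric])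
          (simp add: algebra_simps)
      then show ?thesis by (simp only: scaleR_add_right)
    qed
    have J: "?J W = ?J \<phi> + ?J ?d"
      by (subst Bochner_Integration.integral_add[OF L2_mult_integrable[OF L2_on_cell[OF weak_pairD(2)] \<phi>L] L2_mult_integrable[OF L2_on_cell[OF weak_pairD(2)] dL], symmetric])
        (simp add: algebra_simps)
    have "norm (integral\<^sup>L (lebesgue_on D) (\<lambda>x. (z (x + t *\<^sub>R e) - z x) * ?d x)) \<le> t * L2_norm D z' * L2_norm D ?d"
      using order_trans[OF L2_Cauchy_Schwarz[OF gL dL] mult_right_mono[OF L2_norm_difference L2_norm_nonneg]] elim by simp
    then have Id: "norm (?I t ?d) \<le> L2_norm D z' * L2_norm D ?d"
      using elim by (simp add: divide_le_eq inverse_eq_divide mult_ac)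
    have Jd: "norm (?J ?d) \<le> L2_norm D z' * L2_norm D ?d"
      by (rule L2_Cauchy_Schwarz[OF L2_on_cell[OF weak_pairD(2)] dL])
    have "2 * L2_norm D z' * L2_norm D ?d \<le> K * L2_norm D ?d"
      by (intro mult_right_mono L2_norm_nonneg) (simp add: K_def)
    also have "\<dots> < K * (\<epsilon> / (2 * K))" using \<phi>(2) K by (intro mult_strict_left_mono)
    also have "\<dots> = \<epsilon> / 2" using K by simp
    finally have rest: "2 * L2_norm D z' * L2_norm D ?d < \<epsilon> / 2" .
    have "norm (p + q - (r + s)) \<le> norm (p - r) + (norm q + norm s)" for p q r s :: complex
      using norm_triangle_ineq[of "p - r" "q - s"] norm_triangle_ineq4[of q s] by (simp add: add_diff_add)
    then have "norm (?I t W - ?J W) \<le> norm (?I t \<phi> - ?J \<phi>) + (norm (?I t ?d) + norm (?J ?d))"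
      unfolding I J by blast
    then show ?case using elim(2) Id Jd rest unfolding dist_norm by linarith
  qed
qed

end

text \<open>The discrete product rule, integrated over the cell. The left-hand side vanishes by periodicity, the
  product of the two differences is of order \<open>t\<^sup>2\<close>, and the other two terms, divided by \<open>t\<close>, converge to
  the two integrals of the formula, whose sum is therefore 0.\<close>

lemma periodic_integration_by_parts:
  assumes z: "weak_pair z z'" and w: "weak_pair w w'"
  shows "integral\<^sup>L (lebesgue_on D) (\<lambda>x. z' x * w x) = - integral\<^sup>L (lebesgue_on D) (\<lambda>x. z x * w' x)"
proof -
  let ?dz = "\<lambda>t x. z (x + t *\<^sub>R e) - z x" and ?dw = "\<lambda>t x. w (x + t *\<^sub>R e) - w x"
  let ?int = "\<lambda>f. integral\<^sup>L (lebesgue_on D) f"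
  note zD = weak_pairD[OF z] and wD = weak_pairD[OF w]
  have pos: "eventually (\<lambda>t. t \<in> {0<..<L}) (at_right 0)"
    by (rule eventually_at_right_real[OF L_gt_0])
  have lim1: "((\<lambda>t. ?int (\<lambda>x. ?dz t x * w x) /\<^sub>R t) \<longlongrightarrow> ?int (\<lambda>x. z' x * w x)) (at_right 0)"
    by (rule difference_quotient_tendsto[OF z L2_on_cell[OF wD(1)]])
  have lim2: "((\<lambda>t. ?int (\<lambda>x. ?dw t x * z x) /\<^sub>R t) \<longlongrightarrow> ?int (\<lambda>x. w' x * z x)) (at_right 0)"
    by (rule difference_quotient_tendsto[OF w L2_on_cell[OF zD(1)]])
  have lim3: "((\<lambda>t. ?int (\<lambda>x. ?dz t x * ?dw t x) /\<^sub>R t) \<longlongrightarrow> 0) (at_right 0)"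
  proof (rule Lim_null_comparison)
    show "((\<lambda>t. t * (L2_norm D z' * L2_norm D w')) \<longlongrightarrow> 0) (at_right 0)"
      by (rule tendsto_mult_left_zero) (rule tendsto_ident_at)
    show "eventually (\<lambda>t. norm (?int (\<lambda>x. ?dz t x * ?dw t x) /\<^sub>R t) \<le> t * (L2_norm D z' * L2_norm D w')) (at_right 0)"
      using pos
    proof eventually_elim
      case (elim t)
      have "norm (?int (\<lambda>x. ?dz t x * ?dw t x)) \<le> L2_norm D (?dz t) * L2_norm D (?dw t)"
        using elim by (intro L2_Cauchy_Schwarz difference_in_L2[OF z] difference_in_L2[OF w]) auto
      also have "\<dots> \<le> (t * L2_norm D z') * (t * L2_norm D w')"
        using elim by (intro mult_mono L2_norm_difference[OF z] L2_norm_difference[OF w] L2_norm_nonneg)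
          (auto intro!: mult_nonneg_nonneg L2_norm_nonneg)
      finally show ?case using elim by (simp add: divide_le_eq inverse_eq_divide mult_ac)
    qed
  qed
  have "((\<lambda>t. ?int (\<lambda>x. ?dz t x * w x) /\<^sub>R t + ?int (\<lambda>x. ?dw t x * z x) /\<^sub>R t + ?int (\<lambda>x. ?dz t x * ?dw t x) /\<^sub>R t)
      \<longlongrightarrow> ?int (\<lambda>x. z' x * w x) + ?int (\<lambda>x. w' x * z x) + 0) (at_right 0)"
    by (intro tendsto_add lim1 lim2 lim3)
  moreover have "eventually (\<lambda>t. ?int (\<lambda>x. ?dz t x * w x) /\<^sub>R t + ?int (\<lambda>x. ?dw t x * z x) /\<^sub>R t + ?int (\<lambda>x. ?dz t x * ?dw t x) /\<^sub>R t = 0) (at_right 0)"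
    using pos
  proof eventually_elim
    case (elim t)
    have t: "0 \<le> t" "t \<le> L" "0 < t" "t < L" using elim by auto
    note i1 = L2_mult_integrable[OF difference_in_L2[OF z t(1,2)] L2_on_cell[OF wD(1)]]
    note i2 = L2_mult_integrable[OF difference_in_L2[OF w t(1,2)] L2_on_cell[OF zD(1)]]
    note i3 = L2_mult_integrable[OF difference_in_L2[OF z t(1,2)] difference_in_L2[OF w t(1,2)]]
    have "periodic (\<lambda>x. z x * w x)"
      using zD(4) wD(4) unfolding periodic_def by eventually_elim simp
    then have shift: "?int (\<lambda>x. z (x + t *\<^sub>R e) * w (x + t *\<^sub>R e)) = ?int (\<lambda>x. z x * w x)"
      using periodic_integral_shift[OF L2_mult_integrable[OF zD(1) wD(1)] _ t(3,4)] by simp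
    have "?int (\<lambda>x. ?dz t x * w x) + ?int (\<lambda>x. ?dw t x * z x) + ?int (\<lambda>x. ?dz t x * ?dw t x)
        = ?int (\<lambda>x. ?dz t x * w x + ?dw t x * z x + ?dz t x * ?dw t x)"
      using Bochner_Integration.integral_add[OF Bochner_Integration.integrable_add[OF i1 i2] i3]
        Bochner_Integration.integral_add[OF i1 i2] by metis
    also have "\<dots> = ?int (\<lambda>x. z (x + t *\<^sub>R e) * w (x + t *\<^sub>R e) - z x * w x)"
      by (intro Bochner_Integration.integral_cong[OF refl]) (simp add: algebra_simps)
    also have "\<dots> = 0"
      using L2_mult_integrable[OF L2_shift[OF zD(1) t(1,2)] L2_shift[OF wD(1) t(1,2)]]
        L2_mult_integrable[OF L2_on_cell[OF zD(1)] L2_on_cell[OF wD(1)]] shift by simp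
    finally show ?case by (simp only: scaleR_add_right[symmetric] scaleR_zero_right)
  qed
  ultimately have "((\<lambda>t::real. 0) \<longlongrightarrow> ?int (\<lambda>x. z' x * w x) + ?int (\<lambda>x. w' x * z x) + 0) (at_right 0)"
    by (rule Lim_transform_eventually)
  from tendsto_unique[OF trivial_limit_at_right_real this tendsto_const]
  have "?int (\<lambda>x. z' x * w x) + ?int (\<lambda>x. w' x * z x) = 0" by simp
  then show ?thesis by (simp add: eq_neg_iff_add_eq_0 mult.commute)
qed

end

section \<open>Integration by parts in the two boundary cases\<close>

text \<open>The only point at which the boundary condition enters. Summing over the coordinate directions
  gives Green's first formula without a boundary term.\<close>

definition green_formula :: "'a::euclidean_space set \<Rightarrow> ('a \<Rightarrow> complex) \<Rightarrow> ('a \<Rightarrow> complex) \<Rightarrow> bool" where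
  "green_formula D v w \<longleftrightarrow> (\<forall>e\<in>Basis.
     integral\<^sup>L (lebesgue_on D) (\<lambda>x. weak_partial D e (weak_partial D e v) x * cnj (w x))
       = - integral\<^sup>L (lebesgue_on D) (\<lambda>x. weak_partial D e v x * cnj (weak_partial D e w x)))"

lemma H2D:
  assumes "v \<in> H2 U" "open U" "e \<in> Basis"
  shows "v \<in> H1 U" "v \<in> L2 U" "weak_partial U e v \<in> L2 U"
    "weak_partial U e (weak_partial U e v) \<in> L2 U"
    "is_weak_partial U e v (weak_partial U e v)"
    "is_weak_partial U e (weak_partial U e v) (weak_partial U e (weak_partial U e v))"
proof -
  show v: "v \<in> H1 U" using assms by (simp add: H2_def)
  have v': "weak_partial U e v \<in> H1 U" using assms by (simp add: H2_def)
  show "v \<in> L2 U" "weak_partial U e v \<in> L2 U" "is_weak_partial U e v (weak_partial U e v)"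
    by (rule H1D[OF v assms(2,3)])+
  show "weak_partial U e (weak_partial U e v) \<in> L2 U"
    "is_weak_partial U e (weak_partial U e v) (weak_partial U e (weak_partial U e v))"
    by (rule H1D[OF v' assms(2,3)])+
qed

lemma green_formula_Dirichlet:
  assumes D: "open D" and v: "v \<in> H2 D" and w: "w \<in> H1_0 D"
  shows "green_formula D v w"
  unfolding green_formula_def
proof
  fix e :: 'a assume e: "e \<in> Basis"
  show "integral\<^sup>L (lebesgue_on D) (\<lambda>x. weak_partial D e (weak_partial D e v) x * cnj (w x))
       = - integral\<^sup>L (lebesgue_on D) (\<lambda>x. weak_partial D e v x * cnj (weak_partial D e w x))"
    by (rule integration_by_parts_H1_0[OF D H2D(3,4,6)[OF v D e] w e])
qed

context period_cell
begin

text \<open>The translate of a weak derivative is a weak derivative of the translate, and weak derivatives are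
  unique.\<close>

lemma periodic_weak_partial:
  assumes p: "is_weak_partial U e v g" and per: "periodic v"
  shows "periodic g"
proof -
  have "is_weak_partial D e (\<lambda>x. v (x + L *\<^sub>R e)) (\<lambda>x. g (x + L *\<^sub>R e))"
    using L_gt_0 by (intro is_weak_partial_translate[OF p U(1) open_box _ e] cell_shift) auto
  then have "is_weak_partial D e v (\<lambda>x. g (x + L *\<^sub>R e))"
    by (rule is_weak_partial_cong_AE[OF _ D_measurable(1) e]) (use per in \<open>simp_all only: periodic_def AE_I2\<close>)
  from is_weak_partial_unique[OF this is_weak_partial_subset[OF p U(1) open_box D_subset_U e] open_box]
  show ?thesis by (simp add: periodic_def)
qed

lemma weak_pair_H1:
  assumes v: "v \<in> H1 U" "periodic v"
  shows "weak_pair v (weak_partial U e v)"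
  using H1D[OF v(1) U(1) e] v(2) periodic_weak_partial[OF H1D(2)[OF v(1) U(1) e] v(2)]
  by (simp add: weak_pair_def)

lemma weak_pair_cnj: "weak_pair v g \<Longrightarrow> weak_pair (\<lambda>x. cnj (v x)) (\<lambda>x. cnj (g x))"
  by (simp add: weak_pair_def periodic_def L2_cnj is_weak_partial_cnj[OF _ U_measurable(1) e])

end

text \<open>The formula is proved for the weak derivatives on a larger set, which are periodic up to a null set.
  On the cell they agree almost everywhere with the weak derivatives taken there.\<close>

lemma green_formula_periodic:
  fixes a b :: "'a::euclidean_space"
  assumes v: "v \<in> H2_per a b" and w: "w \<in> H2_per a b" and ne: "box a b \<noteq> {}"
  shows "green_formula (box a b) v w"
  unfolding green_formula_def
proof
  fix e :: 'a assume e: "e \<in> Basis"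
  obtain \<rho> where \<rho>: "box a b \<subseteq> ball 0 \<rho>"
    using bounded_subset_ballD[OF bounded_box] by blast
  define U where "U = ball (0::'a) (\<rho> + norm (b - a))"
  interpret period_cell a b e U
  proof
    show "e \<in> Basis" by (rule e)
    show "open U" "bounded U" by (auto simp: U_def)
    show "a \<bullet> e < b \<bullet> e" using ne e by (simp add: box_ne_empty)
    show "x + t *\<^sub>R e \<in> U" if "x \<in> box a b" "0 \<le> t" "t \<le> (b - a) \<bullet> e" for x t
    proof -
      have "norm (x + t *\<^sub>R e) \<le> norm x + norm (t *\<^sub>R e)" by (rule norm_triangle_ineq)
      moreover have "norm (t *\<^sub>R e) \<le> norm (b - a)"
        using that e Basis_le_norm[OF e, of "b - a"] by simp
      moreover have "norm x < \<rho>" using \<rho> that(1) by auto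
      ultimately show ?thesis by (simp add: U_def)
    qed
  qed
  have H2: "q \<in> H2 U" "q \<in> H2 D" "periodic q" if "q \<in> H2_per a b" for q
    using that e U open_box bounded_box by (auto simp: H2_per_def periodic_def)
  define z where "z = weak_partial U e v"
  define z' where "z' = weak_partial U e z"
  define w' where "w' = weak_partial U e w"
  have pv: "weak_pair v z"
    unfolding z_def by (rule weak_pair_H1[OF H2D(1)[OF H2(1)[OF v] U(1) e] H2(3)[OF v]])
  have pz: "weak_pair z z'"
    unfolding z'_def
  proof (rule weak_pair_H1)
    show "z \<in> H1 U" using H2(1)[OF v] e by (simp add: H2_def z_def)
    show "periodic z" using pv by (simp add: weak_pair_def)
  qed
  have pw: "weak_pair w w'"
    unfolding w'_def by (rule weak_pair_H1[OF H2D(1)[OF H2(1)[OF w] U(1) e] H2(3)[OF w]])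
  note sub = is_weak_partial_subset[OF _ U(1) open_box D_subset_U e]
  have v1: "AE x in lebesgue_on D. weak_partial D e v x = z x"
    by (rule weak_partial_eq[OF sub[OF weak_pairD(3)[OF pv]] open_box])
  have w1: "AE x in lebesgue_on D. weak_partial D e w x = w' x"
    by (rule weak_partial_eq[OF sub[OF weak_pairD(3)[OF pw]] open_box])
  have "is_weak_partial D e (weak_partial D e v) z'"
    using v1 by (intro is_weak_partial_cong_AE[OF sub[OF weak_pairD(3)[OF pz]] D_measurable(1) e])
      (auto elim: eventually_mono)
  then have v2: "AE x in lebesgue_on D. weak_partial D e (weak_partial D e v) x = z' x"
    by (rule weak_partial_eq[OF _ open_box])
  note vD = H2D[OF H2(2)[OF v] open_box e] and wD = H2D[OF H2(2)[OF w] open_box e]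
  note prod = borel_measurable_integrable[OF L2_mult_integrable]
  have "integral\<^sup>L (lebesgue_on D) (\<lambda>x. weak_partial D e (weak_partial D e v) x * cnj (w x))
      = integral\<^sup>L (lebesgue_on D) (\<lambda>x. z' x * cnj (w x))"
  proof (intro integral_cong_AE prod L2_cnj vD wD L2_on_cell)
    show "z' \<in> L2 U" by (rule weak_pairD(2)[OF pz])
    show "AE x in lebesgue_on D. weak_partial D e (weak_partial D e v) x * cnj (w x) = z' x * cnj (w x)"
      using v2 by eventually_elim simp
  qed
  also have "\<dots> = - integral\<^sup>L (lebesgue_on D) (\<lambda>x. z x * cnj (w' x))"
    by (rule periodic_integration_by_parts[OF pz weak_pair_cnj[OF pw]])
  also have "integral\<^sup>L (lebesgue_on D) (\<lambda>x. z x * cnj (w' x))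
      = integral\<^sup>L (lebesgue_on D) (\<lambda>x. weak_partial D e v x * cnj (weak_partial D e w x))"
  proof (intro integral_cong_AE prod L2_cnj vD wD L2_on_cell)
    show "z \<in> L2 U" "w' \<in> L2 U" by (rule weak_pairD(2)[OF pv] weak_pairD(2)[OF pw])+
    show "AE x in lebesgue_on D. z x * cnj (w' x) = weak_partial D e v x * cnj (weak_partial D e w x)"
      using v1 w1 by eventually_elim simp
  qed
  finally show "integral\<^sup>L (lebesgue_on D) (\<lambda>x. weak_partial D e (weak_partial D e v) x * cnj (w x))
       = - integral\<^sup>L (lebesgue_on D) (\<lambda>x. weak_partial D e v x * cnj (weak_partial D e w x))" .
qed

section \<open>The \<open>L2\<close> inner product\<close>

definition L2_inner :: "'a::euclidean_space set \<Rightarrow> ('a \<Rightarrow> complex) \<Rightarrow> ('a \<Rightarrow> complex) \<Rightarrow> complex" where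
  "L2_inner D v w = integral\<^sup>L (lebesgue_on D) (\<lambda>x. v x * cnj (w x))"

lemma L2_inner_integrable:
  "v \<in> L2 D \<Longrightarrow> w \<in> L2 D \<Longrightarrow> integrable (lebesgue_on D) (\<lambda>x. v x * cnj (w x))"
  by (rule L2_mult_integrable[OF _ L2_cnj])

lemma L2_inner_lin_left:
  assumes "v \<in> L2 D" "v' \<in> L2 D" "w \<in> L2 D"
  shows "L2_inner D (\<lambda>x. c * v x + d * v' x) w = c * L2_inner D v w + d * L2_inner D v' w"
  using L2_inner_integrable[OF assms(1,3)] L2_inner_integrable[OF assms(2,3)]
  by (simp add: L2_inner_def distrib_right mult.assoc)

lemma L2_inner_commute: "L2_inner D w v = cnj (L2_inner D v w)"
  by (simp add: L2_inner_def mult.commute flip: Bochner_Integration.integral_cnj)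

lemma L2_inner_lin_right:
  assumes "v \<in> L2 D" "w \<in> L2 D" "w' \<in> L2 D"
  shows "L2_inner D v (\<lambda>x. c * w x + d * w' x) = cnj c * L2_inner D v w + cnj d * L2_inner D v w'"
  using L2_inner_lin_left[OF assms(2,3,1), of c d]
  by (simp add: L2_inner_commute[of D v])

lemma L2_inner_self: "L2_inner D v v = complex_of_real ((L2_norm D v)\<^sup>2)"
  unfolding L2_inner_def L2_norm_power2 complex_norm_square[symmetric] by (simp del: of_real_power)

section \<open>The Laplacian\<close>

lemma L2_sum:
  "finite I \<Longrightarrow> (\<And>i. i \<in> I \<Longrightarrow> v i \<in> L2 U) \<Longrightarrow> (\<lambda>x. \<Sum>i\<in>I. v i x) \<in> L2 U"
proof (induction I rule: finite_induct)
  case empty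
  show ?case by (simp add: L2_def)
next
  case (insert i I)
  then show ?case using L2_add[of "v i" U "\<lambda>x. \<Sum>i\<in>I. v i x"] by simp
qed

lemma weak_laplacian_L2:
  assumes "v \<in> H2 D" "open D"
  shows "weak_laplacian D v \<in> L2 D"
  unfolding weak_laplacian_def[abs_def]
  by (intro L2_sum H2D(4)[OF assms]) auto

lemma weak_laplacian_lin:
  assumes v: "v \<in> H2 D" and w: "w \<in> H2 D" and D: "open D"
  shows "AE x in lebesgue_on D.
    weak_laplacian D (\<lambda>x. c * v x + d * w x) x = c * weak_laplacian D v x + d * weak_laplacian D w x"
proof -
  have Dm: "D \<in> sets lebesgue" using D by auto
  have "AE x in lebesgue_on D. weak_partial D e (weak_partial D e (\<lambda>x. c * v x + d * w x)) x
      = c * weak_partial D e (weak_partial D e v) x + d * weak_partial D e (weak_partial D e w) x"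
    if e: "e \<in> Basis" for e
  proof (rule weak_partial_eq[OF _ D])
    note 1 = is_weak_partial_lin[OF H2D(5)[OF v D e] H2D(5)[OF w D e] Dm e, of c d]
    note 2 = is_weak_partial_lin[OF H2D(6)[OF v D e] H2D(6)[OF w D e] Dm e, of c d]
    show "is_weak_partial D e (weak_partial D e (\<lambda>x. c * v x + d * w x))
      (\<lambda>x. c * weak_partial D e (weak_partial D e v) x + d * weak_partial D e (weak_partial D e w) x)"
      using weak_partial_eq[OF 1 D]
      by (intro is_weak_partial_cong_AE[OF 2 Dm e]) (auto elim: eventually_mono)
  qed
  then have "AE x in lebesgue_on D. \<forall>e\<in>Basis. weak_partial D e (weak_partial D e (\<lambda>x. c * v x + d * w x)) x
      = c * weak_partial D e (weak_partial D e v) x + d * weak_partial D e (weak_partial D e w) x"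
    by (subst AE_finite_all) auto
  then show ?thesis
    by eventually_elim (simp add: weak_laplacian_def sum.distrib sum_distrib_left)
qed

definition gradient_inner :: "'a::euclidean_space set \<Rightarrow> ('a \<Rightarrow> complex) \<Rightarrow> ('a \<Rightarrow> complex) \<Rightarrow> complex" where
  "gradient_inner D v w = (\<Sum>e\<in>Basis. L2_inner D (weak_partial D e v) (weak_partial D e w))"

lemma laplacian_inner:
  assumes g: "green_formula D v w" and v: "v \<in> H2 D" and w: "w \<in> L2 D" and D: "open D"
  shows "L2_inner D (weak_laplacian D v) w = - gradient_inner D v w"
proof -
  have "L2_inner D (weak_laplacian D v) w
      = (\<Sum>e\<in>Basis. L2_inner D (weak_partial D e (weak_partial D e v)) w)"
    unfolding L2_inner_def weak_laplacian_def sum_distrib_right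
    by (intro Bochner_Integration.integral_sum L2_inner_integrable H2D(4)[OF v D] w)
  also have "\<dots> = (\<Sum>e\<in>Basis. - L2_inner D (weak_partial D e v) (weak_partial D e w))"
    using g by (intro sum.cong) (auto simp: green_formula_def L2_inner_def)
  finally show ?thesis by (simp add: gradient_inner_def sum_negf)
qed

lemma gradient_inner_self:
  "v \<in> H1 D \<Longrightarrow> open D \<Longrightarrow> gradient_inner D v v = complex_of_real ((grad_L2_norm D v)\<^sup>2)"
  by (simp add: gradient_inner_def L2_inner_self grad_L2_norm_power2)

lemma gradient_inner_commute: "gradient_inner D w v = cnj (gradient_inner D v w)"
  unfolding gradient_inner_def cnj_sum by (intro sum.cong refl L2_inner_commute)

section \<open>The nonlinearity\<close>

lemma primF_nonpos: "s \<le> 0 \<Longrightarrow> primF f s = 0"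
  by (cases "s = 0") (auto simp: primF_def)

text \<open>Monotonicity gives both the measurability of the potential energy density and its boundedness for
  a bounded function.\<close>

lemma mono_primF:
  assumes "continuous_on {0..} f" "\<And>s. s \<ge> 0 \<Longrightarrow> f s \<ge> 0"
  shows "mono (primF f)"
proof (rule monoI)
  fix x y :: real assume "x \<le> y"
  have int: "f integrable_on {0..s}" for s
    by (intro integrable_continuous_interval continuous_on_subset[OF assms(1)]) auto
  have "primF f y \<ge> 0"
    unfolding primF_def by (intro Henstock_Kurzweil_Integration.integral_nonneg int assms(2)) auto
  moreover have "primF f x \<le> primF f y" if "x \<ge> 0"
    unfolding primF_def using \<open>x \<le> y\<close>
    by (intro integral_subset_le int) (auto intro: assms(2))
  ultimately show "primF f x \<le> primF f y"
    using primF_nonpos[of x f] by (cases "x \<ge> 0") auto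
qed

lemma primF_nonneg:
  assumes "continuous_on {0..} f" "\<And>s. s \<ge> 0 \<Longrightarrow> f s \<ge> 0"
  shows "0 \<le> primF f s"
proof (cases "s \<ge> 0")
  case True
  then show ?thesis using monoD[OF mono_primF[OF assms] True] by (simp add: primF_nonpos)
qed (simp add: primF_nonpos)

text \<open>The discrete chain rule. It takes the place of \<open>F(\<rho>)' = f(\<rho>) \<rho>'\<close> for the density \<open>\<rho>\<close> and is the reason
  for the form of the nonlinear term in the scheme.\<close>

lemma diffG_times_difference: "diffG f a b * (a - b) = primF f a - primF f b"
  by (simp add: diffG_def)

lemma potential_integrable:
  assumes f: "continuous_on {0..} f" "\<And>s. s \<ge> 0 \<Longrightarrow> f s \<ge> 0"
    and v: "v \<in> Linf D" and D: "D \<in> lmeasurable"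
  shows "integrable (lebesgue_on D) (\<lambda>x. primF f ((norm (v x))\<^sup>2))"
proof -
  interpret finite_measure "lebesgue_on D" by (rule finite_measure_lebesgue_on[OF D])
  obtain C where C: "AE x in lebesgue_on D. norm (v x) \<le> C" and vm: "v \<in> borel_measurable (lebesgue_on D)"
    using v by (auto simp: Linf_def)
  show ?thesis
  proof (rule integrable_const_bound[where B="primF f (C\<^sup>2)"])
    show "AE x in lebesgue_on D. norm (primF f ((norm (v x))\<^sup>2)) \<le> primF f (C\<^sup>2)"
      using C
    proof eventually_elim
      case (elim x)
      have "primF f ((norm (v x))\<^sup>2) \<le> primF f (C\<^sup>2)"
        by (intro monoD[OF mono_primF[OF f]] power_mono elim) auto
      then show ?case using primF_nonneg[OF f] by simp
    qed
    show "(\<lambda>x. primF f ((norm (v x))\<^sup>2)) \<in> borel_measurable (lebesgue_on D)"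
      using vm by (intro measurable_compose[OF _ borel_measurable_mono[OF mono_primF[OF f]]]) measurable
  qed
qed

section \<open>One step of the scheme\<close>

text \<open>The scheme is tested with \<open>s + r\<close>, taking imaginary parts, for the mass, and with \<open>s - r\<close>, taking
  real parts, for the energy.\<close>

lemma crank_nicolson_step:
  fixes r s :: "'a::euclidean_space \<Rightarrow> complex" and lam \<tau> :: real
  assumes D: "open D" "D \<in> lmeasurable" and r: "r \<in> H2 D" "r \<in> Linf D" and s: "s \<in> H2 D" "s \<in> Linf D"
    and green: "\<And>v w. v \<in> {r, s} \<Longrightarrow> w \<in> {r, s} \<Longrightarrow> green_formula D v w"
    and f: "continuous_on {0..} f" "\<And>s. s \<ge> 0 \<Longrightarrow> f s \<ge> 0" and \<tau>: "\<tau> > 0"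
    and scheme: "AE x in lebesgue_on D. \<i> * ((s x - r x) / complex_of_real \<tau>)
           = - weak_laplacian D (\<lambda>x. (s x + r x) / 2) x
             + complex_of_real (lam * diffG f ((norm (s x))\<^sup>2) ((norm (r x))\<^sup>2)) * ((s x + r x) / 2)"
  shows "mass D s = mass D r" "energy D lam f s = energy D lam f r"
proof -
  have Dm: "D \<in> sets lebesgue" using D by auto
  have e0: "(SOME e. e \<in> Basis) \<in> (Basis :: 'a set)" by (rule SOME_Basis)
  note rL = H2D(1,2)[OF r(1) D(1) e0] and sL = H2D(1,2)[OF s(1) D(1) e0]
  note lr = weak_laplacian_L2[OF r(1) D(1)] and ls = weak_laplacian_L2[OF s(1) D(1)]
  let ?G = "\<lambda>x. diffG f ((norm (s x))\<^sup>2) ((norm (r x))\<^sup>2)"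
  define p where "p x = 1 * s x + 1 * r x" for x
  define q where "q x = 1 * s x + (- 1) * r x" for x
  define l where "l x = (1 / 2) * weak_laplacian D s x + (1 / 2) * weak_laplacian D r x" for x
  \<comment> \<open>By the scheme, \<open>Q\<close> is the nonlinear term. This expression shows that it is square integrable.\<close>
  define Q where "Q x = (\<i> / complex_of_real \<tau>) * q x + 1 * l x" for x
  have pL: "p \<in> L2 D" and qL: "q \<in> L2 D" and lL: "l \<in> L2 D"
    unfolding p_def[abs_def] q_def[abs_def] l_def[abs_def] by (intro L2_add L2_cmult rL sL lr ls)+
  have QL: "Q \<in> L2 D" unfolding Q_def[abs_def] by (intro L2_add L2_cmult qL lL)
  have "(\<lambda>x. (s x + r x) / 2) = (\<lambda>x. (1 / 2) * s x + (1 / 2) * r x)"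
    by (simp add: fun_eq_iff add_divide_distrib)
  with weak_laplacian_lin[OF s(1) r(1) D(1), of "1 / 2" "1 / 2"]
  have lap: "AE x in lebesgue_on D. weak_laplacian D (\<lambda>x. (s x + r x) / 2) x = l x"
    by (simp add: l_def)
  have Q: "AE x in lebesgue_on D. Q x = complex_of_real (lam * ?G x / 2) * p x"
    using scheme lap
  proof eventually_elim
    case (elim x)
    have "Q x = \<i> * ((s x - r x) / complex_of_real \<tau>) + l x" by (simp add: Q_def q_def)
    also have "\<dots> = complex_of_real (lam * ?G x) * ((s x + r x) / 2)" unfolding elim by simp
    finally show ?case by (simp add: p_def)
  qed
  let ?B = "L2_inner D" and ?E = "gradient_inner D"
  have lap_inner: "?B (weak_laplacian D v) w = - ?E v w" if "v \<in> {r, s}" "w \<in> {r, s}" for v w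
    using laplacian_inner[OF green[OF that] _ _ D(1)] that r s rL sL by auto
  have "?B l w = - (?E s w + ?E r w) / 2" if w: "w \<in> {r, s}" for w
  proof -
    have wL: "w \<in> L2 D" using w sL rL by auto
    have "?B l w = (1 / 2) * ?B (weak_laplacian D s) w + (1 / 2) * ?B (weak_laplacian D r) w"
      unfolding l_def[abs_def] by (rule L2_inner_lin_left[OF ls lr wL])
    then show ?thesis using lap_inner[of s w] lap_inner[of r w] w by simp
  qed
  then have Bl: "?B l s = - (?E s s + ?E r s) / 2" "?B l r = - (?E s r + ?E r r) / 2"
    by blast+
  have Bpq: "?B l p = ?B l s + ?B l r" "?B l q = ?B l s - ?B l r"
    unfolding p_def[abs_def] q_def[abs_def] 
    using L2_inner_lin_right[OF lL sL(2) rL(2), of 1 1] L2_inner_lin_right[OF lL sL(2) rL(2), of 1 "-1"]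
    by simp_all
  have lp: "?B l p = - (?E s s + ?E r s + ?E s r + ?E r r) / 2"
    and lq: "?B l q = - (?E s s + ?E r s - ?E s r - ?E r r) / 2"
    unfolding Bpq Bl by (simp_all add: field_simps)
  have Qp: "?B Q p = (\<i> / of_real \<tau>) * ?B q p + ?B l p" and Qq: "?B Q q = (\<i> / of_real \<tau>) * ?B q q + ?B l q"
    unfolding Q_def[abs_def] 
    using L2_inner_lin_left[OF qL lL pL, of "\<i> / of_real \<tau>" 1] L2_inner_lin_left[OF qL lL qL, of "\<i> / of_real \<tau>" 1]
    by simp_all
  have qp: "?B q p = ?B s s - ?B r r + (?B s r - cnj (?B s r))"
  proof -
    have "?B q p = ?B q s + ?B q r"
      unfolding p_def[abs_def] using L2_inner_lin_right[OF qL sL(2) rL(2), of 1 1] by simp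
    moreover have "?B q w = ?B s w - ?B r w" if "w \<in> L2 D" for w
      unfolding q_def[abs_def] using L2_inner_lin_left[OF sL(2) rL(2) that, of 1 "-1"] by simp
    ultimately show ?thesis using sL rL L2_inner_commute[of D r s] by simp
  qed
  note Es = gradient_inner_self[OF sL(1) D(1)] and Er = gradient_inner_self[OF rL(1) D(1)]
  have Ers: "?E r s = cnj (?E s r)" by (rule gradient_inner_commute)
  have int: "?B Q w = integral\<^sup>L (lebesgue_on D) (\<lambda>x. Q x * cnj (w x))"
    "integrable (lebesgue_on D) (\<lambda>x. Q x * cnj (w x))" if "w \<in> L2 D" for w
    using L2_inner_integrable[OF QL that] by (simp_all add: L2_inner_def)

  have "Im (?B Q p) = integral\<^sup>L (lebesgue_on D) (\<lambda>x. Im (Q x * cnj (p x)))"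
    unfolding int(1)[OF pL] by (rule integral_Im[symmetric, OF int(2)[OF pL]])
  also have "\<dots> = 0"
  proof (rule integral_eq_zero_AE)
    show "AE x in lebesgue_on D. Im (Q x * cnj (p x)) = 0"
      using Q
    proof eventually_elim
      case (elim x)
      show ?case unfolding elim mult.assoc complex_norm_square[symmetric] of_real_mult[symmetric] by (rule Im_complex_of_real)
    qed
  qed
  finally have "Im (?B Q p) = 0" .
  moreover have "Im (?B l p) = 0"
    unfolding lp Es Er Ers by simp
  moreover have "Im ((\<i> / of_real \<tau>) * ?B q p) = ((L2_norm D s)\<^sup>2 - (L2_norm D r)\<^sup>2) / \<tau>"
    unfolding qp L2_inner_self by simp
  ultimately have "((L2_norm D s)\<^sup>2 - (L2_norm D r)\<^sup>2) / \<tau> = 0"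
    unfolding Qp plus_complex.sel by linarith
  then show "mass D s = mass D r" using \<tau> by (simp add: mass_def)

  let ?F = "\<lambda>v. integral\<^sup>L (lebesgue_on D) (\<lambda>x. primF f ((norm (v x))\<^sup>2))"
  have Fi: "integrable (lebesgue_on D) (\<lambda>x. primF f ((norm (s x))\<^sup>2))"
    "integrable (lebesgue_on D) (\<lambda>x. primF f ((norm (r x))\<^sup>2))"
    using potential_integrable[OF f s(2) D(2)] potential_integrable[OF f r(2) D(2)] by simp_all
  have "Re (?B Q q) = integral\<^sup>L (lebesgue_on D) (\<lambda>x. Re (Q x * cnj (q x)))"
    unfolding int(1)[OF qL] by (rule integral_Re[symmetric, OF int(2)[OF qL]])
  also have "\<dots> = integral\<^sup>L (lebesgue_on D) (\<lambda>x. lam / 2 * (primF f ((norm (s x))\<^sup>2) - primF f ((norm (r x))\<^sup>2)))"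
  proof (rule integral_cong_AE)
    show "(\<lambda>x. Re (Q x * cnj (q x))) \<in> borel_measurable (lebesgue_on D)"
      by (rule borel_measurable_integrable[OF integrable_Re[OF int(2)[OF qL]]])
    show "(\<lambda>x. lam / 2 * (primF f ((norm (s x))\<^sup>2) - primF f ((norm (r x))\<^sup>2))) \<in> borel_measurable (lebesgue_on D)"
      using Fi by (intro borel_measurable_integrable) simp
    show "AE x in lebesgue_on D. Re (Q x * cnj (q x)) = lam / 2 * (primF f ((norm (s x))\<^sup>2) - primF f ((norm (r x))\<^sup>2))"
      using Q
    proof eventually_elim
      case (elim x)
      have "Re (p x * cnj (q x)) = (norm (s x))\<^sup>2 - (norm (r x))\<^sup>2"
        unfolding cmod_power2 by (simp add: p_def q_def algebra_simps power2_eq_square)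
      moreover have "Re (complex_of_real c * y * z) = c * Re (y * z)" for c y z
        by (simp add: algebra_simps)
      ultimately have "Re (Q x * cnj (q x)) = lam * ?G x / 2 * ((norm (s x))\<^sup>2 - (norm (r x))\<^sup>2)"
        unfolding elim by metis
      also have "\<dots> = lam / 2 * (?G x * ((norm (s x))\<^sup>2 - (norm (r x))\<^sup>2))" by simp
      finally show ?case unfolding diffG_times_difference .
    qed
  qed
  also have "\<dots> = lam / 2 * (?F s - ?F r)" using Fi by simp
  finally have "lam * (?F s - ?F r) = 2 * Re (?B Q q)" by simp
  also have "Re (?B Q q) = Re ((\<i> / of_real \<tau>) * ?B q q) + Re (?B l q)"
    unfolding Qq plus_complex.sel ..
  also have "Re (?B l q) = - ((grad_L2_norm D s)\<^sup>2 - (grad_L2_norm D r)\<^sup>2) / 2"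
    unfolding lq Es Er Ers by simp
  also have "Re ((\<i> / of_real \<tau>) * ?B q q) = 0"
    unfolding L2_inner_self by simp
  finally have "lam * (?F s - ?F r) = - ((grad_L2_norm D s)\<^sup>2 - (grad_L2_norm D r)\<^sup>2)"
    by simp
  moreover have "L1_norm D (\<lambda>x. primF f ((norm (v x))\<^sup>2)) = ?F v"
    for v :: "'a \<Rightarrow> complex"
    using primF_nonneg[OF f] by (simp add: L1_norm_def)
  ultimately show "energy D lam f s = energy D lam f r"
    by (simp add: energy_def algebra_simps)
qed

section \<open>Conservation of mass and energy\<close>

theorem lemma5p1:
  fixes D :: "'a::euclidean_space set"
    and f :: "real \<Rightarrow> real"
    and k :: nat
    and \<beta> :: "nat \<Rightarrow> real"
    and lam \<tau> :: real
    and R :: "nat \<Rightarrow> 'a \<Rightarrow> complex"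
    and u :: "int \<Rightarrow> 'a \<Rightarrow> complex"
    and N :: enat
  assumes dim: "DIM('a) \<in> {1, 2, 3}"
    and domain: "open D" "connected D" "bounded D" "D \<noteq> {}"
    and f_cont: "continuous_on {0..} f"
    and f_nonneg: "\<And>s. s \<ge> 0 \<Longrightarrow> f s \<ge> 0"
    and k: "k \<ge> 1"
    and \<beta>0: "\<beta> 0 \<noteq> 0"
    and lam: "lam \<in> {1, -1}"
    and \<tau>: "\<tau> > 0"
    and boundary:
      "(\<forall>n. enat n \<le> N \<longrightarrow> R n \<in> H2 D \<inter> H1_0 D \<inter> Linf D) \<or>
       (\<exists>a b. D = box a b \<and> (\<forall>n. enat n \<le> N \<longrightarrow> R n \<in> H2_per a b \<inter> Linf D))"
    and R_u: "\<And>n. enat n \<le> N \<Longrightarrow>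
       AE x in lebesgue_on D. R n x = (\<Sum>j<k. complex_of_real (\<beta> j) * u (int n - int j) x)"
    and scheme_R: "\<And>n. enat n < N \<Longrightarrow>
       AE x in lebesgue_on D.
         \<i> * ((R (Suc n) x - R n x) / complex_of_real \<tau>)
           = - weak_laplacian D (midpoint_step R n) x
             + complex_of_real (lam * diffG f ((norm (R (Suc n) x))\<^sup>2) ((norm (R n x))\<^sup>2))
               * midpoint_step R n x"
    and scheme_u: "\<And>n. enat n < N \<Longrightarrow>
       AE x in lebesgue_on D.
         u (int n + 1) x
           = inverse (complex_of_real (\<beta> 0))
             * (R (Suc n) x - (\<Sum>j\<in>{1..<k}. complex_of_real (\<beta> j) * u (int n + 1 - int j) x))"
  shows "\<forall>n\<ge>1. enat n \<le> N \<longrightarrow>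
           mass D (R n) = mass D (R 0) \<and> energy D lam f (R n) = energy D lam f (R 0)"
proof -
  have D: "D \<in> lmeasurable" using domain by (intro lmeasurable_open)
  have R: "R n \<in> H2 D \<and> R n \<in> Linf D" if "enat n \<le> N" for n
    using boundary
  proof
    assume "\<exists>a b. D = box a b \<and> (\<forall>n. enat n \<le> N \<longrightarrow> R n \<in> H2_per a b \<inter> Linf D)"
    then show ?thesis using that domain by (auto simp: H2_per_def)
  qed (use that in auto)
  have green: "green_formula D (R n) (R m)" if "enat n \<le> N" "enat m \<le> N" for n m
    using boundary
  proof
    assume "\<forall>n. enat n \<le> N \<longrightarrow> R n \<in> H2 D \<inter> H1_0 D \<inter> Linf D"
    then show ?thesis using that by (intro green_formula_Dirichlet domain) auto
  next
    assume "\<exists>a b. D = box a b \<and> (\<forall>n. enat n \<le> N \<longrightarrow> R n \<in> H2_per a b \<inter> Linf D)"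
    then obtain a b where "D = box a b" "\<And>n. enat n \<le> N \<Longrightarrow> R n \<in> H2_per a b" by auto
    then show ?thesis using that domain by (auto intro!: green_formula_periodic)
  qed
  have step: "mass D (R (Suc n)) = mass D (R n) \<and> energy D lam f (R (Suc n)) = energy D lam f (R n)"
    if n: "enat n < N" for n
  proof -
    have le: "enat n \<le> N" "enat (Suc n) \<le> N" using n by (auto simp: Suc_ile_eq)
    have eq: "AE x in lebesgue_on D. \<i> * ((R (Suc n) x - R n x) / complex_of_real \<tau>)
           = - weak_laplacian D (\<lambda>x. (R (Suc n) x + R n x) / 2) x
             + complex_of_real (lam * diffG f ((norm (R (Suc n) x))\<^sup>2) ((norm (R n x))\<^sup>2))
               * ((R (Suc n) x + R n x) / 2)"
      using scheme_R[OF n] unfolding midpoint_step_def[abs_def] .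
    have "green_formula D v w" if "v \<in> {R n, R (Suc n)}" "w \<in> {R n, R (Suc n)}" for v w
      using that green le by auto
    from crank_nicolson_step[OF domain(1) D _ _ _ _ this f_cont f_nonneg \<tau> eq] R[OF le(1)] R[OF le(2)]
    show ?thesis by simp
  qed
  have "enat n \<le> N \<longrightarrow> mass D (R n) = mass D (R 0) \<and> energy D lam f (R n) = energy D lam f (R 0)" for n
  proof (induction n)
    case (Suc n)
    show ?case
    proof
      assume "enat (Suc n) \<le> N"
      then have "enat n < N" by (simp add: Suc_ile_eq)
      then show "mass D (R (Suc n)) = mass D (R 0) \<and> energy D lam f (R (Suc n)) = energy D lam f (R 0)"
        using step[of n] Suc.IH by simp
    qed
  qed simp
  then show ?thesis by blast
qed

end
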